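(* Let $h:\Omega\to\Omega'$ be a homeomorphism between two minimal aperiodic tiling spaces in $\mathbb{R}^d$ with finite local complexity (FLC), with $\Omega$ uniquely ergodic with invariant probability measure $\mu$. Then the $d\times d$ matrix $C_\mu([h])$ is invertible.
   Context: **Tiling spaces.** A tile is a convex polytope in $\mathbb{R}^d$ with non-empty interior, possibly carrying a label in a compact metric space; the set of prototiles (tiles up to translation) is compact. A tiling is a collection of tiles covering $\mathbb{R}^d$, any two of which meet only along their boundaries. A Delone set is a uniformly discrete and relatively dense subset of $\mathbb{R}^d$, possibly labelled. Tilings and labelled Delone sets are used interchangeably. $\mathbb{R}^d$ acts by translation, $T\mapsto T-x$. The patch $T\cap B(x,R)$ is the set of labelled tiles meeting $B(x,R)$ (for Delone sets: labelled points in $B(x,R)$). Two tilings (Delone sets) are $\varepsilon$-close if on a ball of radius about $1/\varepsilon$ around the origin there is a one-to-one correspondence between their tiles (points), corresponding tiles being $\varepsilon$-close in Hausdorff distance (points being $\varepsilon$-close) with $\varepsilon$-close labels. A tiling space is a compact translation-invariant set of tilings (or labelled Delone sets). It is minimal if every $\mathbb{R}^d$-orbit is dense, aperiodic if $T-x=T$ implies $x=0$ for each of its elements, uniquely ergodic if it carries exactly one translation-invariant Borel probability measure, FLC if for each $R$ there are finitely many patches of radius $R$ up to translation. **FLC transversals.** The canonical transversal of a space of Delone sets is the set of its elements containing the origin. A local derivation between FLC tiling spaces is a continuous onto map $\phi$ with $\phi(T-x)=\phi(T)-x$ such that for all $r>0$ there is $R>0$ with: $T\cap B(0,R)=T'\cap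 B(0,R)$ implies $\phi(T)\cap B(0,r)=\phi(T')\cap B(0,r)$. An FLC transversal of $\Omega$ is $\mathcal{D}^{-1}(\Xi')$, where $\mathcal{D}:\Omega\to\Omega_0$ is a local derivation to a space of Delone sets with canonical transversal $\Xi'$. A function on $\Omega$ is transversally locally constant if its restriction to every FLC transversal is locally constant. **Strong cohomology.** A strong 1-cocycle is a continuous $\alpha:\Omega\times\mathbb{R}^d\to\mathbb{R}^d$ with $\alpha(T,x)+\alpha(T-x,y)=\alpha(T,x+y)$ and with $\alpha(\cdot,v)$ transversally locally constant for each $v$; it is a strong coboundary if $\alpha(T,v)=s(T-v)-s(T)$ with $s:\Omega\to\mathbb{R}^d$ continuous and transversally locally constant. The quotient $H^1_s(\Omega;\mathbb{R}^d)$ is canonically isomorphic to $\check H^1(\Omega;\mathbb{R}^d)$: on an open flow box $U=\{S-x: S\in\Xi, |x|<\varepsilon\}$ ($\Xi$ an FLC transversal) put $c_U(S-x)=\alpha(S,x)$; the differences $c_U-c_V$ on overlaps are locally constant and form the Čech cocycle. The fundamental shape class $[\mathcal{F}(\Omega)]$ is the class of $\mathcal{F}(T,v)=v$. **Class of a homeomorphism.** $[h]:=h^*[\mathcal{F}(\Omega')]\in\check H^1(\Omega;\mathbb{R}^d)\cong H^1_s(\Omega;\mathbb{R}^d)$, where $h^*$ is pullback in Čech cohomology. **Ruelle–Sullivan map.** For a class represented by a cocycle $\alpha$, $C_\mu([\alpha])$ is the linear map $v\mapsto\int_\Omega\alpha(T,v)\,d\mu(T)=\lim_{r\to\infty}r^{-d}\int_{C_r}\alpha(T-s,v)\,ds$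 (any $T$), with $C_r=[-r/2,r/2]^d$; it depends only on the class. *)

theory Defs
  imports "HOL-Probability.Probability"
begin

section \<open>Tilings and labelled Delone sets\<close>

text \<open>
  Tilings and labelled Delone sets are handled by one type. A pattern is a set of pairs
  (support, label); in a tiling the supports are polytopes, in a labelled Delone set they are
  singletons, the point \<open>p\<close> with label \<open>l\<close> being the pair \<open>({p}, l)\<close>.
\<close>

type_synonym ('d, 'l) ptile = "(real ^ 'd) set \<times> 'l"
type_synonym ('d, 'l) pattern = "('d, 'l) ptile set"

definition shift_tile :: "real ^ 'd \<Rightarrow> ('d::finite, 'l) ptile \<Rightarrow> ('d, 'l) ptile" where
  "shift_tile x t = ((\<lambda>p. p - x) ` fst t, snd t)"

text \<open>\<open>shift x T\<close> is the translate \<open>T - x\<close>.\<close>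

definition shift :: "real ^ 'd \<Rightarrow> ('d::finite, 'l) pattern \<Rightarrow> ('d, 'l) pattern" where
  "shift x T = shift_tile x ` T"

definition tile :: "('d::finite, 'l) ptile \<Rightarrow> bool" where
  "tile t \<longleftrightarrow> polytope (fst t) \<and> interior (fst t) \<noteq> {}"

definition tiling :: "('d::finite, 'l) pattern \<Rightarrow> bool" where
  "tiling T \<longleftrightarrow>
     (\<forall>t\<in>T. tile t) \<and>
     (\<Union>t\<in>T. fst t) = UNIV \<and>
     (\<forall>t\<in>T. \<forall>u\<in>T. t \<noteq> u \<longrightarrow> fst t \<inter> fst u \<subseteq> frontier (fst t) \<inter> frontier (fst u))"

definition relatively_dense :: "(real ^ 'd::finite) set \<Rightarrow> bool" where
  "relatively_dense X \<longleftrightarrow> (\<exists>R>0. \<forall>y. \<exists>x\<in>X. dist y x < R)"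

definition delone :: "('d::finite, 'l) pattern \<Rightarrow> bool" where
  "delone T \<longleftrightarrow>
     (\<exists>X lab. T = (\<lambda>p. ({p}, lab p)) ` X \<and> uniform_discrete X \<and> relatively_dense X)"

definition patch :: "('d::finite, 'l) pattern \<Rightarrow> real ^ 'd \<Rightarrow> real \<Rightarrow> ('d, 'l) pattern" where
  "patch T x R = {t \<in> T. fst t \<inter> ball x R \<noteq> {}}"


section \<open>Topology\<close>

text \<open>The topology whose neighbourhoods are given by a notion of being \<open>\<epsilon>\<close>-close.\<close>

definition closeness_topology :: "(real \<Rightarrow> 'a \<Rightarrow> 'a \<Rightarrow> bool) \<Rightarrow> 'a topology" where
  "closeness_topology close =
     topology (\<lambda>U. \<forall>x\<in>U. \<exists>\<epsilon>>0. \<forall>y. close \<epsilon> x y \<longrightarrow> y \<in> U)"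

lemma openin_closeness_topology:
  assumes mono: "\<And>\<epsilon> \<delta> x y. 0 < \<epsilon> \<Longrightarrow> \<epsilon> \<le> \<delta> \<Longrightarrow> close \<epsilon> x y \<Longrightarrow> close \<delta> x y"
  shows "openin (closeness_topology close) U \<longleftrightarrow>
           (\<forall>x\<in>U. \<exists>\<epsilon>>0. \<forall>y. close \<epsilon> x y \<longrightarrow> y \<in> U)"
proof -
  have "istopology (\<lambda>U. \<forall>x\<in>U. \<exists>\<epsilon>>0. \<forall>y. close \<epsilon> x y \<longrightarrow> y \<in> U)"
    unfolding istopology_def
  proof (intro conjI allI impI ballI)
    fix S T x
    assume S: "\<forall>x\<in>S. \<exists>\<epsilon>>0. \<forall>y. close \<epsilon> x y \<longrightarrow> y \<in> S"
      and T: "\<forall>x\<in>T. \<exists>\<epsilon>>0. \<forall>y. close \<epsilon> x y \<longrightarrow> y \<in> T" and x: "x \<in> S \<inter> T"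
    obtain a where a: "a > 0" "\<And>y. close a x y \<Longrightarrow> y \<in> S" using S x by blast
    obtain b where b: "b > 0" "\<And>y. close b x y \<Longrightarrow> y \<in> T" using T x by blast
    have "close a x y \<and> close b x y" if "close (min a b) x y" for y
      using mono[of "min a b" a x y] mono[of "min a b" b x y] a(1) b(1) that by auto
    then show "\<exists>\<epsilon>>0. \<forall>y. close \<epsilon> x y \<longrightarrow> y \<in> S \<inter> T"
      using a b by (intro exI[of _ "min a b"]) auto
  next
    fix \<K> x
    assume K: "\<forall>K\<in>\<K>. \<forall>x\<in>K. \<exists>\<epsilon>>0. \<forall>y. close \<epsilon> x y \<longrightarrow> y \<in> K" and "x \<in> \<Union>\<K>"
    then show "\<exists>\<epsilon>>0. \<forall>y. close \<epsilon> x y \<longrightarrow> y \<in> \<Union>\<K>" by (meson UnionE UnionI)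
  qed
  then show ?thesis by (simp add: closeness_topology_def)
qed

text \<open>Supports at Hausdorff distance less than \<open>\<epsilon>\<close> (for compact supports), and \<open>\<epsilon>\<close>-close labels.\<close>

definition tile_close ::
  "real \<Rightarrow> ('d::finite, 'l::metric_space) ptile \<Rightarrow> ('d, 'l) ptile \<Rightarrow> bool" where
  "tile_close \<epsilon> t u \<longleftrightarrow>
     (\<forall>p\<in>fst t. \<exists>q\<in>fst u. dist p q < \<epsilon>) \<and>
     (\<forall>q\<in>fst u. \<exists>p\<in>fst t. dist p q < \<epsilon>) \<and>
     dist (snd t) (snd u) < \<epsilon>"

text \<open>
  The bijection \<open>f\<close> pairs all tiles meeting the ball of radius \<open>1 / \<epsilon>\<close>; its domain and range
  may contain further tiles, since the partner of a tile that meets the ball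
  near its boundary need not meet the ball.
\<close>

definition pattern_close ::
  "real \<Rightarrow> ('d::finite, 'l::metric_space) pattern \<Rightarrow> ('d, 'l) pattern \<Rightarrow> bool" where
  "pattern_close \<epsilon> T T' \<longleftrightarrow>
     (\<exists>A A' f. patch T 0 (1 / \<epsilon>) \<subseteq> A \<and> A \<subseteq> T \<and> patch T' 0 (1 / \<epsilon>) \<subseteq> A' \<and> A' \<subseteq> T' \<and>
        bij_betw f A A' \<and> (\<forall>t\<in>A. tile_close \<epsilon> t (f t)))"

lemma tile_close_mono: "tile_close \<epsilon> t u \<Longrightarrow> \<epsilon> \<le> \<delta> \<Longrightarrow> tile_close \<delta> t u"
  unfolding tile_close_def by (meson order_less_le_trans)

lemma pattern_close_mono:
  assumes "0 < \<epsilon>" "\<epsilon> \<le> \<delta>" "pattern_close \<epsilon> T T'"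
  shows "pattern_close \<delta> T T'"
proof -
  have "1 / \<delta> \<le> 1 / \<epsilon>" using assms by (simp add: frac_le)
  then have sub: "patch S 0 (1 / \<delta>) \<subseteq> patch S 0 (1 / \<epsilon>)" for S :: "('a, 'b) pattern"
    using subset_ball[of "1 / \<delta>" "1 / \<epsilon>" "0 :: real ^ 'a"] unfolding patch_def by blast
  show ?thesis
    using assms(3) sub[of T] sub[of T'] tile_close_mono[OF _ assms(2)]
    unfolding pattern_close_def by (meson subset_trans)
qed

definition tile_topology :: "('d::finite, 'l::metric_space) ptile topology" where
  "tile_topology = closeness_topology tile_close"

definition pattern_topology :: "('d::finite, 'l::metric_space) pattern topology" where
  "pattern_topology = closeness_topology pattern_close"

lemma openin_tile_topology:
  "openin tile_topology U \<longleftrightarrow> (\<forall>t\<in>U. \<exists>\<epsilon>>0. \<forall>u. tile_close \<epsilon> t u \<longrightarrow> u \<in> U)"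
  unfolding tile_topology_def
  by (rule openin_closeness_topology) (rule tile_close_mono)

lemma openin_pattern_topology:
  "openin pattern_topology U \<longleftrightarrow> (\<forall>T\<in>U. \<exists>\<epsilon>>0. \<forall>S. pattern_close \<epsilon> T S \<longrightarrow> S \<in> U)"
  unfolding pattern_topology_def
  by (rule openin_closeness_topology) (rule pattern_close_mono)

lemma topspace_pattern_topology [simp]: "topspace pattern_topology = UNIV"
proof -
  have "openin pattern_topology (UNIV :: ('a, 'b) pattern set)"
    unfolding openin_pattern_topology using zero_less_one by blast
  then show ?thesis using openin_subset by blast
qed

abbreviation space_topology ::
  "('d::finite, 'l::metric_space) pattern set \<Rightarrow> ('d, 'l) pattern topology" where
  "space_topology \<Omega> \<equiv> subtopology pattern_topology \<Omega>"


section \<open>Tiling spaces\<close>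

text \<open>All tiles are translates of members of one compact set of tiles.\<close>

definition tilings_of_compact_prototiles ::
  "('d::finite, 'l::metric_space) pattern set \<Rightarrow> bool" where
  "tilings_of_compact_prototiles \<Omega> \<longleftrightarrow>
     (\<forall>T\<in>\<Omega>. tiling T) \<and>
     (\<exists>P. compactin tile_topology P \<and> (\<forall>p\<in>P. tile p) \<and>
        (\<forall>t\<in>\<Union>\<Omega>. \<exists>p\<in>P. \<exists>x. t = shift_tile x p))"

definition delone_sets_of_compact_labels ::
  "('d::finite, 'l::metric_space) pattern set \<Rightarrow> bool" where
  "delone_sets_of_compact_labels \<Omega> \<longleftrightarrow>
     (\<forall>T\<in>\<Omega>. delone T) \<and> (\<exists>L. compact L \<and> snd ` \<Union>\<Omega> \<subseteq> L)"

definition tiling_space :: "('d::finite, 'l::metric_space) pattern set \<Rightarrow> bool" where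
  "tiling_space \<Omega> \<longleftrightarrow>
     (tilings_of_compact_prototiles \<Omega> \<or> delone_sets_of_compact_labels \<Omega>) \<and>
     (\<forall>T\<in>\<Omega>. \<forall>x. shift x T \<in> \<Omega>) \<and>
     compactin pattern_topology \<Omega>"

definition minimal_space :: "('d::finite, 'l::metric_space) pattern set \<Rightarrow> bool" where
  "minimal_space \<Omega> \<longleftrightarrow>
     (\<forall>T\<in>\<Omega>. (space_topology \<Omega>) closure_of (range (\<lambda>x. shift x T)) = \<Omega>)"

definition aperiodic_space :: "('d::finite, 'l) pattern set \<Rightarrow> bool" where
  "aperiodic_space \<Omega> \<longleftrightarrow> (\<forall>T\<in>\<Omega>. \<forall>x. shift x T = T \<longrightarrow> x = 0)"

definition flc :: "('d::finite, 'l) pattern set \<Rightarrow> bool" where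
  "flc \<Omega> \<longleftrightarrow>
     (\<forall>R>0. \<exists>\<P>. finite \<P> \<and> (\<forall>T\<in>\<Omega>. \<forall>x. \<exists>P\<in>\<P>. \<exists>y. patch T x R = shift y P))"

definition invariant_prob ::
  "('d::finite, 'l::metric_space) pattern set \<Rightarrow> ('d, 'l) pattern measure \<Rightarrow> bool" where
  "invariant_prob \<Omega> \<mu> \<longleftrightarrow>
     prob_space \<mu> \<and>
     space \<mu> = \<Omega> \<and> sets \<mu> = sigma_sets \<Omega> {U. openin (space_topology \<Omega>) U} \<and>
     (\<forall>A\<in>sets \<mu>. \<forall>x. emeasure \<mu> (shift x ` A) = emeasure \<mu> A)"

text \<open>\<open>\<Omega>\<close> is uniquely ergodic and \<open>\<mu>\<close> is its invariant probability measure.\<close>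

definition uniquely_ergodic ::
  "('d::finite, 'l::metric_space) pattern set \<Rightarrow> ('d, 'l) pattern measure \<Rightarrow> bool" where
  "uniquely_ergodic \<Omega> \<mu> \<longleftrightarrow>
     invariant_prob \<Omega> \<mu> \<and> (\<forall>\<nu>. invariant_prob \<Omega> \<nu> \<longrightarrow> \<nu> = \<mu>)"


section \<open>FLC transversals\<close>

definition local_derivation ::
  "('d::finite, 'l::metric_space) pattern set \<Rightarrow> ('d, 'm::metric_space) pattern set
     \<Rightarrow> (('d, 'l) pattern \<Rightarrow> ('d, 'm) pattern) \<Rightarrow> bool" where
  "local_derivation \<Omega> \<Omega>\<^sub>0 \<phi> \<longleftrightarrow>
     continuous_map (space_topology \<Omega>) (space_topology \<Omega>\<^sub>0) \<phi> \<and>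
     \<phi> ` \<Omega> = \<Omega>\<^sub>0 \<and>
     (\<forall>T\<in>\<Omega>. \<forall>x. \<phi> (shift x T) = shift x (\<phi> T)) \<and>
     (\<forall>r>0. \<exists>R>0. \<forall>T\<in>\<Omega>. \<forall>T'\<in>\<Omega>.
        patch T 0 R = patch T' 0 R \<longrightarrow> patch (\<phi> T) 0 r = patch (\<phi> T') 0 r)"

definition canonical_transversal :: "('d::finite, 'l) pattern set \<Rightarrow> ('d, 'l) pattern set" where
  "canonical_transversal \<Omega>\<^sub>0 = {T \<in> \<Omega>\<^sub>0. \<exists>l. ({0}, l) \<in> T}"

text \<open>
  The labels of the Delone sets derived from \<open>\<Omega>\<close> are taken in \<^typ>\<open>real\<close>. This is no restriction:
  finite local complexity leaves only finitely many labels, and the unlabelled case is the one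
  of a constant label.
\<close>

definition flc_transversal ::
  "('d::finite, 'l::metric_space) pattern set \<Rightarrow> ('d, 'l) pattern set \<Rightarrow> bool" where
  "flc_transversal \<Omega> \<Xi> \<longleftrightarrow>
     (\<exists>(\<Omega>\<^sub>0 :: ('d, real) pattern set) \<D>.
        tiling_space \<Omega>\<^sub>0 \<and> (\<forall>S\<in>\<Omega>\<^sub>0. delone S) \<and> flc \<Omega>\<^sub>0 \<and> local_derivation \<Omega> \<Omega>\<^sub>0 \<D> \<and>
        \<Xi> = {T \<in> \<Omega>. \<D> T \<in> canonical_transversal \<Omega>\<^sub>0})"

definition locally_constant_on :: "'a topology \<Rightarrow> 'a set \<Rightarrow> ('a \<Rightarrow> 'b) \<Rightarrow> bool" where
  "locally_constant_on X A f \<longleftrightarrow>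
     (\<forall>x\<in>A. \<exists>N. openin X N \<and> x \<in> N \<and> (\<forall>y\<in>N \<inter> A. f y = f x))"

definition transversally_locally_constant ::
  "('d::finite, 'l::metric_space) pattern set \<Rightarrow> (('d, 'l) pattern \<Rightarrow> 'b) \<Rightarrow> bool" where
  "transversally_locally_constant \<Omega> f \<longleftrightarrow>
     (\<forall>\<Xi>. flc_transversal \<Omega> \<Xi> \<longrightarrow> locally_constant_on (space_topology \<Omega>) \<Xi> f)"


section \<open>Strong cohomology\<close>

type_synonym ('d, 'l) cochain = "('d, 'l) pattern \<Rightarrow> real ^ 'd \<Rightarrow> real ^ 'd"

definition strong_cocycle ::
  "('d::finite, 'l::metric_space) pattern set \<Rightarrow> ('d, 'l) cochain \<Rightarrow> bool" where
  "strong_cocycle \<Omega> \<alpha> \<longleftrightarrow>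
     continuous_map (prod_topology (space_topology \<Omega>) euclidean) euclidean (\<lambda>(T, x). \<alpha> T x) \<and>
     (\<forall>T\<in>\<Omega>. \<forall>x y. \<alpha> T x + \<alpha> (shift x T) y = \<alpha> T (x + y)) \<and>
     (\<forall>v. transversally_locally_constant \<Omega> (\<lambda>T. \<alpha> T v))"

definition strong_coboundary ::
  "('d::finite, 'l::metric_space) pattern set \<Rightarrow> ('d, 'l) cochain \<Rightarrow> bool" where
  "strong_coboundary \<Omega> \<alpha> \<longleftrightarrow>
     (\<exists>s. continuous_map (space_topology \<Omega>) euclidean s \<and>
          transversally_locally_constant \<Omega> s \<and>
          (\<forall>T\<in>\<Omega>. \<forall>v. \<alpha> T v = s (shift v T) - s T))"

definition strong_cohomologous ::
  "('d::finite, 'l::metric_space) pattern set \<Rightarrow> (('d, 'l) cochain \<times> ('d, 'l) cochain) set" where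
  "strong_cohomologous \<Omega> =
     {(\<alpha>, \<beta>). strong_cocycle \<Omega> \<alpha> \<and> strong_cocycle \<Omega> \<beta> \<and>
              strong_coboundary \<Omega> (\<lambda>T v. \<beta> T v - \<alpha> T v)}"

definition strong_H1 ::
  "('d::finite, 'l::metric_space) pattern set \<Rightarrow> ('d, 'l) cochain set set" where
  "strong_H1 \<Omega> = Collect (strong_cocycle \<Omega>) // strong_cohomologous \<Omega>"

definition fundamental_shape_class ::
  "('d::finite, 'l::metric_space) pattern set \<Rightarrow> ('d, 'l) cochain set" where
  "fundamental_shape_class \<Omega> = strong_cohomologous \<Omega> `` {\<lambda>T v. v}"


section \<open>First Cech cohomology\<close>

text \<open>
  Cech cohomology with coefficients in the constant sheaf of the abelian group \<open>'g\<close>, as the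
  direct limit over open covers. A cochain \<open>(I, U, g)\<close> consists of an indexed open cover and a
  locally constant function \<open>g i j\<close> on each overlap \<open>U i \<inter> U j\<close>.
\<close>

type_synonym ('i, 'a, 'g) cech = "'i set \<times> ('i \<Rightarrow> 'a set) \<times> ('i \<Rightarrow> 'i \<Rightarrow> 'a \<Rightarrow> 'g)"

definition cech_cocycle :: "'a topology \<Rightarrow> ('i, 'a, 'g::ab_group_add) cech \<Rightarrow> bool" where
  "cech_cocycle X = (\<lambda>(I, U, g).
     (\<forall>i\<in>I. openin X (U i)) \<and> (\<Union>i\<in>I. U i) = topspace X \<and>
     (\<forall>i\<in>I. \<forall>j\<in>I. locally_constant_on X (U i \<inter> U j) (g i j)) \<and>
     (\<forall>i\<in>I. \<forall>j\<in>I. \<forall>k\<in>I. \<forall>x \<in> U i \<inter> U j \<inter> U k. g i j x + g j k x = g i k x))"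

text \<open>
  Cohomologous in the direct limit: on a common refinement \<open>\<W>\<close> of the two covers, with
  refinement maps \<open>r\<close> and \<open>s\<close>, the cocycles differ by the coboundary of a locally constant
  0-cochain \<open>b\<close>. The two index types may differ.
\<close>

definition cech_cohomologous ::
  "'a topology \<Rightarrow> ('i, 'a, 'g::ab_group_add) cech \<Rightarrow> ('j, 'a, 'g) cech \<Rightarrow> bool" where
  "cech_cohomologous X = (\<lambda>(I, U, g) (J, V, k).
     \<exists>\<W> r s b.
       (\<forall>W\<in>\<W>. openin X W \<and> r W \<in> I \<and> W \<subseteq> U (r W) \<and> s W \<in> J \<and> W \<subseteq> V (s W) \<and>
                locally_constant_on X W (b W)) \<and>
       \<Union>\<W> = topspace X \<and>
       (\<forall>W\<in>\<W>. \<forall>W'\<in>\<W>. \<forall>x \<in> W \<inter> W'.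
          g (r W) (r W') x - k (s W) (s W') x = b W x - b W' x))"

text \<open>
  The members of a class use covers indexed by subsets of \<open>'a set\<close>. Every open cover is
  equivalent to the one indexed by its own members, so each cocycle, whatever
  its index type, has a class of this form.
\<close>

definition cech_class ::
  "'a topology \<Rightarrow> ('i, 'a, 'g::ab_group_add) cech \<Rightarrow> ('a set, 'a, 'g) cech set" where
  "cech_class X C = {D. cech_cocycle X D \<and> cech_cohomologous X C D}"

definition cech_pullback ::
  "'a topology \<Rightarrow> 'b topology \<Rightarrow> ('a \<Rightarrow> 'b) \<Rightarrow> ('b set, 'b, 'g::ab_group_add) cech set
     \<Rightarrow> ('a set, 'a, 'g) cech set" where
  "cech_pullback X Y h c =
     (\<Union>(I, U, g)\<in>c.
        cech_class X (I, \<lambda>i. {x \<in> topspace X. h x \<in> U i}, \<lambda>i j x. g i j (h x)))"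


section \<open>From strong cohomology to Cech cohomology\<close>

definition flow_box :: "('d::finite, 'l) pattern set \<Rightarrow> real \<Rightarrow> ('d, 'l) pattern set" where
  "flow_box \<Xi> \<epsilon> = (\<lambda>(S, x). shift x S) ` (\<Xi> \<times> ball 0 \<epsilon>)"

text \<open>
  The coordinates \<open>(S, x)\<close> of a point \<open>S - x\<close> of a flow box are required to be unique, so that
  \<open>c\<^sub>U (S - x) = \<alpha>(S, x)\<close> makes sense.
\<close>

definition open_flow_box ::
  "('d::finite, 'l::metric_space) pattern set \<Rightarrow> ('d, 'l) pattern set \<times> real \<Rightarrow> bool" where
  "open_flow_box \<Omega> = (\<lambda>(\<Xi>, \<epsilon>).
     flc_transversal \<Omega> \<Xi> \<and> \<epsilon> > 0 \<and>
     inj_on (\<lambda>(S, x). shift x S) (\<Xi> \<times> ball 0 \<epsilon>) \<and>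
     openin (space_topology \<Omega>) (flow_box \<Xi> \<epsilon>))"

definition flow_box_primitive ::
  "('d::finite, 'l) cochain \<Rightarrow> ('d, 'l) pattern set \<times> real \<Rightarrow> ('d, 'l) pattern \<Rightarrow> real ^ 'd" where
  "flow_box_primitive \<alpha> = (\<lambda>(\<Xi>, \<epsilon>) T.
     case inv_into (\<Xi> \<times> ball 0 \<epsilon>) (\<lambda>(S, x). shift x S) T of (S, x) \<Rightarrow> \<alpha> S x)"

definition cech_of_cocycle ::
  "('d::finite, 'l::metric_space) pattern set \<Rightarrow> ('d, 'l) cochain
     \<Rightarrow> (('d, 'l) pattern set \<times> real, ('d, 'l) pattern, real ^ 'd) cech" where
  "cech_of_cocycle \<Omega> \<alpha> =
     (Collect (open_flow_box \<Omega>), \<lambda>(\<Xi>, \<epsilon>). flow_box \<Xi> \<epsilon>,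
      \<lambda>i j T. flow_box_primitive \<alpha> i T - flow_box_primitive \<alpha> j T)"

text \<open>The canonical isomorphism from \<open>strong_H1 \<Omega>\<close> to the first Cech cohomology of \<open>\<Omega>\<close>.\<close>

definition strong_to_cech ::
  "('d::finite, 'l::metric_space) pattern set \<Rightarrow> ('d, 'l) cochain set
     \<Rightarrow> (('d, 'l) pattern set, ('d, 'l) pattern, real ^ 'd) cech set" where
  "strong_to_cech \<Omega> a = (\<Union>\<alpha>\<in>a. cech_class (space_topology \<Omega>) (cech_of_cocycle \<Omega> \<alpha>))"


section \<open>The class of a homeomorphism and the Ruelle--Sullivan map\<close>

text \<open>The class \<open>[h]\<close>, transported to strong cohomology along the canonical isomorphism.\<close>

definition homeo_class ::
  "('d::finite, 'l::metric_space) pattern set \<Rightarrow> ('d, 'm::metric_space) pattern set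
     \<Rightarrow> (('d, 'l) pattern \<Rightarrow> ('d, 'm) pattern) \<Rightarrow> ('d, 'l) cochain set" where
  "homeo_class \<Omega> \<Omega>' h =
     inv_into (strong_H1 \<Omega>) (strong_to_cech \<Omega>)
       (cech_pullback (space_topology \<Omega>) (space_topology \<Omega>') h
          (strong_to_cech \<Omega>' (fundamental_shape_class \<Omega>')))"

definition ruelle_sullivan ::
  "('d::finite, 'l) pattern measure \<Rightarrow> ('d, 'l) cochain set \<Rightarrow> real ^ 'd \<Rightarrow> real ^ 'd" where
  "ruelle_sullivan \<mu> a v = (\<integral>T. (SOME \<alpha>. \<alpha> \<in> a) T v \<partial>\<mu>)"

end

theory Submission
  imports Defs
begin

text \<open>
  Finite local complexity makes a tiling space locally the product of a totally disconnected
  transversal and a ball: the elements near \<open>T\<close> are those that agree on a large ball with a small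
  translate of \<open>T\<close> (\<open>openin_iff_nbd\<close>), and a function is transversally locally constant if and only if
  its value at \<open>T\<close> is determined by a patch of \<open>T\<close> (\<open>transversally_locally_constant_iff\<close>).

  Hence a continuous map \<open>h\<close> sends orbits into orbits, and aperiodicity of the target gives a cocycle
  \<open>c\<close> with \<open>h (T - z) = h T - c(T, z)\<close>, which grows at most linearly in \<open>z\<close> by compactness. For a
  homeomorphism the cocycle of the inverse undoes \<open>c\<close>, so that \<open>|z| \<le> C |c(T, z)| + C\<close>
  (\<open>orbit_cocycle_lower_bound\<close>).

  The cocycle \<open>c\<close> represents the class of \<open>h\<close> up to a bounded coboundary. In a flow box of the target,
  \<open>c\<close> is the increment of the coordinate along the leaves, so the pullback of the fundamental shape
  class is the Cech class of the differences of these coordinates. A partition of unity corrects \<open>c\<close>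
  to a strong cocycle with the same Cech class (\<open>strong_representative\<close>), which shows that the class of
  \<open>h\<close> does come from strong cohomology (\<open>homeo_class_members\<close>); and any strong cocycle with this Cech
  class is at a bounded distance from \<open>c\<close> (\<open>cohomologous_imp_bounded_difference\<close>). So every representative
  \<open>\<alpha>\<close> of the class satisfies \<open>|z| \<le> C |\<alpha>(T, z)| + C\<close> for some \<open>C\<close>.

  Suppose now that \<open>\<alpha>(\<cdot>, v)\<close> has mean zero. A uniquely ergodic measure is ergodic, and by the mean
  ergodic theorem some average of translates of \<open>\<alpha>(\<cdot>, v)\<close> is small in \<open>L\<^sup>1\<close>
  (\<open>averages_tendsto_mean\<close>). Summed along \<open>T, T - v, \<dots>, T - (L - 1) v\<close>, the average reproduces
  \<open>\<alpha>(T, L v)\<close> up to an error independent of \<open>L\<close>. Thus for each \<open>L\<close> there is a \<open>T\<close> for which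
  \<open>\<alpha>(T, L v)\<close> is small compared to \<open>L\<close>, which contradicts the lower bound unless \<open>v = 0\<close>
  (\<open>mean_cocycle_kernel_trivial\<close>). So the linear map of the Ruelle--Sullivan class is injective.
\<close>


section \<open>Translation and agreement of patterns\<close>

lemma fst_shift_tile: "fst (shift_tile x t) = (\<lambda>p. p - x) ` fst t"
  and snd_shift_tile: "snd (shift_tile x t) = snd t"
  by (simp_all add: shift_tile_def)

lemma shift_tile_0 [simp]: "shift_tile 0 t = t"
  by (simp add: shift_tile_def)

lemma shift_tile_shift_tile [simp]: "shift_tile x (shift_tile y t) = shift_tile (x + y) t"
  by (simp add: shift_tile_def image_image algebra_simps)

lemma inj_shift_tile: "inj (shift_tile x)"
  by (rule inj_on_inverseI[where g = "shift_tile (- x)"]) simp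

lemma shift_0 [simp]: "shift 0 T = T"
  by (simp add: shift_def)

lemma shift_shift [simp]: "shift x (shift y T) = shift (x + y) T"
  by (simp add: shift_def image_image)

lemma patch_shift: "patch (shift x T) y R = shift x (patch T (x + y) R)"
proof -
  have "(\<lambda>p. p - x) ` K \<inter> ball y R \<noteq> {} \<longleftrightarrow> K \<inter> ball (x + y) R \<noteq> {}" for K
  proof -
    have "p - x \<in> ball y R \<longleftrightarrow> p \<in> ball (x + y) R" for p
      by (simp add: dist_norm algebra_simps)
    then show ?thesis by blast
  qed
  note meets = this
  have "patch (shift x T) y R = shift_tile x ` {t \<in> T. fst (shift_tile x t) \<inter> ball y R \<noteq> {}}"
    unfolding patch_def shift_def by blast
  then show ?thesis by (simp only: fst_shift_tile meets) (simp add: patch_def shift_def)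
qed

definition agree :: "real \<Rightarrow> ('d::finite, 'l) pattern \<Rightarrow> ('d, 'l) pattern \<Rightarrow> bool" where
  "agree R S T \<longleftrightarrow> patch S 0 R = patch T 0 R"

lemma agree_refl [simp]: "agree R T T"
  by (simp add: agree_def)

lemma agree_patch:
  assumes "agree R S T" "norm x + r \<le> R"
  shows "patch S x r = patch T x r"
proof -
  have "ball x r \<subseteq> ball 0 R"
    using assms(2) by (simp add: ball_subset_ball_iff dist_norm)
  then have "patch U x r = {t \<in> patch U 0 R. fst t \<inter> ball x r \<noteq> {}}" for U :: "('a, 'b) pattern"
    unfolding patch_def by blast
  then show ?thesis using assms(1) by (simp add: agree_def)
qed

lemma agree_mono: "agree R S T \<Longrightarrow> r \<le> R \<Longrightarrow> agree r S T"
  using agree_patch[of R S T 0 r] by (simp add: agree_def)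

lemma agree_shift:
  assumes "agree R S T" "norm x + r \<le> R"
  shows "agree r (shift x S) (shift x T)"
  using agree_patch[OF assms] by (simp add: agree_def patch_shift)

lemma agree_shiftD:
  assumes "agree R S (shift x T)" "norm x + r \<le> R"
  shows "agree r (shift (- x) S) T"
  using agree_shift[of R S "shift x T" "- x" r] assms by simp

lemma agree_all_imp_eq:
  assumes "\<And>R. R > 0 \<Longrightarrow> agree R S T" and "\<And>t. t \<in> S \<union> T \<Longrightarrow> fst t \<noteq> {}"
  shows "S = T"
proof -
  have "\<exists>R>0. t \<in> patch U 0 R" if "t \<in> U" "U = S \<or> U = T" for t U
  proof -
    obtain p where "p \<in> fst t" using assms(2)[of t] \<open>t \<in> U\<close> \<open>U = S \<or> U = T\<close> by blast
    then have "t \<in> patch U 0 (norm p + 1)" using \<open>t \<in> U\<close> by (auto simp: patch_def)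
    moreover have "norm p + 1 > 0" by (simp add: add_nonneg_pos)
    ultimately show ?thesis by blast
  qed
  then have "t \<in> S \<longleftrightarrow> t \<in> T" for t
    using assms(1) unfolding agree_def patch_def by blast
  then show ?thesis by blast
qed


section \<open>Topologies given by a notion of closeness\<close>

text \<open>
  The balls of a closeness relation are neighbourhoods of their centres as soon as a weak triangle
  inequality holds: the points with a smaller ball inside the given one form an open set.
\<close>

lemma closeness_ball_nhd:
  assumes mono: "\<And>\<epsilon> \<delta> x y. 0 < \<epsilon> \<Longrightarrow> \<epsilon> \<le> \<delta> \<Longrightarrow> close \<epsilon> x y \<Longrightarrow> close \<delta> x y"
    and tri: "\<And>\<epsilon>. 0 < \<epsilon> \<Longrightarrow> \<exists>\<delta>>0. \<forall>x y z. close \<delta> x y \<longrightarrow> close \<delta> y z \<longrightarrow> close \<epsilon> x z"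
  shows "openin (closeness_topology close) {x. \<exists>\<epsilon>>0. \<forall>y. close \<epsilon> x y \<longrightarrow> y \<in> V}"
proof -
  have iff: "openin (closeness_topology close) U \<longleftrightarrow> (\<forall>x\<in>U. \<exists>\<epsilon>>0. \<forall>y. close \<epsilon> x y \<longrightarrow> y \<in> U)" for U
    by (rule openin_closeness_topology) (rule mono)
  show ?thesis
    unfolding iff
  proof clarify
    fix x \<epsilon> assume \<epsilon>: "\<epsilon> > 0" "\<forall>y. close \<epsilon> x y \<longrightarrow> y \<in> V"
    obtain \<delta> where "\<delta> > 0" "\<forall>x y z. close \<delta> x y \<longrightarrow> close \<delta> y z \<longrightarrow> close \<epsilon> x z"
      using tri[OF \<epsilon>(1)] by blast
    then have "\<exists>\<epsilon>>0. \<forall>z. close \<epsilon> y z \<longrightarrow> z \<in> V" if "close \<delta> x y" for y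
      using \<epsilon>(2) that by blast
    then show "\<exists>\<epsilon>>0. \<forall>y. close \<epsilon> x y \<longrightarrow> y \<in> {x. \<exists>\<epsilon>>0. \<forall>y. close \<epsilon> x y \<longrightarrow> y \<in> V}"
      using \<open>\<delta> > 0\<close> by blast
  qed
qed

lemma compactin_finite_closeness_cover:
  assumes mono: "\<And>\<epsilon> \<delta> x y. 0 < \<epsilon> \<Longrightarrow> \<epsilon> \<le> \<delta> \<Longrightarrow> close \<epsilon> x y \<Longrightarrow> close \<delta> x y"
    and tri: "\<And>\<epsilon>. 0 < \<epsilon> \<Longrightarrow> \<exists>\<delta>>0. \<forall>x y z. close \<delta> x y \<longrightarrow> close \<delta> y z \<longrightarrow> close \<epsilon> x z"
    and refl: "\<And>\<epsilon> x. 0 < \<epsilon> \<Longrightarrow> close \<epsilon> x x"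
    and K: "compactin (closeness_topology close) K"
    and e: "\<And>x. x \<in> K \<Longrightarrow> e x > 0"
  obtains F where "finite F" "F \<subseteq> K" "\<And>y. y \<in> K \<Longrightarrow> \<exists>x\<in>F. close (e x) x y"
proof -
  define V where "V x = {z. \<exists>\<epsilon>>0. \<forall>y. close \<epsilon> z y \<longrightarrow> y \<in> {y. close (e x) x y}}" for x
  have "openin (closeness_topology close) (V x)" for x
    unfolding V_def by (rule closeness_ball_nhd) (rule mono, assumption+, rule tri, assumption)
  then have op: "\<forall>U\<in>V ` K. openin (closeness_topology close) U" by blast
  have "x \<in> V x" if "x \<in> K" for x
    using e[OF that] by (auto simp: V_def)
  then have "K \<subseteq> \<Union>(V ` K)" by blast
  then obtain \<F> where \<F>: "finite \<F>" "\<F> \<subseteq> V ` K" "K \<subseteq> \<Union>\<F>"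
    using K op unfolding compactin_def by meson
  obtain F where F: "F \<subseteq> K" "finite F" "\<F> = V ` F"
    using finite_subset_image[OF \<F>(1,2)] by blast
  have "\<exists>x\<in>F. close (e x) x y" if y: "y \<in> K" for y
  proof -
    obtain x where x: "x \<in> F" "y \<in> V x" using \<F>(3) F(3) y by blast
    then obtain \<epsilon> where "\<epsilon> > 0" "\<forall>z. close \<epsilon> y z \<longrightarrow> close (e x) x z" by (auto simp: V_def)
    then show ?thesis using refl x(1) by blast
  qed
  then show thesis using that F by blast
qed

lemma tile_close_refl: "\<epsilon> > 0 \<Longrightarrow> tile_close \<epsilon> t t"
  unfolding tile_close_def by (metis dist_self)

lemma tile_close_trans: "tile_close a t u \<Longrightarrow> tile_close b u w \<Longrightarrow> tile_close (a + b) t w"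
  unfolding tile_close_def by (meson add_strict_mono dist_triangle le_less_trans)

lemma tile_close_sym: "tile_close a t u \<Longrightarrow> tile_close a u t"
  unfolding tile_close_def by (metis dist_commute)

lemma tile_close_shift_tile: "norm x < a \<Longrightarrow> tile_close a t (shift_tile x t)"
proof -
  assume "norm x < a"
  then have d: "dist p (p - x) < a" for p by (simp add: dist_norm)
  have "0 < a" using \<open>norm x < a\<close> norm_ge_zero[of x] by linarith
  then show ?thesis
    unfolding tile_close_def fst_shift_tile snd_shift_tile 
  proof (intro conjI ballI)
    fix p assume "p \<in> fst t"
    then show "\<exists>q\<in>(\<lambda>p. p - x) ` fst t. dist p q < a" using d[of p] by blast
  next
    fix q assume "q \<in> (\<lambda>p. p - x) ` fst t"
    then obtain p where "p \<in> fst t" "q = p - x" by blast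
    then show "\<exists>p\<in>fst t. dist p q < a" using d[of p] by blast
  next
    show "dist (snd t) (snd t) < a" using \<open>0 < a\<close> by simp
  qed
qed

lemma tile_close_meets_ball:
  assumes "tile_close \<epsilon> t u" "fst t \<inter> ball 0 r \<noteq> {}"
  shows "fst u \<inter> ball 0 (r + \<epsilon>) \<noteq> {}"
proof -
  obtain p where p: "p \<in> fst t" "norm p < r" using assms(2) by auto
  obtain q where q: "q \<in> fst u" "dist p q < \<epsilon>" using assms(1) p(1) unfolding tile_close_def by blast
  have "norm q < r + \<epsilon>" using norm_triangle_sub[of q p] p q by (simp add: dist_norm norm_minus_commute)
  then show ?thesis using q(1) by auto
qed

lemma pattern_close_refl: "\<epsilon> > 0 \<Longrightarrow> pattern_close \<epsilon> T T"
  unfolding pattern_close_def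
  by (rule exI[of _ T], rule exI[of _ T], rule exI[of _ id])
    (auto simp: patch_def tile_close_refl)

lemma pattern_close_trans:
  assumes "\<epsilon> > 0"
  shows "\<exists>\<delta>>0. \<forall>T S U. pattern_close \<delta> T S \<longrightarrow> pattern_close \<delta> S U \<longrightarrow> pattern_close \<epsilon> T U"
proof -
  \<comment> \<open>A partner of a tile meeting the ball of radius \<open>1 / \<epsilon>\<close> meets the ball of radius \<open>1 / \<epsilon> + \<delta>\<close>.\<close>
  define \<delta> where "\<delta> = 1 / (1 / \<epsilon> + 2 / \<epsilon> + 1)"
  have d0: "\<delta> > 0" using assms by (simp add: \<delta>_def add_pos_pos)
  have inv: "1 / \<delta> = 1 / \<epsilon> + 2 / \<epsilon> + 1" by (simp add: \<delta>_def)
  have "1 \<le> 1 / \<epsilon> + 2 / \<epsilon> + 1" using assms by simp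
  then have "1 \<le> 1 / \<delta>" by (simp only: inv)
  then have d1: "\<delta> \<le> 1" using d0 by (simp add: field_simps)
  have "0 < 1 / \<epsilon>" using assms by simp
  then have "2 / \<epsilon> \<le> 1 / \<delta>" unfolding inv by linarith
  then have d2: "2 * \<delta> \<le> \<epsilon>" using assms d0 by (simp add: field_simps)
  have r: "1 / \<epsilon> + \<delta> \<le> 1 / \<delta>" "1 / \<epsilon> \<le> 1 / \<delta>"
    unfolding inv using d1 \<open>0 < 1 / \<epsilon>\<close> by linarith+
  have "pattern_close \<epsilon> T U" if TS: "pattern_close \<delta> T S" and SU: "pattern_close \<delta> S U"
    for T S U :: "('a, 'b) pattern"
  proof -
    obtain A A' f where f: "patch T 0 (1 / \<delta>) \<subseteq> A" "A \<subseteq> T" "patch S 0 (1 / \<delta>) \<subseteq> A'" "A' \<subseteq> S"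
      "bij_betw f A A'" "\<forall>t\<in>A. tile_close \<delta> t (f t)"
      using TS unfolding pattern_close_def by blast
    obtain B B' g where g: "patch S 0 (1 / \<delta>) \<subseteq> B" "B \<subseteq> S" "patch U 0 (1 / \<delta>) \<subseteq> B'" "B' \<subseteq> U"
      "bij_betw g B B'" "\<forall>t\<in>B. tile_close \<delta> t (g t)"
      using SU unfolding pattern_close_def by blast
    define C where "C = {t \<in> A. f t \<in> B}"
    have meets: "fst t \<inter> ball 0 (1 / \<delta>) \<noteq> {}" if "fst t \<inter> ball 0 (1 / \<epsilon> + \<delta>) \<noteq> {}"
      for t :: "('a, 'b) ptile"
      using that subset_ball[OF r(1), of 0] by blast
    have meets': "fst t \<inter> ball 0 (1 / \<delta>) \<noteq> {}" if "fst t \<inter> ball 0 (1 / \<epsilon>) \<noteq> {}"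
      for t :: "('a, 'b) ptile"
      using that subset_ball[OF r(2), of 0] by blast
    have fA: "f ` A = A'" "inj_on f A" and gB: "g ` B = B'" "inj_on g B"
      using f(5) g(5) by (auto simp: bij_betw_def)
    show ?thesis
      unfolding pattern_close_def
    proof (intro exI conjI)
      show "patch T 0 (1 / \<epsilon>) \<subseteq> C"
      proof
        fix t assume "t \<in> patch T 0 (1 / \<epsilon>)"
        then have t: "t \<in> T" "fst t \<inter> ball 0 (1 / \<epsilon>) \<noteq> {}" by (auto simp: patch_def)
        then have tA: "t \<in> A" using f(1) meets'[OF t(2)] t(1) unfolding patch_def by blast
        then have "fst (f t) \<inter> ball 0 (1 / \<delta>) \<noteq> {}"
          using tile_close_meets_ball[of \<delta> t "f t" "1 / \<epsilon>"] f(6) t(2) meets by blast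
        then have "f t \<in> B" using g(1) f(4) fA tA by (auto simp: patch_def)
        then show "t \<in> C" using tA by (simp add: C_def)
      qed
      show "patch U 0 (1 / \<epsilon>) \<subseteq> (g \<circ> f) ` C"
      proof
        fix u assume "u \<in> patch U 0 (1 / \<epsilon>)"
        then have u: "u \<in> U" "fst u \<inter> ball 0 (1 / \<epsilon>) \<noteq> {}" by (auto simp: patch_def)
        then have "u \<in> B'" using g(3) meets'[OF u(2)] u(1) unfolding patch_def by blast
        then obtain s where s: "s \<in> B" "u = g s" using gB by blast
        have "fst s \<inter> ball 0 (1 / \<delta>) \<noteq> {}"
          using tile_close_meets_ball[OF tile_close_sym, of \<delta> s u "1 / \<epsilon>"] g(6) s u(2) meets by blast
        then have "s \<in> A'" using f(3) g(2) s(1) by (auto simp: patch_def)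
        then obtain t where "t \<in> A" "s = f t" using fA by blast
        then show "u \<in> (g \<circ> f) ` C" using s by (auto simp: C_def)
      qed
      show "C \<subseteq> T" using f(2) by (auto simp: C_def)
      show "(g \<circ> f) ` C \<subseteq> U" using gB g(4) by (auto simp: C_def)
      have "inj_on (g \<circ> f) C"
        by (rule comp_inj_on) (auto intro: inj_on_subset[OF fA(2)] inj_on_subset[OF gB(2)] simp: C_def)
      then show "bij_betw (g \<circ> f) C ((g \<circ> f) ` C)" by (simp add: bij_betw_def)
      show "\<forall>t\<in>C. tile_close \<epsilon> t ((g \<circ> f) t)"
      proof
        fix t assume "t \<in> C"
        then have "tile_close (\<delta> + \<delta>) t (g (f t))"
          using f(6) g(6) by (intro tile_close_trans[of \<delta> t "f t"]) (simp_all add: C_def)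
        then show "tile_close \<epsilon> t ((g \<circ> f) t)" using d2 tile_close_mono by fastforce
      qed
    qed
  qed
  then show ?thesis using d0 by blast
qed

lemma pattern_close_if_agree_shift:
  assumes "agree R S (shift x T)" "norm x < \<epsilon>" "1 / \<epsilon> + norm x \<le> R"
  shows "pattern_close \<epsilon> T S"
proof -
  define A where "A = {t \<in> T. shift_tile x t \<in> patch S 0 R}"
  have e: "\<epsilon> > 0" using assms(2) norm_ge_zero[of x] by linarith
  have S: "patch S 0 R = patch (shift x T) 0 R" using assms(1) by (simp add: agree_def)
  show ?thesis
    unfolding pattern_close_def
  proof (intro exI conjI)
    show "patch T 0 (1 / \<epsilon>) \<subseteq> A"
    proof
      fix t assume t: "t \<in> patch T 0 (1 / \<epsilon>)"
      then obtain p where p: "p \<in> fst t" "norm p < 1 / \<epsilon>" by (auto simp: patch_def)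
      have "norm (p - x) < R" using norm_triangle_ineq4[of p x] p assms(3) by linarith
      then have "fst (shift_tile x t) \<inter> ball 0 R \<noteq> {}" using p(1) by (auto simp: fst_shift_tile)
      moreover have "t \<in> T" using t by (simp add: patch_def)
      ultimately have "shift_tile x t \<in> patch S 0 R" unfolding S by (simp add: patch_def shift_def)
      then show "t \<in> A" using \<open>t \<in> T\<close> by (simp add: A_def)
    qed
    show "A \<subseteq> T" by (auto simp: A_def)
    have "1 / \<epsilon> \<le> R" using assms(3) norm_ge_zero[of x] by linarith
    then show "patch S 0 (1 / \<epsilon>) \<subseteq> patch S 0 R"
      using subset_ball[of "1 / \<epsilon>" R 0] by (auto simp: patch_def)
    show "patch S 0 R \<subseteq> S" by (auto simp: patch_def)
    have "shift_tile x ` A = patch S 0 R"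
      unfolding A_def S unfolding patch_def shift_def by blast
    then show "bij_betw (shift_tile x) A (patch S 0 R)"
      using inj_shift_tile by (auto simp: bij_betw_def intro: inj_on_subset)
    show "\<forall>t\<in>A. tile_close \<epsilon> t (shift_tile x t)" using tile_close_shift_tile[OF assms(2)] by blast
  qed
qed


section \<open>An equivariant reference point\<close>

text \<open>
  The lowest corner of the smallest axis-parallel box around \<open>K\<close>. It follows translations of \<open>K\<close> and is
  Lipschitz for the Hausdorff distance; so a translate of \<open>K\<close> that is close to \<open>K\<close> is a translate by a
  small vector.
\<close>

definition corner :: "(real ^ 'd::finite) set \<Rightarrow> real ^ 'd" where
  "corner K = (\<chi> i. INF p\<in>K. p $ i)"

lemma bdd_below_component: "bounded (K :: (real ^ 'd::finite) set) \<Longrightarrow> bdd_below ((\<lambda>p. p $ i) ` K)"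
proof -
  assume "bounded K"
  then obtain B where B: "\<And>p. p \<in> K \<Longrightarrow> norm p \<le> B" using bounded_iff by blast
  have "- B \<le> p $ i" if "p \<in> K" for p
    using component_le_norm_cart[of p i] B[OF that] by linarith
  then show ?thesis by (intro bdd_belowI2)
qed

lemma corner_translate:
  assumes "bounded K" "K \<noteq> {}"
  shows "corner ((\<lambda>p. p - x) ` K) = corner K - x"
proof -
  have "(INF p\<in>K. p $ i - x $ i) = (INF p\<in>K. p $ i) - x $ i" for i
  proof -
    have "Inf ((\<lambda>p. p $ i) ` K) - x $ i = (INF s\<in>(\<lambda>p. p $ i) ` K. s - x $ i)"
      by (rule continuous_at_Inf_mono)
        (auto simp: mono_def assms bdd_below_component intro!: continuous_intros)
    then show ?thesis by (simp add: image_image)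
  qed
  then show ?thesis by (simp add: corner_def vec_eq_iff image_image)
qed

lemma corner_close:
  fixes K L :: "(real ^ 'd::finite) set" and \<delta> :: real
  assumes "bounded K" "K \<noteq> {}" "bounded L" "L \<noteq> {}"
    and KL: "\<And>p. p \<in> K \<Longrightarrow> \<exists>q\<in>L. dist p q < \<delta>" and LK: "\<And>q. q \<in> L \<Longrightarrow> \<exists>p\<in>K. dist p q < \<delta>"
  shows "norm (corner K - corner L) \<le> CARD('d) * \<delta>"
proof -
  have le: "(INF p\<in>K. p $ i) - \<delta> \<le> (INF q\<in>L. q $ i)"
    if "bounded K" "L \<noteq> {}" and LK: "\<And>q. q \<in> L \<Longrightarrow> \<exists>p\<in>K. dist p q < \<delta>"
    for K L :: "(real ^ 'd) set" and i
  proof (rule cINF_greatest[OF \<open>L \<noteq> {}\<close>])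
    fix q assume "q \<in> L"
    then obtain p where p: "p \<in> K" "dist p q < \<delta>" using LK by blast
    have "(INF p\<in>K. p $ i) \<le> p $ i" by (rule cINF_lower[OF bdd_below_component[OF that(1)] p(1)])
    moreover have "\<bar>p $ i - q $ i\<bar> < \<delta>"
      using dist_vec_nth_le[of p i q] p(2) by (simp add: dist_real_def)
    ultimately show "(INF p\<in>K. p $ i) - \<delta> \<le> q $ i" by linarith
  qed
  have comp: "\<bar>(corner K - corner L) $ i\<bar> \<le> \<delta>" for i
    using le[OF assms(1,4) LK, of i] le[OF assms(3,2), of i] KL
    by (simp add: corner_def dist_commute abs_le_iff)
  have "norm (corner K - corner L) \<le> (\<Sum>i\<in>UNIV. \<bar>(corner K - corner L) $ i\<bar>)"
    by (rule norm_le_l1_cart)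
  also have "\<dots> \<le> (\<Sum>i\<in>(UNIV :: 'd set). \<delta>)" by (rule sum_mono) (rule comp)
  finally show ?thesis by simp
qed

lemma tile_close_all_imp_eq:
  assumes "compact (fst t)" "compact (fst u)" "\<And>\<delta>. \<delta> > 0 \<Longrightarrow> tile_close \<delta> t u"
  shows "t = u"
proof -
  have sub: "K \<subseteq> L" if "closed L" "\<And>\<delta> p. \<delta> > 0 \<Longrightarrow> p \<in> K \<Longrightarrow> \<exists>q\<in>L. dist p q < \<delta>"
    for K L :: "(real ^ 'a) set"
    using that closure_approachable[of _ L] by (metis closure_closed dist_commute subsetI)
  have "fst t \<subseteq> fst u"
    by (rule sub) (use assms in \<open>auto simp: compact_imp_closed tile_close_def\<close>)
  moreover have "fst u \<subseteq> fst t"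
    by (rule sub) (use assms in \<open>auto simp: compact_imp_closed tile_close_def dist_commute\<close>)
  moreover have "snd t = snd u"
  proof (rule ccontr)
    assume "snd t \<noteq> snd u"
    then have "tile_close (dist (snd t) (snd u)) t u" using assms(3) by simp
    then show False by (simp add: tile_close_def)
  qed
  ultimately show ?thesis by (simp add: prod_eq_iff)
qed


section \<open>Finite local complexity and the topology of a tiling space\<close>

lemma finite_positive_lower_bound:
  assumes "finite F" "\<And>x. x \<in> F \<Longrightarrow> f x > (0 :: real)"
  obtains r where "r > 0" "\<And>x. x \<in> F \<Longrightarrow> r \<le> f x"
proof
  show "Min (insert 1 (f ` F)) > 0" using assms by simp
  show "Min (insert 1 (f ` F)) \<le> f x" if "x \<in> F" for x using assms(1) that by simp
qed

text \<open>
  A point of \<open>ball c r\<close> outside \<open>L\<close> would be separated from \<open>L\<close> by a hyperplane, and moving it by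
  \<open>r\<close> away from \<open>L\<close> would give a point of \<open>ball c (2 * r)\<close> at distance at least \<open>r\<close> from \<open>L\<close>.
\<close>

lemma ball_subset_convex_if_close:
  fixes L :: "'a::euclidean_space set"
  assumes L: "convex L" "closed L" and "r > 0"
    and close: "\<And>p. p \<in> ball c (2 * r) \<Longrightarrow> \<exists>q\<in>L. dist p q < r"
  shows "ball c r \<subseteq> L"
proof
  fix a assume a: "a \<in> ball c r"
  show "a \<in> L"
  proof (rule ccontr)
    assume "a \<notin> L"
    then obtain n b where n: "n \<bullet> a < b" "\<And>x. x \<in> L \<Longrightarrow> n \<bullet> x > b"
      using separating_hyperplane_closed_point[OF L, of a] by blast
    define p where "p = a - (r / norm n) *\<^sub>R n"
    have "norm ((r / norm n) *\<^sub>R n) \<le> r" using \<open>r > 0\<close> by simp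
    then have "dist a p \<le> r" by (simp add: p_def dist_norm)
    then have "p \<in> ball c (2 * r)" using a dist_triangle[of c p a] by simp
    then obtain q where q: "q \<in> L" "dist p q < r" using close by blast
    have "n \<noteq> 0" using n(1) n(2)[OF q(1)] by auto
    then have "n \<bullet> p = n \<bullet> a - r * norm n"
      by (simp add: p_def inner_diff_right power2_norm_eq_inner[symmetric] power2_eq_square)
    moreover have "n \<bullet> (q - p) \<le> norm n * norm (q - p)" by (rule norm_cauchy_schwarz)
    moreover have "norm n * norm (q - p) \<le> norm n * r"
      using q(2) by (intro mult_left_mono) (auto simp: dist_norm norm_minus_commute)
    ultimately have "n \<bullet> q \<le> n \<bullet> a" by (simp add: inner_diff_right mult.commute)
    then show False using n q(1) by fastforce
  qed
qed

text \<open>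
  Compactness of the set of prototiles bounds the tiles: a convex body close to a given one contains
  a ball of half the radius.
\<close>

lemma tilings_of_compact_prototiles_bounds:
  fixes \<Omega> :: "('d::finite, 'l::metric_space) pattern set"
  assumes "tilings_of_compact_prototiles \<Omega>"
  obtains r D where "r > 0"
    and "\<And>T t. T \<in> \<Omega> \<Longrightarrow> t \<in> T \<Longrightarrow> \<exists>c. ball c r \<subseteq> fst t"
    and "\<And>T t p q. T \<in> \<Omega> \<Longrightarrow> t \<in> T \<Longrightarrow> p \<in> fst t \<Longrightarrow> q \<in> fst t \<Longrightarrow> dist p q \<le> D"
proof -
  obtain P where P: "compactin tile_topology P" "\<And>p. p \<in> P \<Longrightarrow> tile p"
    "\<And>t. t \<in> \<Union>\<Omega> \<Longrightarrow> \<exists>p\<in>P. \<exists>x. t = shift_tile x p"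
    using assms unfolding tilings_of_compact_prototiles_def by meson
  have "\<exists>r>0. \<exists>c. ball c (2 * r) \<subseteq> fst p" if p: "p \<in> P" for p
  proof -
    obtain c where "c \<in> interior (fst p)" using P(2)[OF p] by (auto simp: tile_def)
    then obtain e where "e > 0" "ball c e \<subseteq> fst p"
      using mem_interior by blast
    then show ?thesis by (intro exI[of _ "e / 2"]) auto
  qed
  then obtain r c where rc: "\<And>p. p \<in> P \<Longrightarrow> r p > 0" "\<And>p. p \<in> P \<Longrightarrow> ball (c p) (2 * r p) \<subseteq> fst p"
    by metis
  have "tile_close \<delta> x z"
    if "tile_close (\<delta> / 2) x y" "tile_close (\<delta> / 2) y z" for \<delta> and x y z :: "('d, 'l) ptile"
    using tile_close_trans[OF that] by simp
  then have tri: "0 < \<epsilon> \<Longrightarrow> \<exists>\<delta>>0. \<forall>x y z :: ('d, 'l) ptile.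
      tile_close \<delta> x y \<longrightarrow> tile_close \<delta> y z \<longrightarrow> tile_close \<epsilon> x z" for \<epsilon>
    by (intro exI[of _ "\<epsilon> / 2"]) auto
  obtain F where F: "finite F" "F \<subseteq> P" "\<And>u. u \<in> P \<Longrightarrow> \<exists>p\<in>F. tile_close (r p) p u"
    by (rule compactin_finite_closeness_cover[OF _ tri tile_close_refl P(1)[unfolded tile_topology_def] rc(1)])
      (auto elim: tile_close_mono)
  obtain r0 where r0: "r0 > 0" "\<And>p. p \<in> F \<Longrightarrow> r0 \<le> r p"
    using finite_positive_lower_bound[OF F(1), of r] rc(1) F(2) by blast
  define D where "D = (\<Sum>p\<in>F. diameter (fst p) + 2 * r p)"
  have poly: "compact (fst p)" "convex (fst p)" if "p \<in> P" for p
    using P(2)[OF that] by (auto simp: tile_def polytope_imp_compact polytope_imp_convex)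
  have in_ball: "\<exists>c. ball c r0 \<subseteq> fst u" and diam: "\<And>a b. a \<in> fst u \<Longrightarrow> b \<in> fst u \<Longrightarrow> dist a b \<le> D"
    if u: "u \<in> P" for u
  proof -
    obtain p where p: "p \<in> F" "tile_close (r p) p u" using F(3)[OF u] by blast
    have pP: "p \<in> P" using p(1) F(2) by blast
    have "ball (c p) (r p) \<subseteq> fst u"
    proof (rule ball_subset_convex_if_close)
      show "\<exists>q\<in>fst u. dist a q < r p" if "a \<in> ball (c p) (2 * r p)" for a
        using that rc(2)[OF pP] p(2) unfolding tile_close_def by blast
    qed (use poly[OF u] rc(1)[OF pP] in \<open>auto simp: compact_imp_closed\<close>)
    then show "\<exists>c. ball c r0 \<subseteq> fst u" using r0(2)[OF p(1)] subset_ball by blast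
    fix a b assume ab: "a \<in> fst u" "b \<in> fst u"
    obtain a' b' where ab': "a' \<in> fst p" "b' \<in> fst p" "dist a' a < r p" "dist b' b < r p"
      using p(2) ab unfolding tile_close_def by blast
    have "dist a b \<le> dist a' b' + 2 * r p"
      using ab'(3,4) dist_triangle[of a b a'] dist_triangle[of a' b b'] by (simp add: dist_commute)
    also have "\<dots> \<le> diameter (fst p) + 2 * r p"
      using diameter_bounded_bound[OF compact_imp_bounded[OF poly(1)[OF pP]] ab'(1,2)] by simp
    also have "\<dots> \<le> D" unfolding D_def
    proof (rule member_le_sum[OF p(1) _ F(1)])
      fix a assume "a \<in> F - {p}"
      then have "a \<in> P" using F(2) by blast
      then show "0 \<le> diameter (fst a) + 2 * r a"
        using diameter_ge_0[OF compact_imp_bounded[OF poly(1)]] rc(1)[of a] by fastforce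
    qed
    finally show "dist a b \<le> D" .
  qed
  show thesis
  proof
    show "r0 > 0" by (rule r0(1))
  next
    fix T t assume "T \<in> \<Omega>" "t \<in> T"
    then obtain p x where p: "p \<in> P" "t = shift_tile x p" using P(3) by blast
    obtain c where "ball c r0 \<subseteq> fst p" using in_ball[OF p(1)] by blast
    then have "(\<lambda>q. q - x) ` ball c r0 \<subseteq> fst t" by (auto simp: p(2) fst_shift_tile)
    moreover have "ball (c - x) r0 \<subseteq> (\<lambda>q. q - x) ` ball c r0"
    proof
      fix q assume "q \<in> ball (c - x) r0"
      then have "q + x \<in> ball c r0" by (simp add: dist_norm algebra_simps)
      then show "q \<in> (\<lambda>q. q - x) ` ball c r0" by (rule rev_image_eqI) simp
    qed
    ultimately show "\<exists>c. ball c r0 \<subseteq> fst t" by blast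
  next
    fix T t a b assume "T \<in> \<Omega>" "t \<in> T" and ab: "a \<in> fst t" "b \<in> fst t"
    then obtain p x where p: "p \<in> P" "t = shift_tile x p" using P(3) by blast
    then show "dist a b \<le> D" using ab diam[OF p(1)] by (auto simp: fst_shift_tile dist_norm)
  qed
qed

text \<open>
  In a space of finite local complexity the patterns that agree with \<open>T\<close> near the origin up to a
  small translation form a neighbourhood basis at \<open>T\<close>.
\<close>

definition nbd ::
  "('d::finite, 'l) pattern set \<Rightarrow> ('d, 'l) pattern \<Rightarrow> real \<Rightarrow> real \<Rightarrow> ('d, 'l) pattern set" where
  "nbd \<Omega> T R e = {S \<in> \<Omega>. \<exists>x. norm x < e \<and> agree R S (shift x T)}"

lemma nbd_mono: "r \<le> R \<Longrightarrow> e \<le> e' \<Longrightarrow> nbd \<Omega> T R e \<subseteq> nbd \<Omega> T r e'"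
  unfolding nbd_def using agree_mono less_le_trans by blast

lemma nbdI: "S \<in> \<Omega> \<Longrightarrow> norm x < e \<Longrightarrow> agree R S (shift x T) \<Longrightarrow> S \<in> nbd \<Omega> T R e"
  by (auto simp: nbd_def)

locale flc_space =
  fixes \<Omega> :: "('d::finite, 'l::metric_space) pattern set"
  assumes tiling_space: "tiling_space \<Omega>" and flc: "flc \<Omega>"
begin

lemma shift_in: "T \<in> \<Omega> \<Longrightarrow> shift x T \<in> \<Omega>"
  using tiling_space by (simp add: tiling_space_def)

lemma shift_in_iff [simp]: "shift x T \<in> \<Omega> \<longleftrightarrow> T \<in> \<Omega>"
  using shift_in[of T x] shift_in[of "shift x T" "- x"] by auto

lemma support:
  assumes "T \<in> \<Omega>" "t \<in> T"
  shows "compact (fst t)" "fst t \<noteq> {}"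
proof -
  have "tiling T \<or> delone T"
    using tiling_space assms(1)
    by (auto simp: tiling_space_def tilings_of_compact_prototiles_def delone_sets_of_compact_labels_def)
  then have "compact (fst t) \<and> fst t \<noteq> {}"
    using assms(2)
    by (auto simp: tiling_def tile_def delone_def polytope_imp_compact)
  then show "compact (fst t)" "fst t \<noteq> {}" by blast+
qed

lemma eq_if_agree_all: "S \<in> \<Omega> \<Longrightarrow> T \<in> \<Omega> \<Longrightarrow> (\<And>R. R > 0 \<Longrightarrow> agree R S T) \<Longrightarrow> S = T"
  by (rule agree_all_imp_eq) (auto dest: support(2))

text \<open>
  Distinct tiles of a tiling have disjoint interiors; each contains a ball of a fixed radius and has
  bounded diameter. So only finitely many meet a given ball.
\<close>

lemma finite_patch:
  assumes "T \<in> \<Omega>"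
  shows "finite (patch T x R)"
proof (cases "tilings_of_compact_prototiles \<Omega>")
  case True
  obtain r D where r: "r > 0"
    and "\<And>T t. T \<in> \<Omega> \<Longrightarrow> t \<in> T \<Longrightarrow> \<exists>c. ball c r \<subseteq> fst t"
    and D: "\<And>T t p q. T \<in> \<Omega> \<Longrightarrow> t \<in> T \<Longrightarrow> p \<in> fst t \<Longrightarrow> q \<in> fst t \<Longrightarrow> dist p q \<le> D"
    using tilings_of_compact_prototiles_bounds[OF True] by blast
  then obtain c where c: "\<And>t. t \<in> T \<Longrightarrow> ball (c t) r \<subseteq> fst t" using assms by metis
  have T: "tiling T" using True assms by (simp add: tilings_of_compact_prototiles_def)
  have cin: "c t \<in> fst t" if "t \<in> T" for t using c[OF that] r by auto
  have sep: "dist (c t) (c u) \<ge> r" if "t \<in> T" "u \<in> T" "t \<noteq> u" for t u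
  proof (rule ccontr)
    assume "\<not> dist (c t) (c u) \<ge> r"
    then have "c u \<in> ball (c t) r" by simp
    then have "c u \<in> interior (fst t)" using c[OF that(1)] interior_maximal open_ball by blast
    moreover have "c u \<in> fst t \<inter> fst u" using cin[OF that(2)] interior_subset calculation by blast
    then have "c u \<in> frontier (fst t)" using T that unfolding tiling_def by blast
    ultimately show False by (simp add: frontier_def)
  qed
  have "uniform_discrete (c ` patch T x R)"
    unfolding uniform_discrete_def
    using r sep by (intro exI[of _ r]) (fastforce simp: patch_def)
  moreover have "bounded (c ` patch T x R)"
    unfolding bounded_def
  proof (intro exI ballI)
    fix y assume "y \<in> c ` patch T x R"
    then obtain t where t: "t \<in> patch T x R" "y = c t" by blast
    then obtain p where "t \<in> T" "y = c t" "p \<in> fst t" "dist x p < R" unfolding patch_def by auto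
    then show "dist x y \<le> R + D"
      using D[OF assms, of t p y] cin dist_triangle[of x y p] by fastforce
  qed
  ultimately have "finite (c ` patch T x R)" using uniform_discrete_finite_iff by blast
  moreover have "inj_on c (patch T x R)"
    using sep r by (intro inj_onI) (fastforce simp: patch_def)
  ultimately show ?thesis by (rule finite_imageD)
next
  case False
  then have "delone T"
    using tiling_space assms by (auto simp: tiling_space_def delone_sets_of_compact_labels_def)
  then obtain X lab where X: "T = (\<lambda>p. ({p}, lab p)) ` X" "uniform_discrete X"
    unfolding delone_def by blast
  have "uniform_discrete (X \<inter> ball x R)" by (rule uniform_discrete_subset[OF X(2)]) simp
  then have "finite (X \<inter> ball x R)"
    using uniform_discrete_finite_iff[of "X \<inter> ball x R"] bounded_Int by blast
  moreover have "patch T x R \<subseteq> (\<lambda>p. ({p}, lab p)) ` (X \<inter> ball x R)"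
    by (auto simp: patch_def X(1))
  ultimately show ?thesis using finite_surj by blast
qed

lemma finite_patch_types:
  assumes "R > 0"
  obtains \<P> where "finite \<P>" "\<And>P. P \<in> \<P> \<Longrightarrow> \<exists>T\<in>\<Omega>. \<exists>x. P = patch T x R"
    "\<And>T x. T \<in> \<Omega> \<Longrightarrow> \<exists>P\<in>\<P>. \<exists>y. patch T x R = shift y P"
proof -
  obtain \<P>0 where \<P>0: "finite \<P>0" "\<And>T x. T \<in> \<Omega> \<Longrightarrow> \<exists>P\<in>\<P>0. \<exists>y. patch T x R = shift y P"
    using flc assms unfolding flc_def by meson
  define occurs where "occurs P Q \<longleftrightarrow> (\<exists>T\<in>\<Omega>. \<exists>x. Q = patch T x R) \<and> (\<exists>y. Q = shift y P)" for P Q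
  define rep where "rep P = (SOME Q. occurs P Q)" for P
  define \<P> where "\<P> = rep ` {P \<in> \<P>0. \<exists>Q. occurs P Q}"
  have rep: "occurs P (rep P)" if "occurs P Q" for P Q
    unfolding rep_def using that by (rule someI)
  show thesis
  proof
    show "finite \<P>" using \<P>0(1) by (simp add: \<P>_def)
    show "\<exists>T\<in>\<Omega>. \<exists>x. P = patch T x R" if P: "P \<in> \<P>" for P
    proof -
      obtain P0 Q where "P = rep P0" "occurs P0 Q" using P unfolding \<P>_def by blast
      then show ?thesis using rep[of P0 Q] by (simp add: occurs_def)
    qed
    show "\<exists>P\<in>\<P>. \<exists>y. patch T x R = shift y P" if T: "T \<in> \<Omega>" for T x
    proof -
      obtain P y where P: "P \<in> \<P>0" "patch T x R = shift y P" using \<P>0(2)[OF T] by blast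
      then have occ: "occurs P (patch T x R)" using T by (auto simp: occurs_def)
      then obtain z where "rep P = shift z P" using rep[OF occ] by (auto simp: occurs_def)
      then have "patch T x R = shift (y - z) (rep P)" using P(2) by simp
      moreover have "rep P \<in> \<P>" using P(1) occ by (auto simp: \<P>_def)
      ultimately show ?thesis by blast
    qed
  qed
qed

text \<open>
  The patches of radius \<open>R + 1\<close> are translates of finitely many finite ones. Hence, once the
  translation is normalised by the corner of one tile, only finitely many tiles can be the partner
  of a given tile, and a sufficiently close one is the tile itself.
\<close>

lemma close_partners_are_translates:
  assumes T: "T \<in> \<Omega>" and R: "R > 0" and e: "e > 0"
  obtains \<delta> where "\<delta> > 0"
    "\<And>S f. S \<in> \<Omega> \<Longrightarrow> (\<And>t. t \<in> patch T 0 R \<Longrightarrow> f t \<in> patch S 0 (R + 1) \<and> tile_close \<delta> t (f t)) \<Longrightarrow>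
       \<exists>x. norm x < e \<and> (\<forall>t\<in>patch T 0 R. f t = shift_tile x t)"
proof (cases "patch T 0 R = {}")
  case True
  then have "\<exists>x. norm x < e \<and> (\<forall>t\<in>patch T 0 R. f t = shift_tile x t)" for f
    using e by (intro exI[of _ 0]) auto
  then show ?thesis using that[of 1] by simp
next
  case False
  then obtain t0 where t0: "t0 \<in> patch T 0 R" by blast
  define A where "A = patch T 0 R"
  obtain \<P> where \<P>: "finite \<P>" "\<And>P. P \<in> \<P> \<Longrightarrow> \<exists>T\<in>\<Omega>. \<exists>x. P = patch T x (R + 1)"
    "\<And>T x. T \<in> \<Omega> \<Longrightarrow> \<exists>P\<in>\<P>. \<exists>y. patch T x (R + 1) = shift y P"
    using finite_patch_types[of "R + 1"] R by auto
  define Q where "Q = \<Union>\<P>"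
  have Q: "compact (fst q)" "fst q \<noteq> {}" if "q \<in> Q" for q
  proof -
    obtain T x where "T \<in> \<Omega>" "q \<in> patch T x (R + 1)" using \<P>(2) \<open>q \<in> Q\<close> unfolding Q_def by blast
    then have "T \<in> \<Omega>" "q \<in> T" by (simp_all add: patch_def)
    then show "compact (fst q)" "fst q \<noteq> {}" by (rule support)+
  qed
  have Af: "finite A" "\<And>t. t \<in> A \<Longrightarrow> compact (fst t)" "\<And>t. t \<in> A \<Longrightarrow> fst t \<noteq> {}"
    using finite_patch[OF T] support[OF T] by (auto simp: A_def patch_def)
  have finQ: "finite Q"
    using \<P>(1,2) finite_patch unfolding Q_def by blast
  define y0 where "y0 q = corner (fst q) - corner (fst t0)" for q :: "('d, 'l) ptile"
  define u where "u z = shift_tile (y0 (fst z)) (fst (snd z))" for z :: "('d, 'l) ptile \<times> ('d, 'l) ptile \<times> ('d, 'l) ptile"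
  have "\<exists>\<delta>>0. tile_close \<delta> (snd (snd z)) (u z) \<longrightarrow> snd (snd z) = u z"
    if z: "z \<in> Q \<times> Q \<times> A" for z
  proof (rule ccontr)
    assume *: "\<not> ?thesis"
    have "compact (fst (u z))"
      using Q(1)[of "fst (snd z)"] z
      by (auto simp: u_def fst_shift_tile intro!: compact_continuous_image continuous_intros)
    moreover have "compact (fst (snd (snd z)))" using Af(2) z by auto
    ultimately have "snd (snd z) = u z"
      using * by (intro tile_close_all_imp_eq) auto
    then show False using * zero_less_one by blast
  qed
  then obtain d where d: "\<And>z. z \<in> Q \<times> Q \<times> A \<Longrightarrow> d z > 0"
      "\<And>z. z \<in> Q \<times> Q \<times> A \<Longrightarrow> tile_close (d z) (snd (snd z)) (u z) \<Longrightarrow> snd (snd z) = u z"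
    by metis
  obtain \<delta>1 where \<delta>1: "\<delta>1 > 0" "\<And>z. z \<in> Q \<times> Q \<times> A \<Longrightarrow> \<delta>1 \<le> d z"
    by (rule finite_positive_lower_bound[of "Q \<times> Q \<times> A" d]) (use finQ Af(1) d(1) in auto)
  define N where "N = real CARD('d)"
  define \<delta> where "\<delta> = min \<delta>1 e / (N + 2)"
  have N: "N > 0" by (simp add: N_def)
  have \<delta>: "\<delta> > 0" "(N + 2) * \<delta> \<le> \<delta>1" "(N + 2) * \<delta> \<le> e" using \<delta>1(1) e N by (auto simp: \<delta>_def)
  show ?thesis
  proof (rule that[OF \<delta>(1)])
    fix S f assume S: "S \<in> \<Omega>"
      and f: "\<And>t. t \<in> patch T 0 R \<Longrightarrow> f t \<in> patch S 0 (R + 1) \<and> tile_close \<delta> t (f t)"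
    obtain P y where P: "P \<in> \<P>" "patch S 0 (R + 1) = shift y P" using \<P>(3)[OF S] by blast
    have fP: "\<exists>q\<in>P. f t = shift_tile y q" if "t \<in> A" for t
    proof -
      have "f t \<in> shift y P" using f[of t] \<open>t \<in> A\<close> P(2) by (simp add: A_def)
      then show ?thesis by (auto simp: shift_def)
    qed
    obtain q0 where q0: "q0 \<in> P" "f t0 = shift_tile y q0" using fP[of t0] t0 by (auto simp: A_def)
    have q0Q: "q0 \<in> Q" using q0(1) P(1) by (auto simp: Q_def)
    have t0A: "t0 \<in> A" using t0 by (simp add: A_def)
    have ft0: "fst (f t0) = (\<lambda>p. p - y) ` fst q0" by (simp add: q0(2) fst_shift_tile)
    have cq: "corner (fst (f t0)) = corner (fst q0) - y"
      unfolding ft0 by (rule corner_translate) (use Q[OF q0Q] in \<open>auto simp: compact_imp_bounded\<close>)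
    have "norm (corner (fst t0) - corner (fst (f t0))) \<le> N * \<delta>"
      unfolding N_def
    proof (rule corner_close)
      show "bounded (fst (f t0))"
        unfolding ft0 using Q(1)[OF q0Q]
        by (intro compact_imp_bounded compact_continuous_image) (auto intro!: continuous_intros)
    qed (use f[OF t0] Af t0A ft0 Q(2)[OF q0Q] in \<open>auto simp: compact_imp_bounded tile_close_def\<close>)
    then have small: "norm (y - y0 q0) \<le> N * \<delta>"
      unfolding cq y0_def by (simp add: algebra_simps)
    have "f t = shift_tile (y - y0 q0) t" if t: "t \<in> A" for t
    proof -
      obtain q where q: "q \<in> P" "f t = shift_tile y q" using fP[OF t] by blast
      have qQ: "(q0, q, t) \<in> Q \<times> Q \<times> A" using q(1) P(1) q0Q t by (auto simp: Q_def)
      have "norm (y0 q0 - y) < N * \<delta> + \<delta>" using small \<delta>(1) by (simp add: norm_minus_commute)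
      then have "tile_close (N * \<delta> + \<delta>) (f t) (shift_tile (y0 q0 - y) (f t))"
        by (rule tile_close_shift_tile)
      then have "tile_close (N * \<delta> + \<delta>) (f t) (shift_tile (y0 q0) q)" by (simp add: q(2))
      moreover have "tile_close \<delta> t (f t)" using f t by (simp add: A_def)
      ultimately have "tile_close (\<delta> + (N * \<delta> + \<delta>)) t (shift_tile (y0 q0) q)"
        by (rule tile_close_trans[rotated])
      moreover have "\<delta> + (N * \<delta> + \<delta>) \<le> d (q0, q, t)"
        using \<delta>(2) \<delta>1(2)[OF qQ] by (simp add: algebra_simps)
      ultimately have "t = shift_tile (y0 q0) q"
        using d(2)[OF qQ] tile_close_mono[of _ t] by (simp add: u_def)
      then have "shift_tile (y - y0 q0) t = shift_tile y q" by simp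
      then show ?thesis using q(2) by simp
    qed
    moreover have "norm (y - y0 q0) < e" using small \<delta>(1,3) by (simp add: algebra_simps)
    ultimately show "\<exists>x. norm x < e \<and> (\<forall>t\<in>patch T 0 R. f t = shift_tile x t)"
      unfolding A_def by blast
  qed
qed

lemma nbd_if_close:
  assumes T: "T \<in> \<Omega>" and R: "R > 0" and e: "e > 0"
  obtains \<delta> where "\<delta> > 0" "\<And>S. S \<in> \<Omega> \<Longrightarrow> pattern_close \<delta> T S \<Longrightarrow> S \<in> nbd \<Omega> T R e"
proof -
  obtain \<delta>0 where \<delta>0: "\<delta>0 > 0"
    "\<And>S f. S \<in> \<Omega> \<Longrightarrow> (\<And>t. t \<in> patch T 0 (R + 1) \<Longrightarrow> f t \<in> patch S 0 (R + 1 + 1) \<and> tile_close \<delta>0 t (f t)) \<Longrightarrow>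
       \<exists>x. norm x < min e 1 \<and> (\<forall>t\<in>patch T 0 (R + 1). f t = shift_tile x t)"
    by (rule close_partners_are_translates[OF T, of "R + 1" "min e 1"]) (use R e in auto)
  define \<delta> where "\<delta> = min \<delta>0 (1 / (R + 2))"
  have \<delta>: "\<delta> > 0" "\<delta> \<le> \<delta>0" "\<delta> \<le> 1" using \<delta>0(1) R by (auto simp: \<delta>_def min_le_iff_disj)
  have "\<delta> \<le> 1 / (R + 2)" by (simp add: \<delta>_def)
  then have inv: "R + 2 \<le> 1 / \<delta>" using \<delta>(1) R by (simp add: field_simps)
  show ?thesis
  proof (rule that[OF \<delta>(1)])
    fix S assume S: "S \<in> \<Omega>" and "pattern_close \<delta> T S"
    then obtain A A' f where f: "patch T 0 (1 / \<delta>) \<subseteq> A" "A \<subseteq> T" "patch S 0 (1 / \<delta>) \<subseteq> A'" "A' \<subseteq> S"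
      "bij_betw f A A'" "\<forall>t\<in>A. tile_close \<delta> t (f t)"
      unfolding pattern_close_def by blast
    have fA: "f ` A = A'" using f(5) by (simp add: bij_betw_def)
    have sub: "patch U 0 r \<subseteq> patch U 0 (1 / \<delta>)" if "r \<le> R + 2" for U :: "('d, 'l) pattern" and r
      using that inv subset_ball[of r "1 / \<delta>" 0] unfolding patch_def by fastforce
    have fin: "f t \<in> patch S 0 (R + 1 + 1) \<and> tile_close \<delta>0 t (f t)" if t: "t \<in> patch T 0 (R + 1)" for t
    proof -
      have tA: "t \<in> A" using t sub[of "R + 1" T] f(1) by auto
      have "fst (f t) \<inter> ball 0 (R + 1 + \<delta>) \<noteq> {}"
        using tile_close_meets_ball[OF f(6)[rule_format, OF tA]] t by (simp add: patch_def)
      then have "fst (f t) \<inter> ball 0 (R + 1 + 1) \<noteq> {}"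
        using subset_ball[of "R + 1 + \<delta>" "R + 1 + 1" 0] \<delta>(3) by auto
      moreover have "f t \<in> S" using tA fA f(4) by blast
      moreover have "tile_close \<delta>0 t (f t)" using f(6) tA \<delta>(2) tile_close_mono by blast
      ultimately show ?thesis by (simp add: patch_def)
    qed
    obtain x where x: "norm x < min e 1" "\<And>t. t \<in> patch T 0 (R + 1) \<Longrightarrow> f t = shift_tile x t"
      using \<delta>0(2)[OF S fin] by blast
    have "patch S 0 R = patch (shift x T) 0 R"
    proof (intro subset_antisym subsetI)
      fix s assume s: "s \<in> patch S 0 R"
      then have "s \<in> A'" using sub[of R S] f(3) by auto
      then obtain t where t: "t \<in> A" "s = f t" using fA by blast
      have "fst t \<inter> ball 0 (R + \<delta>) \<noteq> {}"
        using tile_close_meets_ball[OF tile_close_sym[OF f(6)[rule_format, OF t(1)]]] s t(2) by (simp add: patch_def)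
      then have "fst t \<inter> ball 0 (R + 1) \<noteq> {}"
        using subset_ball[of "R + \<delta>" "R + 1" 0] \<delta>(3) by auto
      then have "t \<in> patch T 0 (R + 1)" using t(1) f(2) by (auto simp only: patch_def mem_Collect_eq)
      then have "s = shift_tile x t" using x(2) t(2) by simp
      then show "s \<in> patch (shift x T) 0 R" using s t(1) f(2) by (auto simp: patch_def shift_def)
    next
      fix s assume s: "s \<in> patch (shift x T) 0 R"
      then obtain t where t: "t \<in> T" "s = shift_tile x t" by (auto simp: patch_def shift_def)
      obtain p where p: "p \<in> fst t" "norm (p - x) < R"
        using s by (auto simp: patch_def t(2) fst_shift_tile)
      have "norm p < R + 1" using p(2) x(1) norm_triangle_sub[of p x] by simp
      then have "t \<in> patch T 0 (R + 1)" using p(1) t(1) by (auto simp: patch_def)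
      then have "s \<in> S" using fin x(2) t(2) by (auto simp: patch_def)
      then show "s \<in> patch S 0 R" using s by (simp add: patch_def)
    qed
    then show "S \<in> nbd \<Omega> T R e" using S x(1) by (auto simp: nbd_def agree_def)
  qed
qed

lemma open_nhd_in_nbd:
  assumes "T \<in> \<Omega>" "R > 0" "e > 0"
  obtains U where "openin (space_topology \<Omega>) U" "T \<in> U" "U \<subseteq> nbd \<Omega> T R e"
proof -
  obtain \<delta> where \<delta>: "\<delta> > 0" "\<And>S. S \<in> \<Omega> \<Longrightarrow> pattern_close \<delta> T S \<Longrightarrow> S \<in> nbd \<Omega> T R e"
    using nbd_if_close[OF assms] by blast
  define V where "V = {S. \<exists>\<epsilon>>0. \<forall>S'. pattern_close \<epsilon> S S' \<longrightarrow> S' \<in> {S'. pattern_close \<delta> T S'}}"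
  have "openin pattern_topology V"
    unfolding V_def pattern_topology_def
    by (rule closeness_ball_nhd[OF pattern_close_mono pattern_close_trans])
  then have "openin (space_topology \<Omega>) (V \<inter> \<Omega>)"
    by (auto simp: openin_subtopology)
  moreover have "T \<in> V \<inter> \<Omega>" using \<delta>(1) assms(1) by (auto simp: V_def)
  moreover have "V \<inter> \<Omega> \<subseteq> nbd \<Omega> T R e" using \<delta>(2) pattern_close_refl by (auto simp: V_def)
  ultimately show ?thesis using that by blast
qed

lemma openin_iff_nbd:
  "openin (space_topology \<Omega>) U \<longleftrightarrow> U \<subseteq> \<Omega> \<and> (\<forall>T\<in>U. \<exists>R>0. \<exists>e>0. nbd \<Omega> T R e \<subseteq> U)"
proof (intro iffI conjI ballI)
  assume U: "openin (space_topology \<Omega>) U"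
  then show "U \<subseteq> \<Omega>" using openin_subset by fastforce
  fix T assume T: "T \<in> U"
  obtain V where V: "openin pattern_topology V" "U = V \<inter> \<Omega>"
    using U by (auto simp: openin_subtopology)
  obtain \<epsilon> where \<epsilon>: "\<epsilon> > 0" "\<And>S. pattern_close \<epsilon> T S \<Longrightarrow> S \<in> V"
    using V T unfolding openin_pattern_topology by blast
  have "nbd \<Omega> T (1 / \<epsilon> + 1) (min 1 \<epsilon>) \<subseteq> U"
    using pattern_close_if_agree_shift[of "1 / \<epsilon> + 1" _ _ T \<epsilon>] \<epsilon>(2) V(2) by (auto simp: nbd_def)
  moreover have "1 / \<epsilon> + 1 > 0" "min 1 \<epsilon> > 0" using \<epsilon>(1) by (simp_all add: add_pos_pos)
  ultimately show "\<exists>R>0. \<exists>e>0. nbd \<Omega> T R e \<subseteq> U" by blast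
next
  assume U: "U \<subseteq> \<Omega> \<and> (\<forall>T\<in>U. \<exists>R>0. \<exists>e>0. nbd \<Omega> T R e \<subseteq> U)"
  show "openin (space_topology \<Omega>) U"
  proof (subst openin_subopen, intro ballI)
    fix T assume T: "T \<in> U"
    then obtain R e where "R > 0" "e > 0" "nbd \<Omega> T R e \<subseteq> U" using U by blast
    then show "\<exists>V. openin (space_topology \<Omega>) V \<and> T \<in> V \<and> V \<subseteq> U"
      using open_nhd_in_nbd[of T R e] T U by (metis subset_iff)
  qed
qed

lemma finite_nbd_cover:
  assumes "\<And>T. T \<in> \<Omega> \<Longrightarrow> R T > 0" "\<And>T. T \<in> \<Omega> \<Longrightarrow> e T > 0"
  obtains F where "finite F" "F \<subseteq> \<Omega>" "\<Omega> \<subseteq> (\<Union>T\<in>F. nbd \<Omega> T (R T) (e T))"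
proof -
  have "\<forall>T\<in>\<Omega>. \<exists>\<delta>>0. \<forall>S\<in>\<Omega>. pattern_close \<delta> T S \<longrightarrow> S \<in> nbd \<Omega> T (R T) (e T)"
    using nbd_if_close assms by metis
  then obtain \<delta> where \<delta>: "\<And>T. T \<in> \<Omega> \<Longrightarrow> \<delta> T > 0"
    "\<And>T S. T \<in> \<Omega> \<Longrightarrow> S \<in> \<Omega> \<Longrightarrow> pattern_close (\<delta> T) T S \<Longrightarrow> S \<in> nbd \<Omega> T (R T) (e T)"
    by metis
  have comp: "compactin (closeness_topology pattern_close) \<Omega>"
    using tiling_space by (simp add: tiling_space_def pattern_topology_def)
  show ?thesis
  proof (rule compactin_finite_closeness_cover[where close = pattern_close and K = \<Omega> and e = \<delta>])
    fix F assume F: "finite F" "F \<subseteq> \<Omega>" "\<And>S. S \<in> \<Omega> \<Longrightarrow> \<exists>T\<in>F. pattern_close (\<delta> T) T S"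
    have "\<Omega> \<subseteq> (\<Union>T\<in>F. nbd \<Omega> T (R T) (e T))" using F(2,3) \<delta>(2) by blast
    then show ?thesis using that F(1,2) by blast
  qed (rule pattern_close_mono pattern_close_trans pattern_close_refl comp \<delta>(1); assumption)+
qed

end


section \<open>Punctures of tiles\<close>

text \<open>
  A point of the tile chosen in a translation-equivariant way: the choice is made for the translate
  whose corner is the origin.
\<close>

definition puncture :: "('d::finite, 'l) ptile \<Rightarrow> real ^ 'd" where
  "puncture t = corner (fst t) + (SOME p. p \<in> (\<lambda>q. q - corner (fst t)) ` fst t)"

lemma puncture_shift_tile:
  assumes "compact (fst t)" "fst t \<noteq> {}"
  shows "puncture (shift_tile x t) = puncture t - x"
proof -
  have "corner (fst (shift_tile x t)) = corner (fst t) - x"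
    using corner_translate[OF compact_imp_bounded[OF assms(1)] assms(2)] by (simp add: fst_shift_tile)
  moreover have "(\<lambda>q. q - (corner (fst t) - x)) ` (\<lambda>p. p - x) ` fst t = (\<lambda>q. q - corner (fst t)) ` fst t"
    by (simp add: image_image)
  ultimately show ?thesis by (simp add: puncture_def fst_shift_tile)
qed

lemma puncture_mem:
  assumes "fst t \<noteq> {}"
  shows "puncture t \<in> fst t"
proof -
  have "(SOME p. p \<in> (\<lambda>q. q - corner (fst t)) ` fst t) \<in> (\<lambda>q. q - corner (fst t)) ` fst t"
    using assms by (intro some_in_eq[THEN iffD2]) simp
  then show ?thesis unfolding puncture_def by auto
qed

definition punctures :: "('d::finite, 'l) pattern \<Rightarrow> (real ^ 'd) set" where
  "punctures T = puncture ` T"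

context flc_space
begin

lemma puncture_in: "T \<in> \<Omega> \<Longrightarrow> t \<in> T \<Longrightarrow> puncture t \<in> fst t"
  using puncture_mem support by blast

lemma puncture_shift: "T \<in> \<Omega> \<Longrightarrow> t \<in> T \<Longrightarrow> puncture (shift_tile x t) = puncture t - x"
  using puncture_shift_tile support by blast

lemma punctures_shift:
  assumes "T \<in> \<Omega>"
  shows "punctures (shift x T) = (\<lambda>p. p - x) ` punctures T"
proof -
  have "(\<lambda>t. puncture (shift_tile x t)) ` T = (\<lambda>t. puncture t - x) ` T"
    by (rule image_cong) (simp_all add: puncture_shift[OF assms])
  then show ?thesis by (simp add: punctures_def shift_def image_image)
qed

lemma mem_punctures_shift: "T \<in> \<Omega> \<Longrightarrow> p \<in> punctures (shift x T) \<longleftrightarrow> p + x \<in> punctures T"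
  using image_iff by (fastforce simp: punctures_shift)

lemma punctures_agree:
  assumes "T \<in> \<Omega>" "S \<in> \<Omega>" "agree R S T" "norm p < R"
  shows "p \<in> punctures S \<longleftrightarrow> p \<in> punctures T"
proof -
  have "p \<in> punctures U \<longleftrightarrow> (\<exists>t\<in>patch U 0 R. puncture t = p)" if "U \<in> \<Omega>" for U
  proof -
    have "t \<in> patch U 0 R" if "t \<in> U" "puncture t = p" for t
      using puncture_in[OF \<open>U \<in> \<Omega>\<close> that(1)] that assms(4) by (auto simp: patch_def)
    moreover have "patch U 0 R \<subseteq> U" by (auto simp: patch_def)
    ultimately show ?thesis unfolding punctures_def by blast
  qed
  then show ?thesis using assms by (simp add: agree_def)
qed

text \<open>Two punctures at distance less than 1 lie in one of finitely many finite patches.\<close>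

lemma punctures_separated:
  obtains \<sigma> where "\<sigma> > 0"
    "\<And>T p q. T \<in> \<Omega> \<Longrightarrow> p \<in> punctures T \<Longrightarrow> q \<in> punctures T \<Longrightarrow> dist p q < \<sigma> \<Longrightarrow> p = q"
proof -
  obtain \<P> where \<P>: "finite \<P>" "\<And>P. P \<in> \<P> \<Longrightarrow> \<exists>T\<in>\<Omega>. \<exists>x. P = patch T x 1"
    "\<And>T x. T \<in> \<Omega> \<Longrightarrow> \<exists>P\<in>\<P>. \<exists>y. patch T x 1 = shift y P"
    using finite_patch_types[of 1] zero_less_one by blast
  define Q where "Q = (\<Union>P\<in>\<P>. puncture ` P \<times> puncture ` P)"
  have "finite P" if "P \<in> \<P>" for P using \<P>(2)[OF that] finite_patch by blast
  then have "finite Q" using \<P>(1) by (auto simp: Q_def)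
  then have "finite {z \<in> Q. fst z \<noteq> snd z}" by simp
  then obtain \<sigma> where \<sigma>: "\<sigma> > 0" "\<And>z. z \<in> {z \<in> Q. fst z \<noteq> snd z} \<Longrightarrow> \<sigma> \<le> dist (fst z) (snd z)"
    by (rule finite_positive_lower_bound[where f = "\<lambda>z. dist (fst z) (snd z)"]) auto
  show ?thesis
  proof
    show "min \<sigma> 1 > 0" using \<sigma>(1) by simp
    fix T p q assume T: "T \<in> \<Omega>" and pq: "p \<in> punctures T" "q \<in> punctures T" "dist p q < min \<sigma> 1"
    obtain t u where tu: "t \<in> T" "p = puncture t" "u \<in> T" "q = puncture u"
      using pq by (auto simp: punctures_def)
    have "p \<in> fst t" "q \<in> fst u" using puncture_in[OF T] tu by simp_all
    then have tu': "t \<in> patch T p 1" "u \<in> patch T p 1" using tu pq(3) by (auto simp: patch_def)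
    obtain P y where P: "P \<in> \<P>" "patch T p 1 = shift y P" using \<P>(3)[OF T] by blast
    then obtain t' u' where t'u': "t' \<in> P" "t = shift_tile y t'" "u' \<in> P" "u = shift_tile y u'"
      using tu' by (auto simp: shift_def)
    obtain T' x' where "T' \<in> \<Omega>" "P = patch T' x' 1" using \<P>(2)[OF P(1)] by blast
    then have P': "T' \<in> \<Omega>" "P \<subseteq> T'" by (auto simp: patch_def)
    have *: "p = puncture t' - y" "q = puncture u' - y"
      using tu(2,4) t'u' puncture_shift[OF P'(1)] P'(2) by (metis subsetD)+
    show "p = q"
    proof (rule ccontr)
      assume "p \<noteq> q"
      then have "(puncture t', puncture u') \<in> {z \<in> Q. fst z \<noteq> snd z}"
        using * t'u'(1,3) P(1) by (auto simp: Q_def)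
      from \<sigma>(2)[OF this] show False using * pq(3) by (simp add: dist_norm)
    qed
  qed
qed

lemma punctures_relatively_dense:
  assumes T: "T \<in> \<Omega>"
  shows "relatively_dense (punctures T)"
proof (cases "tilings_of_compact_prototiles \<Omega>")
  case True
  then have "tiling T" using T by (simp add: tilings_of_compact_prototiles_def)
  obtain r D where D: "\<And>T t p q. T \<in> \<Omega> \<Longrightarrow> t \<in> T \<Longrightarrow> p \<in> fst t \<Longrightarrow> q \<in> fst t \<Longrightarrow> dist p q \<le> (D :: real)"
    using tilings_of_compact_prototiles_bounds[OF True] by metis
  have "\<exists>p\<in>punctures T. dist y p < \<bar>D\<bar> + 1" for y
  proof -
    have "y \<in> (\<Union>t\<in>T. fst t)" using \<open>tiling T\<close> by (simp add: tiling_def)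
    then obtain t where t: "t \<in> T" "y \<in> fst t" by blast
    then have "dist y (puncture t) \<le> D" using D[OF T t(1) t(2)] puncture_in[OF T] by blast
    then have "dist y (puncture t) < \<bar>D\<bar> + 1" by linarith
    then show ?thesis using t(1) by (auto simp: punctures_def)
  qed
  then show ?thesis unfolding relatively_dense_def by (intro exI[of _ "\<bar>D\<bar> + 1"]) auto
next
  case False
  then have "delone T"
    using tiling_space T by (auto simp: tiling_space_def delone_sets_of_compact_labels_def)
  then obtain X lab where X: "T = (\<lambda>p. ({p}, lab p)) ` X" "relatively_dense X"
    unfolding delone_def by blast
  have "puncture ({p}, lab p) = p" if "p \<in> X" for p
    using puncture_in[OF T, of "({p}, lab p)"] that X by auto
  then have "punctures T = X" by (force simp: punctures_def X(1) image_image)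
  then show ?thesis using X(2) by simp
qed

section \<open>The Delone sets of punctures\<close>

definition puncture_set :: "real ^ 'd \<Rightarrow> ('d, 'l) pattern \<Rightarrow> ('d, real) pattern" where
  "puncture_set y T = (\<lambda>p. ({p - y}, 0)) ` punctures T"

lemma puncture_set_shift: "T \<in> \<Omega> \<Longrightarrow> puncture_set y (shift x T) = shift x (puncture_set y T)"
  unfolding puncture_set_def
  by (simp only: punctures_shift) (simp add: shift_def shift_tile_def image_image algebra_simps)

lemma patch_puncture_set:
  "patch (puncture_set y T) x R = (\<lambda>p. ({p - y}, 0)) ` (punctures T \<inter> ball (x + y) R)"
proof -
  have "p - y \<in> ball x R \<longleftrightarrow> p \<in> ball (x + y) R" for p :: "real ^ 'd"
    by (simp add: dist_norm algebra_simps)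
  then show ?thesis unfolding patch_def puncture_set_def by auto
qed

lemma puncture_set_agree:
  assumes "T \<in> \<Omega>" "S \<in> \<Omega>" "agree R S T" "norm y + r \<le> R"
  shows "agree r (puncture_set y S) (puncture_set y T)"
proof -
  have "ball (0 + y) r \<subseteq> ball 0 R" using assms(4) by (simp add: ball_subset_ball_iff dist_norm)
  then have "punctures S \<inter> ball (0 + y) r = punctures T \<inter> ball (0 + y) r"
    using punctures_agree[OF assms(1-3)] by (auto simp: subset_iff)
  then show ?thesis by (simp only: agree_def patch_puncture_set)
qed

lemma delone_puncture_set:
  assumes T: "T \<in> \<Omega>"
  shows "delone (puncture_set y T)"
proof -
  obtain \<sigma> where \<sigma>: "\<sigma> > 0" "\<And>p q. p \<in> punctures T \<Longrightarrow> q \<in> punctures T \<Longrightarrow> dist p q < \<sigma> \<Longrightarrow> p = q"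
    using punctures_separated T by metis
  obtain R where R: "R > 0" "\<And>z. \<exists>p\<in>punctures T. dist z p < R"
    using punctures_relatively_dense[OF T] unfolding relatively_dense_def by blast
  show ?thesis
    unfolding delone_def
  proof (intro exI conjI)
    show "puncture_set y T = (\<lambda>p. ({p}, (\<lambda>_. 0) p)) ` (\<lambda>p. p - y) ` punctures T"
      by (simp add: puncture_set_def image_image)
    show "uniform_discrete ((\<lambda>p. p - y) ` punctures T)"
      unfolding uniform_discrete_def using \<sigma> by (intro exI[of _ \<sigma>]) (auto simp: dist_norm)
    show "relatively_dense ((\<lambda>p. p - y) ` punctures T)"
      unfolding relatively_dense_def
    proof (intro exI[of _ R] conjI allI)
      fix z
      obtain p where "p \<in> punctures T" "dist (z + y) p < R" using R(2) by blast
      then show "\<exists>x\<in>(\<lambda>p. p - y) ` punctures T. dist z x < R"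
        by (intro bexI[of _ "p - y"]) (auto simp: dist_norm algebra_simps)
    qed (rule R(1))
  qed
qed

lemma continuous_puncture_set: "continuous_map (space_topology \<Omega>) pattern_topology (puncture_set y)"
  unfolding continuous_map_def
proof (intro conjI allI impI)
  show "puncture_set y \<in> topspace (space_topology \<Omega>) \<rightarrow> topspace pattern_topology" by simp
  fix V :: "('d, real) pattern set" assume V: "openin pattern_topology V"
  have "\<exists>R>0. \<exists>e>0. nbd \<Omega> T R e \<subseteq> {T \<in> \<Omega>. puncture_set y T \<in> V}" if T: "T \<in> \<Omega>" "puncture_set y T \<in> V" for T
  proof -
    obtain \<epsilon> where \<epsilon>: "\<epsilon> > 0" "\<And>S. pattern_close \<epsilon> (puncture_set y T) S \<Longrightarrow> S \<in> V"
      using V T(2) unfolding openin_pattern_topology by blast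
    define R where "R = norm y + (1 / \<epsilon> + 1)"
    have "nbd \<Omega> T R (min 1 \<epsilon>) \<subseteq> {T \<in> \<Omega>. puncture_set y T \<in> V}"
    proof
      fix S assume "S \<in> nbd \<Omega> T R (min 1 \<epsilon>)"
      then obtain x where S: "S \<in> \<Omega>" "norm x < min 1 \<epsilon>" "agree R S (shift x T)" by (auto simp: nbd_def)
      have "agree (1 / \<epsilon> + 1) (puncture_set y S) (shift x (puncture_set y T))"
        unfolding puncture_set_shift[OF T(1), symmetric]
        by (rule puncture_set_agree[OF _ S(1,3)]) (use T in \<open>auto simp: R_def\<close>)
      then have "pattern_close \<epsilon> (puncture_set y T) (puncture_set y S)"
        by (rule pattern_close_if_agree_shift) (use S(2) in auto)
      then show "S \<in> {T \<in> \<Omega>. puncture_set y T \<in> V}" using \<epsilon>(2) S(1) by blast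
    qed
    moreover have "R > 0" "min 1 \<epsilon> > 0" using \<epsilon>(1) by (simp_all add: R_def add_nonneg_pos add_pos_pos)
    ultimately show ?thesis by blast
  qed
  then show "openin (space_topology \<Omega>) {T \<in> topspace (space_topology \<Omega>). puncture_set y T \<in> V}"
    by (auto simp: openin_iff_nbd)
qed

text \<open>A patch of the derived Delone set consists of punctures of tiles from one patch.\<close>

lemma flc_puncture_sets: "Defs.flc (puncture_set y ` \<Omega>)"
  unfolding flc_def
proof (intro allI impI)
  fix R :: real assume "R > 0"
  then obtain \<P> where \<P>: "finite \<P>" "\<And>P. P \<in> \<P> \<Longrightarrow> \<exists>T\<in>\<Omega>. \<exists>x. P = patch T x R"
    "\<And>T x. T \<in> \<Omega> \<Longrightarrow> \<exists>P\<in>\<P>. \<exists>y. patch T x R = shift y P"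
    using finite_patch_types by blast
  define \<Q> where "\<Q> = image (\<lambda>p. ({p - y}, 0 :: real)) ` (\<Union>P\<in>\<P>. Pow (puncture ` P))"
  have "finite P" if "P \<in> \<P>" for P using \<P>(2)[OF that] finite_patch by blast
  then have "finite \<Q>" using \<P>(1) by (auto simp: \<Q>_def)
  moreover have "\<exists>Q\<in>\<Q>. \<exists>z. patch (puncture_set y T) x R = shift z Q" if T: "T \<in> \<Omega>" for T x
  proof -
    obtain P z where P: "P \<in> \<P>" "patch T (x + y) R = shift z P" using \<P>(3)[OF T] by blast
    obtain T' x' where T': "T' \<in> \<Omega>" "P = patch T' x' R" using \<P>(2)[OF P(1)] by blast
    define B where "B = (\<lambda>p. p + z) ` (punctures T \<inter> ball (x + y) R)"
    have "B \<subseteq> puncture ` P"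
    proof
      fix b assume "b \<in> B"
      then obtain t where t: "t \<in> T" "puncture t \<in> ball (x + y) R" "b = puncture t + z"
        by (auto simp: B_def punctures_def)
      then have "t \<in> patch T (x + y) R" using puncture_in[OF T t(1)] unfolding patch_def by blast
      then obtain t' where t': "t' \<in> P" "t = shift_tile z t'" using P(2) by (auto simp: shift_def)
      have "t' \<in> T'" using t'(1) T'(2) by (simp add: patch_def)
      then have "b = puncture t'" using t(3) t'(2) puncture_shift[OF T'(1)] by simp
      then show "b \<in> puncture ` P" using t'(1) by blast
    qed
    then have "(\<lambda>p. ({p - y}, 0 :: real)) ` B \<in> \<Q>" using P(1) unfolding \<Q>_def by blast
    moreover have "patch (puncture_set y T) x R = shift z ((\<lambda>p. ({p - y}, 0)) ` B)"
      by (simp add: patch_puncture_set B_def shift_def shift_tile_def image_image algebra_simps)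
    ultimately show ?thesis by blast
  qed
  ultimately show "\<exists>\<P>. finite \<P> \<and>
      (\<forall>T\<in>puncture_set y ` \<Omega>. \<forall>x. \<exists>P\<in>\<P>. \<exists>z. patch T x R = shift z P)"
    by blast
qed

text \<open>The derived Delone set contains the origin exactly if \<open>y\<close> is a puncture.\<close>

lemma flc_transversal_punctures: "flc_transversal \<Omega> {T \<in> \<Omega>. y \<in> punctures T}"
  unfolding flc_transversal_def
proof (intro exI conjI)
  let ?\<Omega>0 = "puncture_set y ` \<Omega>"
  show "tiling_space ?\<Omega>0"
    unfolding tiling_space_def
  proof (intro conjI disjI2)
    have "snd ` \<Union>?\<Omega>0 \<subseteq> {0}" by (auto simp: puncture_set_def)
    then show "delone_sets_of_compact_labels ?\<Omega>0"
      unfolding delone_sets_of_compact_labels_def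
      using delone_puncture_set by (auto intro: exI[of _ "{0}"])
    show "\<forall>T\<in>?\<Omega>0. \<forall>x. shift x T \<in> ?\<Omega>0"
      using puncture_set_shift shift_in by (metis (no_types, lifting) image_iff)
    have "compactin pattern_topology \<Omega>" using tiling_space by (simp add: tiling_space_def)
    then have "compactin (space_topology \<Omega>) \<Omega>" by (simp add: compactin_subtopology)
    then show "compactin pattern_topology ?\<Omega>0"
      using continuous_puncture_set by (rule image_compactin)
  qed
  show "\<forall>S\<in>?\<Omega>0. delone S" using delone_puncture_set by blast
  show "Defs.flc ?\<Omega>0" by (rule flc_puncture_sets)
  show "local_derivation \<Omega> ?\<Omega>0 (puncture_set y)"
    unfolding local_derivation_def
  proof (intro conjI ballI allI impI)
    show "continuous_map (space_topology \<Omega>) (space_topology ?\<Omega>0) (puncture_set y)"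
      using continuous_puncture_set by (simp add: continuous_map_in_subtopology)
    show "puncture_set y (shift x T) = shift x (puncture_set y T)" if "T \<in> \<Omega>" for T x
      using that by (rule puncture_set_shift)
    show "\<exists>R>0. \<forall>T\<in>\<Omega>. \<forall>T'\<in>\<Omega>. patch T 0 R = patch T' 0 R \<longrightarrow>
        patch (puncture_set y T) 0 r = patch (puncture_set y T') 0 r" if "r > 0" for r
    proof (intro exI[of _ "norm y + r"] conjI ballI impI)
      show "norm y + r > 0" using that by (simp add: add_nonneg_pos)
      fix T T' assume "T \<in> \<Omega>" "T' \<in> \<Omega>" "patch T 0 (norm y + r) = patch T' 0 (norm y + r)"
      then show "patch (puncture_set y T) 0 r = patch (puncture_set y T') 0 r"
        using puncture_set_agree[of T' T "norm y + r" y r] by (simp add: agree_def)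
    qed
  qed simp
  show "{T \<in> \<Omega>. y \<in> punctures T} = {T \<in> \<Omega>. puncture_set y T \<in> canonical_transversal ?\<Omega>0}"
    by (force simp: canonical_transversal_def puncture_set_def image_iff)
qed

section \<open>Transversals and flow boxes in terms of agreement\<close>

text \<open>The local derivation that defines a transversal sees only a patch.\<close>

lemma transversal_open:
  assumes "flc_transversal \<Omega> \<Xi>" "S \<in> \<Xi>"
  obtains R where "R > 0" "\<And>S'. S' \<in> \<Omega> \<Longrightarrow> agree R S' S \<Longrightarrow> S' \<in> \<Xi>"
proof -
  obtain \<Omega>0 :: "('d, real) pattern set" and \<D> where D: "local_derivation \<Omega> \<Omega>0 \<D>"
    "\<Xi> = {T \<in> \<Omega>. \<D> T \<in> canonical_transversal \<Omega>0}"
    using assms(1) unfolding flc_transversal_def by blast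
  obtain l where l: "({0}, l) \<in> \<D> S" "S \<in> \<Omega>" using assms(2) D(2) by (auto simp: canonical_transversal_def)
  obtain R where R: "R > 0" "\<And>S'. S' \<in> \<Omega> \<Longrightarrow> patch S 0 R = patch S' 0 R \<Longrightarrow> patch (\<D> S) 0 1 = patch (\<D> S') 0 1"
    using D(1) l(2) unfolding local_derivation_def by (meson zero_less_one)
  have "({0}, l) \<in> patch (\<D> S) 0 1" using l(1) by (simp add: patch_def)
  then have "({0}, l) \<in> \<D> S'" if "S' \<in> \<Omega>" "agree R S' S" for S'
    using R(2)[OF that(1)] that(2) by (auto simp: agree_def patch_def)
  then have "S' \<in> \<Xi>" if "S' \<in> \<Omega>" "agree R S' S" for S'
    using that D by (auto simp: canonical_transversal_def local_derivation_def)
  then show ?thesis using that R(1) by blast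
qed

text \<open>
  A small translation between elements of a transversal is zero: the points of the derived Delone
  set are isolated.
\<close>

lemma transversal_isolated:
  assumes "flc_transversal \<Omega> \<Xi>" "S \<in> \<Xi>"
  obtains R e where "R > 0" "e > 0"
    "\<And>S' x. S' \<in> \<Xi> \<Longrightarrow> norm x < e \<Longrightarrow> agree R S' (shift x S) \<Longrightarrow> x = 0"
proof -
  obtain \<Omega>0 :: "('d, real) pattern set" and \<D> where D: "local_derivation \<Omega> \<Omega>0 \<D>"
    "\<Xi> = {T \<in> \<Omega>. \<D> T \<in> canonical_transversal \<Omega>0}" "\<forall>S\<in>\<Omega>0. delone S"
    using assms(1) unfolding flc_transversal_def by blast
  have S: "S \<in> \<Omega>" using assms(2) D(2) by blast
  then have "delone (\<D> S)" using D by (auto simp: local_derivation_def)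
  then obtain X lab where X: "\<D> S = (\<lambda>p. ({p}, lab p)) ` X" "uniform_discrete X" unfolding delone_def by blast
  then obtain e where e: "e > 0" "\<And>p q. p \<in> X \<Longrightarrow> q \<in> X \<Longrightarrow> dist p q < e \<Longrightarrow> p = q"
    unfolding uniform_discrete_def by blast
  obtain R where R: "R > 0" "\<And>T T'. T \<in> \<Omega> \<Longrightarrow> T' \<in> \<Omega> \<Longrightarrow> patch T 0 R = patch T' 0 R \<Longrightarrow> patch (\<D> T) 0 1 = patch (\<D> T') 0 1"
    using D(1) unfolding local_derivation_def by (meson zero_less_one)
  show ?thesis
  proof (rule that[OF R(1) e(1)])
    fix S' x assume S': "S' \<in> \<Xi>" "norm x < e" "agree R S' (shift x S)"
    obtain l where "({0}, l) \<in> patch (\<D> S') 0 1"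
      using S'(1) D(2) by (auto simp: canonical_transversal_def patch_def)
    moreover have "patch (\<D> S') 0 1 = patch (\<D> (shift x S)) 0 1"
      by (rule R(2)) (use S' S D(2) in \<open>auto simp: agree_def\<close>)
    ultimately have "({0}, l) \<in> shift x (\<D> S)"
      using D(1) S by (auto simp: local_derivation_def patch_def)
    then have "x \<in> X" by (auto simp: X(1) shift_def shift_tile_def)
    moreover have "0 \<in> X"
      using assms(2) D(2) by (auto simp: canonical_transversal_def X(1))
    ultimately show "x = 0" using e(2)[of x 0] S'(2) by simp
  qed
qed

text \<open>
  Transversal local constancy without reference to transversals: near \<open>T\<close> the value is determined by
  a patch of \<open>T\<close>, whose size may depend on \<open>T\<close>.
\<close>

definition patch_stable :: "(('d, 'l) pattern \<Rightarrow> 'b) \<Rightarrow> bool" where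
  "patch_stable f \<longleftrightarrow> (\<forall>T\<in>\<Omega>. \<exists>R>0. \<forall>S\<in>\<Omega>. agree R S T \<longrightarrow> f S = f T)"

lemma patch_stableE:
  assumes "patch_stable f" "T \<in> \<Omega>"
  obtains R where "R > 0" "\<And>S. S \<in> \<Omega> \<Longrightarrow> agree R S T \<Longrightarrow> f S = f T"
  using assms unfolding patch_stable_def by blast

lemma locally_constant_on_iff_nbd:
  assumes "A \<subseteq> \<Omega>"
  shows "locally_constant_on (space_topology \<Omega>) A f \<longleftrightarrow>
    (\<forall>T\<in>A. \<exists>R>0. \<exists>e>0. \<forall>S\<in>nbd \<Omega> T R e \<inter> A. f S = f T)"
proof
  assume lc: "locally_constant_on (space_topology \<Omega>) A f"
  show "\<forall>T\<in>A. \<exists>R>0. \<exists>e>0. \<forall>S\<in>nbd \<Omega> T R e \<inter> A. f S = f T"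
  proof
    fix T assume "T \<in> A"
    then obtain N where N: "openin (space_topology \<Omega>) N" "T \<in> N" "\<forall>S\<in>N \<inter> A. f S = f T"
      using lc unfolding locally_constant_on_def by blast
    obtain R e where "R > 0" "e > 0" "nbd \<Omega> T R e \<subseteq> N"
      using N(1,2) unfolding openin_iff_nbd by blast
    then show "\<exists>R>0. \<exists>e>0. \<forall>S\<in>nbd \<Omega> T R e \<inter> A. f S = f T" using N(3) by blast
  qed
next
  assume r: "\<forall>T\<in>A. \<exists>R>0. \<exists>e>0. \<forall>S\<in>nbd \<Omega> T R e \<inter> A. f S = f T"
  show "locally_constant_on (space_topology \<Omega>) A f"
    unfolding locally_constant_on_def
  proof
    fix T assume T: "T \<in> A"
    then obtain R e where "R > 0" "e > 0" and c: "\<And>S. S \<in> nbd \<Omega> T R e \<Longrightarrow> S \<in> A \<Longrightarrow> f S = f T"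
      using r by blast
    then obtain U where "openin (space_topology \<Omega>) U" "T \<in> U" "U \<subseteq> nbd \<Omega> T R e"
      using open_nhd_in_nbd[of T R e] T assms by blast
    then show "\<exists>N. openin (space_topology \<Omega>) N \<and> T \<in> N \<and> (\<forall>y\<in>N \<inter> A. f y = f T)"
      using c by blast
  qed
qed

lemma punctures_nonempty: "T \<in> \<Omega> \<Longrightarrow> punctures T \<noteq> {}"
  using punctures_relatively_dense unfolding relatively_dense_def by blast

text \<open>
  Within a transversal, a neighbourhood of \<open>S\<close> consists of the elements with the same patch as \<open>S\<close>;
  and every element of \<open>\<Omega>\<close> lies in some transversal.
\<close>

lemma transversally_locally_constant_iff:
  "transversally_locally_constant \<Omega> f \<longleftrightarrow> patch_stable f"
proof
  assume f: "transversally_locally_constant \<Omega> f"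
  show "patch_stable f"
    unfolding patch_stable_def
  proof
    fix T assume T: "T \<in> \<Omega>"
    obtain y where y: "y \<in> punctures T" using punctures_nonempty[OF T] by blast
    let ?\<Xi> = "{T \<in> \<Omega>. y \<in> punctures T}"
    have "locally_constant_on (space_topology \<Omega>) ?\<Xi> f"
      using f flc_transversal_punctures unfolding transversally_locally_constant_def by blast
    then obtain R e where R: "R > 0" "e > 0" "\<And>S. S \<in> nbd \<Omega> T R e \<Longrightarrow> S \<in> ?\<Xi> \<Longrightarrow> f S = f T"
      using T y by (subst (asm) locally_constant_on_iff_nbd) auto
    have "f S = f T" if S: "S \<in> \<Omega>" "agree (max R (norm y + 1)) S T" for S
    proof (rule R(3))
      show "S \<in> nbd \<Omega> T R e"
        using S R(2) agree_mono[OF S(2), of R] by (intro nbdI[of _ _ 0]) auto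
      show "S \<in> ?\<Xi>" using punctures_agree[OF T S] S(1) y by simp
    qed
    then show "\<exists>R>0. \<forall>S\<in>\<Omega>. agree R S T \<longrightarrow> f S = f T"
      using R(1) by (intro exI[of _ "max R (norm y + 1)"]) auto
  qed
next
  assume f: "patch_stable f"
  show "transversally_locally_constant \<Omega> f"
    unfolding transversally_locally_constant_def
  proof (intro allI impI)
    fix \<Xi> assume \<Xi>: "flc_transversal \<Omega> \<Xi>"
    then have sub: "\<Xi> \<subseteq> \<Omega>" by (auto simp: flc_transversal_def)
    show "locally_constant_on (space_topology \<Omega>) \<Xi> f"
      unfolding locally_constant_on_iff_nbd[OF sub]
    proof
      fix T assume T: "T \<in> \<Xi>"
      obtain R where R: "R > 0" "\<And>S. S \<in> \<Omega> \<Longrightarrow> agree R S T \<Longrightarrow> f S = f T"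
        using patch_stableE[OF f, of T] T sub by blast
      obtain R' e where e: "R' > 0" "e > 0" "\<And>S x. S \<in> \<Xi> \<Longrightarrow> norm x < e \<Longrightarrow> agree R' S (shift x T) \<Longrightarrow> x = 0"
        using transversal_isolated[OF \<Xi> T] by blast
      have "f S = f T" if "S \<in> nbd \<Omega> T (max R R') e \<inter> \<Xi>" for S
      proof -
        obtain x where x: "S \<in> \<Omega>" "S \<in> \<Xi>" "norm x < e" "agree (max R R') S (shift x T)"
          using \<open>S \<in> nbd \<Omega> T (max R R') e \<inter> \<Xi>\<close> unfolding nbd_def by blast
        then have "x = 0" using e(3) agree_mono by (metis max.cobounded2)
        then show ?thesis using R(2) x agree_mono by (metis max.cobounded1 shift_0)
      qed
      then show "\<exists>R>0. \<exists>e>0. \<forall>S\<in>nbd \<Omega> T R e \<inter> \<Xi>. f S = f T"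
        using R(1) e(2) by (intro exI[of _ "max R R'"] conjI exI[of _ e]) auto
    qed
  qed
qed

lemma flow_box_subset:
  assumes "open_flow_box \<Omega> (\<Xi>, \<epsilon>)"
  shows "\<Xi> \<subseteq> \<Omega>" "flow_box \<Xi> \<epsilon> \<subseteq> \<Omega>" "openin (space_topology \<Omega>) (flow_box \<Xi> \<epsilon>)" "flc_transversal \<Omega> \<Xi>"
proof -
  show t: "flc_transversal \<Omega> \<Xi>" and "openin (space_topology \<Omega>) (flow_box \<Xi> \<epsilon>)"
    using assms by (simp_all add: open_flow_box_def)
  show "\<Xi> \<subseteq> \<Omega>" using t by (auto simp: flc_transversal_def)
  then show "flow_box \<Xi> \<epsilon> \<subseteq> \<Omega>" by (auto simp: flow_box_def)
qed

lemma flow_box_primitive_shift: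
  assumes "open_flow_box \<Omega> (\<Xi>, \<epsilon>)" "S \<in> \<Xi>" "norm x < \<epsilon>"
  shows "flow_box_primitive \<alpha> (\<Xi>, \<epsilon>) (shift x S) = \<alpha> S x"
proof -
  have "inj_on (\<lambda>(S, x). shift x S) (\<Xi> \<times> ball 0 \<epsilon>)" using assms(1) by (simp add: open_flow_box_def)
  then have "inv_into (\<Xi> \<times> ball 0 \<epsilon>) (\<lambda>(S, x). shift x S) (shift x S) = (S, x)"
    using inv_into_f_f[of "\<lambda>(S, x). shift x S" "\<Xi> \<times> ball 0 \<epsilon>" "(S, x)"] assms(2,3) by auto
  then show ?thesis by (simp add: flow_box_primitive_def)
qed

lemma flow_boxE:
  assumes "T \<in> flow_box \<Xi> \<epsilon>"
  obtains S x where "S \<in> \<Xi>" "norm x < \<epsilon>" "T = shift x S"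
  using assms by (auto simp: flow_box_def)

text \<open>
  The coordinates of a flow box follow small translations and see only a patch: an element that
  agrees with \<open>(S - x) - z\<close> has the coordinates \<open>(S', x + z)\<close> with \<open>S'\<close> agreeing with \<open>S\<close>.
\<close>

lemma flow_box_coordinates:
  assumes box: "open_flow_box \<Omega> (\<Xi>, \<epsilon>)" and S: "S \<in> \<Xi>" and x: "norm x < \<epsilon>"
  obtains R e where "R > 0" "e > 0"
    "\<And>T' z. T' \<in> \<Omega> \<Longrightarrow> norm z < e \<Longrightarrow> agree R T' (shift z (shift x S)) \<Longrightarrow>
       shift (- x - z) T' \<in> \<Xi> \<and> agree r (shift (- x - z) T') S \<and> norm (x + z) < \<epsilon>"
proof -
  obtain R where R: "R > 0" "\<And>S'. S' \<in> \<Omega> \<Longrightarrow> agree R S' S \<Longrightarrow> S' \<in> \<Xi>"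
    using transversal_open[OF flow_box_subset(4)[OF box] S] by blast
  define R' where "R' = \<epsilon> + max R r"
  show ?thesis
  proof
    show "R' > 0" using x R(1) norm_ge_zero[of x] unfolding R'_def by linarith
    show "\<epsilon> - norm x > 0" using x by simp
    fix T' z assume T': "T' \<in> \<Omega>" and z: "norm z < \<epsilon> - norm x" and ag: "agree R' T' (shift z (shift x S))"
    have xz: "norm (x + z) < \<epsilon>" using z norm_triangle_ineq[of x z] by simp
    have "agree (max R r) (shift (- (x + z)) T') S"
      using ag xz by (intro agree_shiftD[of R']) (auto simp: R'_def add.commute)
    then have "agree (max R r) (shift (- x - z) T') S" by simp
    then have "agree R (shift (- x - z) T') S" "agree r (shift (- x - z) T') S"
      by (auto elim: agree_mono)
    then show "shift (- x - z) T' \<in> \<Xi> \<and> agree r (shift (- x - z) T') S \<and> norm (x + z) < \<epsilon>"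
      using R(2) T' xz by auto
  qed
qed

text \<open>
  For a puncture \<open>y\<close> of \<open>T\<close> the transversal consists of the elements with a puncture at \<open>y\<close>. The
  coordinate \<open>x\<close> of \<open>S - x\<close> is read off from the puncture \<open>y - x\<close>, the only one near \<open>y\<close>.
\<close>

lemma flow_box_exists:
  assumes T: "T \<in> \<Omega>"
  obtains \<Xi> \<epsilon> where "open_flow_box \<Omega> (\<Xi>, \<epsilon>)" "T \<in> flow_box \<Xi> \<epsilon>"
proof -
  obtain y where y: "y \<in> punctures T" using punctures_nonempty[OF T] by blast
  obtain \<sigma> where \<sigma>: "\<sigma> > 0"
    "\<And>T p q. T \<in> \<Omega> \<Longrightarrow> p \<in> punctures T \<Longrightarrow> q \<in> punctures T \<Longrightarrow> dist p q < \<sigma> \<Longrightarrow> p = q"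
    using punctures_separated by blast
  define \<Xi> where "\<Xi> = {T \<in> \<Omega>. y \<in> punctures T}"
  define \<epsilon> where "\<epsilon> = \<sigma> / 2"
  have e: "\<epsilon> > 0" using \<sigma>(1) by (simp add: \<epsilon>_def)
  have tr: "flc_transversal \<Omega> \<Xi>" unfolding \<Xi>_def by (rule flc_transversal_punctures)
  have mem: "U \<in> flow_box \<Xi> \<epsilon> \<longleftrightarrow> U \<in> \<Omega> \<and> (\<exists>x. norm x < \<epsilon> \<and> y - x \<in> punctures U)" for U
  proof
    assume "U \<in> flow_box \<Xi> \<epsilon>"
    then obtain S x where "S \<in> \<Xi>" "norm x < \<epsilon>" "U = shift x S" by (rule flow_boxE)
    then show "U \<in> \<Omega> \<and> (\<exists>x. norm x < \<epsilon> \<and> y - x \<in> punctures U)"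
      by (auto simp: \<Xi>_def mem_punctures_shift)
  next
    assume "U \<in> \<Omega> \<and> (\<exists>x. norm x < \<epsilon> \<and> y - x \<in> punctures U)"
    then obtain x where x: "U \<in> \<Omega>" "norm x < \<epsilon>" "y - x \<in> punctures U" by blast
    then have "(shift (- x) U, x) \<in> \<Xi> \<times> ball 0 \<epsilon>" by (simp add: \<Xi>_def mem_punctures_shift)
    moreover have "U = (\<lambda>(S, x). shift x S) (shift (- x) U, x)" by simp
    ultimately show "U \<in> flow_box \<Xi> \<epsilon>" unfolding flow_box_def by (rule rev_image_eqI)
  qed
  have "inj_on (\<lambda>(S, x). shift x S) (\<Xi> \<times> ball 0 \<epsilon>)"
  proof (rule inj_onI, clarsimp)
    fix S x S' x' assume S: "S \<in> \<Xi>" "norm x < \<epsilon>" "S' \<in> \<Xi>" "norm x' < \<epsilon>" "shift x S = shift x' S'"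
    have "y - x \<in> punctures (shift x S)" "y - x' \<in> punctures (shift x S)" "shift x S \<in> \<Omega>"
      using S(1,3) mem_punctures_shift[of S "y - x" x] mem_punctures_shift[of S' "y - x'" x'] S(5)
      by (auto simp: \<Xi>_def)
    moreover have "dist (y - x) (y - x') < \<sigma>"
      using S(2,4) norm_triangle_ineq4[of x' x] by (simp add: dist_norm \<epsilon>_def)
    ultimately have "y - x = y - x'" using \<sigma>(2) by blast
    then have "x = x'" by simp
    moreover have "S = shift (- x) (shift x S)" by simp
    ultimately show "S = S' \<and> x = x'" using S(5) by (metis add.left_inverse shift_0 shift_shift)
  qed
  moreover have "openin (space_topology \<Omega>) (flow_box \<Xi> \<epsilon>)"
    unfolding openin_iff_nbd
  proof (intro conjI ballI)
    show "flow_box \<Xi> \<epsilon> \<subseteq> \<Omega>" using mem by blast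
    fix U assume "U \<in> flow_box \<Xi> \<epsilon>"
    then obtain x where x: "U \<in> \<Omega>" "norm x < \<epsilon>" "y - x \<in> punctures U" using mem by blast
    define e where "e = \<epsilon> - norm x"
    have "nbd \<Omega> U (norm y + \<epsilon> + 1) e \<subseteq> flow_box \<Xi> \<epsilon>"
    proof
      fix V assume "V \<in> nbd \<Omega> U (norm y + \<epsilon> + 1) e"
      then obtain z where z: "V \<in> \<Omega>" "norm z < e" "agree (norm y + \<epsilon> + 1) V (shift z U)" by (auto simp: nbd_def)
      have xz: "norm (x + z) < \<epsilon>" using z(2) norm_triangle_ineq[of x z] by (simp add: e_def)
      have "y - (x + z) \<in> punctures (shift z U)" using x by (simp add: mem_punctures_shift)
      moreover have "norm (y - (x + z)) < norm y + \<epsilon> + 1" using xz norm_triangle_ineq4[of y "x + z"] by linarith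
      ultimately have "y - (x + z) \<in> punctures V"
        using punctures_agree[OF _ z(1,3)] x(1) by auto
      then show "V \<in> flow_box \<Xi> \<epsilon>" using mem z(1) xz by blast
    qed
    moreover have "e > 0" "norm y + \<epsilon> + 1 > 0" using x(2) \<open>\<epsilon> > 0\<close> by (auto simp: e_def add_nonneg_pos)
    ultimately show "\<exists>R>0. \<exists>e>0. nbd \<Omega> U R e \<subseteq> flow_box \<Xi> \<epsilon>" by blast
  qed
  ultimately have "open_flow_box \<Omega> (\<Xi>, \<epsilon>)" using e tr by (simp add: open_flow_box_def)
  moreover have "T \<in> flow_box \<Xi> \<epsilon>" using mem T y e by (auto intro!: exI[of _ 0])
  ultimately show ?thesis by (rule that)
qed

end


section \<open>Cech cocycles\<close>

lemma locally_constant_onE: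
  assumes "locally_constant_on X A f" "x \<in> A"
  obtains N where "openin X N" "x \<in> N" "\<And>y. y \<in> N \<Longrightarrow> y \<in> A \<Longrightarrow> f y = f x"
proof -
  obtain N where "openin X N \<and> x \<in> N \<and> (\<forall>y\<in>N \<inter> A. f y = f x)"
    using assms(1)[unfolded locally_constant_on_def, rule_format, OF assms(2)] ..
  then show thesis by (intro that[of N]) auto
qed

lemma locally_constant_on_subset: "locally_constant_on X A f \<Longrightarrow> B \<subseteq> A \<Longrightarrow> locally_constant_on X B f"
  unfolding locally_constant_on_def
proof
  fix x assume A: "\<forall>x\<in>A. \<exists>N. openin X N \<and> x \<in> N \<and> (\<forall>y\<in>N \<inter> A. f y = f x)" and B: "B \<subseteq> A" and x: "x \<in> B"
  then obtain N where "openin X N \<and> x \<in> N \<and> (\<forall>y\<in>N \<inter> A. f y = f x)" by (meson subsetD)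
  then show "\<exists>N. openin X N \<and> x \<in> N \<and> (\<forall>y\<in>N \<inter> B. f y = f x)"
    using B by (intro exI[of _ N]) auto
qed

lemma locally_constant_on_const: "A \<subseteq> topspace X \<Longrightarrow> locally_constant_on X A (\<lambda>_. c)"
  unfolding locally_constant_on_def by (auto intro: exI[of _ "topspace X"])

lemma locally_constant_on_compose2:
  assumes "locally_constant_on X A f" "locally_constant_on X A g"
  shows "locally_constant_on X A (\<lambda>x. F (f x) (g x))"
  unfolding locally_constant_on_def
proof
  fix x assume x: "x \<in> A"
  obtain M where M: "openin X M" "x \<in> M" "\<And>y. y \<in> M \<Longrightarrow> y \<in> A \<Longrightarrow> f y = f x"
    using locally_constant_onE[OF assms(1) x] by blast
  obtain N where N: "openin X N" "x \<in> N" "\<And>y. y \<in> N \<Longrightarrow> y \<in> A \<Longrightarrow> g y = g x"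
    using locally_constant_onE[OF assms(2) x] by blast
  have "openin X (M \<inter> N)" using M(1) N(1) by (rule openin_Int)
  then show "\<exists>N. openin X N \<and> x \<in> N \<and> (\<forall>y\<in>N \<inter> A. F (f y) (g y) = F (f x) (g x))"
    using M N by (intro exI[of _ "M \<inter> N"]) auto
qed

lemma locally_constant_on_preimage:
  assumes "locally_constant_on Y A f" "continuous_map X Y h" "B \<subseteq> topspace X" "h ` B \<subseteq> A"
  shows "locally_constant_on X B (\<lambda>x. f (h x))"
  unfolding locally_constant_on_def
proof
  fix x assume x: "x \<in> B"
  then obtain N where N: "openin Y N" "h x \<in> N" "\<And>y. y \<in> N \<Longrightarrow> y \<in> A \<Longrightarrow> f y = f (h x)"
    using locally_constant_onE[OF assms(1), of "h x"] assms(4) by blast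
  have "openin X {x \<in> topspace X. h x \<in> N}"
    using assms(2) N(1) by (rule openin_continuous_map_preimage)
  then show "\<exists>N. openin X N \<and> x \<in> N \<and> (\<forall>y\<in>N \<inter> B. f (h y) = f (h x))"
    using x N assms(3,4) by (intro exI[of _ "{x \<in> topspace X. h x \<in> N}"]) auto
qed

lemma cech_cocycleD:
  assumes "cech_cocycle X (I, U, g)"
  shows "\<And>i. i \<in> I \<Longrightarrow> openin X (U i)"
    and "(\<Union>i\<in>I. U i) = topspace X"
    and "\<And>i j. i \<in> I \<Longrightarrow> j \<in> I \<Longrightarrow> locally_constant_on X (U i \<inter> U j) (g i j)"
    and "\<And>i j k x. i \<in> I \<Longrightarrow> j \<in> I \<Longrightarrow> k \<in> I \<Longrightarrow> x \<in> U i \<Longrightarrow> x \<in> U j \<Longrightarrow> x \<in> U k \<Longrightarrow>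
      g i j x + g j k x = g i k x"
  using assms unfolding cech_cocycle_def by blast+

text \<open>Two members of an indexed common refinement may coincide; one index is chosen for each set.\<close>

lemma cech_cohomologousI:
  assumes W: "\<And>k. k \<in> K \<Longrightarrow> openin X (W k)" "(\<Union>k\<in>K. W k) = topspace X"
    and r: "\<And>k. k \<in> K \<Longrightarrow> r k \<in> I" "\<And>k. k \<in> K \<Longrightarrow> W k \<subseteq> U (r k)"
    and s: "\<And>k. k \<in> K \<Longrightarrow> s k \<in> J" "\<And>k. k \<in> K \<Longrightarrow> W k \<subseteq> V (s k)"
    and b: "\<And>k. k \<in> K \<Longrightarrow> locally_constant_on X (W k) (b k)"
    and eq: "\<And>k l x. k \<in> K \<Longrightarrow> l \<in> K \<Longrightarrow> x \<in> W k \<Longrightarrow> x \<in> W l \<Longrightarrow>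
      g (r k) (r l) x - m (s k) (s l) x = b k x - b l x"
  shows "cech_cohomologous X (I, U, g) (J, V, m)"
  unfolding cech_cohomologous_def prod.case
proof (intro exI conjI)
  let ?i = "inv_into K W"
  have i: "?i A \<in> K" "W (?i A) = A" if "A \<in> W ` K" for A
    using that by (simp_all add: inv_into_into f_inv_into_f)
  show "\<forall>A\<in>W ` K. openin X A \<and> (r \<circ> ?i) A \<in> I \<and> A \<subseteq> U ((r \<circ> ?i) A) \<and>
      (s \<circ> ?i) A \<in> J \<and> A \<subseteq> V ((s \<circ> ?i) A) \<and> locally_constant_on X A ((b \<circ> ?i) A)"
  proof
    fix A assume A: "A \<in> W ` K"
    note k = i[OF A]
    show "openin X A \<and> (r \<circ> ?i) A \<in> I \<and> A \<subseteq> U ((r \<circ> ?i) A) \<and>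
      (s \<circ> ?i) A \<in> J \<and> A \<subseteq> V ((s \<circ> ?i) A) \<and> locally_constant_on X A ((b \<circ> ?i) A)"
      using W(1)[OF k(1)] r[OF k(1)] s[OF k(1)] b[OF k(1)] unfolding k(2) o_def by blast
  qed
  show "\<forall>A\<in>W ` K. \<forall>B\<in>W ` K. \<forall>x\<in>A \<inter> B.
      g ((r \<circ> ?i) A) ((r \<circ> ?i) B) x - m ((s \<circ> ?i) A) ((s \<circ> ?i) B) x = (b \<circ> ?i) A x - (b \<circ> ?i) B x"
  proof (intro ballI)
    fix A B x assume "A \<in> W ` K" "B \<in> W ` K" "x \<in> A \<inter> B"
    then show "g ((r \<circ> ?i) A) ((r \<circ> ?i) B) x - m ((s \<circ> ?i) A) ((s \<circ> ?i) B) x =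
        (b \<circ> ?i) A x - (b \<circ> ?i) B x"
      using eq[OF i(1) i(1), of A B x] i(2) by simp
  qed
qed (rule W(2))

lemma cech_cohomologousE:
  assumes "cech_cohomologous X (I, U, g) (J, V, m)"
  obtains \<W> r s b where "\<And>W. W \<in> \<W> \<Longrightarrow> openin X W" "\<Union>\<W> = topspace X"
    "\<And>W. W \<in> \<W> \<Longrightarrow> r W \<in> I" "\<And>W. W \<in> \<W> \<Longrightarrow> W \<subseteq> U (r W)"
    "\<And>W. W \<in> \<W> \<Longrightarrow> s W \<in> J" "\<And>W. W \<in> \<W> \<Longrightarrow> W \<subseteq> V (s W)"
    "\<And>W. W \<in> \<W> \<Longrightarrow> locally_constant_on X W (b W)"
    "\<And>W W' x. W \<in> \<W> \<Longrightarrow> W' \<in> \<W> \<Longrightarrow> x \<in> W \<Longrightarrow> x \<in> W' \<Longrightarrow>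
      g (r W) (r W') x - m (s W) (s W') x = b W x - b W' x"
proof -
  obtain \<W> r s b where "(\<forall>W\<in>\<W>. openin X W \<and> r W \<in> I \<and> W \<subseteq> U (r W) \<and> s W \<in> J \<and> W \<subseteq> V (s W) \<and>
      locally_constant_on X W (b W)) \<and> \<Union>\<W> = topspace X \<and>
    (\<forall>W\<in>\<W>. \<forall>W'\<in>\<W>. \<forall>x \<in> W \<inter> W'. g (r W) (r W') x - m (s W) (s W') x = b W x - b W' x)"
    using assms unfolding cech_cohomologous_def prod.case by (elim exE) (rule that)
  note W = this[THEN conjunct1] this[THEN conjunct2, THEN conjunct1] this[THEN conjunct2, THEN conjunct2]
  show thesis
  proof (rule that[OF _ W(2)])
    fix A assume "A \<in> \<W>"
    note w = W(1)[rule_format, OF this]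
    show "openin X A" "r A \<in> I" "A \<subseteq> U (r A)" "s A \<in> J" "A \<subseteq> V (s A)" "locally_constant_on X A (b A)"
      using w by simp_all
  next
    fix A B x assume "A \<in> \<W>" "B \<in> \<W>" "x \<in> A" "x \<in> B"
    then show "g (r A) (r B) x - m (s A) (s B) x = b A x - b B x"
      using W(3)[rule_format, of A B x] by simp
  qed
qed

lemma cech_cohomologous_sym:
  assumes "cech_cohomologous X C D"
  shows "cech_cohomologous X D C"
proof -
  obtain I U g where C: "C = (I, U, g)" by (cases C)
  obtain J V m where D: "D = (J, V, m)" by (cases D)
  obtain \<W> r s b where W: "\<And>W. W \<in> \<W> \<Longrightarrow> openin X W" "\<Union>\<W> = topspace X"
    "\<And>W. W \<in> \<W> \<Longrightarrow> r W \<in> I" "\<And>W. W \<in> \<W> \<Longrightarrow> W \<subseteq> U (r W)"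
    "\<And>W. W \<in> \<W> \<Longrightarrow> s W \<in> J" "\<And>W. W \<in> \<W> \<Longrightarrow> W \<subseteq> V (s W)"
    "\<And>W. W \<in> \<W> \<Longrightarrow> locally_constant_on X W (b W)"
    "\<And>W W' x. W \<in> \<W> \<Longrightarrow> W' \<in> \<W> \<Longrightarrow> x \<in> W \<Longrightarrow> x \<in> W' \<Longrightarrow>
      g (r W) (r W') x - m (s W) (s W') x = b W x - b W' x"
    using cech_cohomologousE[OF assms[unfolded C D]] by blast
  show ?thesis
    unfolding C D
  proof (rule cech_cohomologousI[where K = \<W> and W = id and r = s and s = r and b = "\<lambda>W x. - b W x"])
    fix W W' x assume "W \<in> \<W>" "W' \<in> \<W>" "x \<in> id W" "x \<in> id W'"
    then show "m (s W) (s W') x - g (r W) (r W') x = - b W x - - b W' x"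
      using W(8)[of W W' x] by (simp add: algebra_simps)
  next
    fix W assume "W \<in> \<W>"
    then show "locally_constant_on X (id W) (\<lambda>x. - b W x)"
      using locally_constant_on_compose2[OF W(7) W(7), where F = "\<lambda>y _. - y"] by simp
  qed (use W in auto)
qed

text \<open>
  On a common refinement of two refinements the middle cocycle is pulled back along two different
  refinement maps; the difference is the coboundary of the cocycle itself.
\<close>

lemma cech_cohomologous_trans:
  fixes C :: "('i, 'a, 'g::ab_group_add) cech"
  assumes CD: "cech_cohomologous X C D" and DE: "cech_cohomologous X D E" and D: "cech_cocycle X D"
  shows "cech_cohomologous X C E"
proof -
  obtain I U g where C: "C = (I, U, g)" by (cases C)
  obtain J V m where D': "D = (J, V, m)" by (cases D)
  obtain L Z n where E: "E = (L, Z, n)" by (cases E)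
  note cD = cech_cocycleD[OF D[unfolded D']]
  obtain \<W> r s b where W: "\<And>W. W \<in> \<W> \<Longrightarrow> openin X W" "\<Union>\<W> = topspace X"
    "\<And>W. W \<in> \<W> \<Longrightarrow> r W \<in> I" "\<And>W. W \<in> \<W> \<Longrightarrow> W \<subseteq> U (r W)"
    "\<And>W. W \<in> \<W> \<Longrightarrow> s W \<in> J" "\<And>W. W \<in> \<W> \<Longrightarrow> W \<subseteq> V (s W)"
    "\<And>W. W \<in> \<W> \<Longrightarrow> locally_constant_on X W (b W)"
    "\<And>W W' x. W \<in> \<W> \<Longrightarrow> W' \<in> \<W> \<Longrightarrow> x \<in> W \<Longrightarrow> x \<in> W' \<Longrightarrow>
      g (r W) (r W') x - m (s W) (s W') x = b W x - b W' x"
    using cech_cohomologousE[OF CD[unfolded C D']] by blast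
  obtain \<Y> r' s' b' where Y: "\<And>W. W \<in> \<Y> \<Longrightarrow> openin X W" "\<Union>\<Y> = topspace X"
    "\<And>W. W \<in> \<Y> \<Longrightarrow> r' W \<in> J" "\<And>W. W \<in> \<Y> \<Longrightarrow> W \<subseteq> V (r' W)"
    "\<And>W. W \<in> \<Y> \<Longrightarrow> s' W \<in> L" "\<And>W. W \<in> \<Y> \<Longrightarrow> W \<subseteq> Z (s' W)"
    "\<And>W. W \<in> \<Y> \<Longrightarrow> locally_constant_on X W (b' W)"
    "\<And>W W' x. W \<in> \<Y> \<Longrightarrow> W' \<in> \<Y> \<Longrightarrow> x \<in> W \<Longrightarrow> x \<in> W' \<Longrightarrow>
      m (r' W) (r' W') x - n (s' W) (s' W') x = b' W x - b' W' x"
    using cech_cohomologousE[OF DE[unfolded D' E]] by blast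
  define c where "c k x = b (fst k) x + (m (s (fst k)) (r' (snd k)) x + b' (snd k) x)" for k x
  show ?thesis
    unfolding C E
  proof (rule cech_cohomologousI[where K = "\<W> \<times> \<Y>" and W = "\<lambda>k. fst k \<inter> snd k"
        and r = "\<lambda>k. r (fst k)" and s = "\<lambda>k. s' (snd k)" and b = c])
    show "(\<Union>k\<in>\<W> \<times> \<Y>. fst k \<inter> snd k) = topspace X"
    proof -
      have "(\<Union>k\<in>\<W> \<times> \<Y>. fst k \<inter> snd k) = \<Union>\<W> \<inter> \<Union>\<Y>" by auto
      then show ?thesis by (simp only: W(2) Y(2) Int_absorb)
    qed
  next
    fix k assume "k \<in> \<W> \<times> \<Y>"
    then have k: "fst k \<in> \<W>" "snd k \<in> \<Y>" by auto
    have "locally_constant_on X (fst k \<inter> snd k) (m (s (fst k)) (r' (snd k)))"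
      by (rule locally_constant_on_subset[OF cD(3)]) (use W(5,6)[OF k(1)] Y(3,4)[OF k(2)] in auto)
    moreover have "locally_constant_on X (fst k \<inter> snd k) (b (fst k))"
      by (rule locally_constant_on_subset[OF W(7)[OF k(1)]]) simp
    moreover have "locally_constant_on X (fst k \<inter> snd k) (b' (snd k))"
      by (rule locally_constant_on_subset[OF Y(7)[OF k(2)]]) simp
    ultimately show "locally_constant_on X (fst k \<inter> snd k) (c k)"
      unfolding c_def
      using locally_constant_on_compose2[where F = "(+)"] by metis
    show "openin X (fst k \<inter> snd k)" using W(1) Y(1) k by blast
    show "fst k \<inter> snd k \<subseteq> U (r (fst k))" using W(4)[OF k(1)] by blast
    show "fst k \<inter> snd k \<subseteq> Z (s' (snd k))" using Y(6)[OF k(2)] by blast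
  next
    fix k l x assume kl: "k \<in> \<W> \<times> \<Y>" "l \<in> \<W> \<times> \<Y>" and x: "x \<in> fst k \<inter> snd k" "x \<in> fst l \<inter> snd l"
    have k: "fst k \<in> \<W>" "snd k \<in> \<Y>" "fst l \<in> \<W>" "snd l \<in> \<Y>" using kl by auto
    have J: "s (fst k) \<in> J" "s (fst l) \<in> J" "r' (snd k) \<in> J" "r' (snd l) \<in> J" using W(5) Y(3) k by auto
    have V: "x \<in> V (s (fst k))" "x \<in> V (s (fst l))" "x \<in> V (r' (snd k))" "x \<in> V (r' (snd l))"
      using W(6) Y(4) k x by blast+
    have "m (s (fst k)) (s (fst l)) x + m (s (fst l)) (r' (snd l)) x = m (s (fst k)) (r' (snd l)) x"
      by (rule cD(4)) (use J V in auto)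
    moreover have "m (s (fst k)) (r' (snd k)) x + m (r' (snd k)) (r' (snd l)) x = m (s (fst k)) (r' (snd l)) x"
      by (rule cD(4)) (use J V in auto)
    moreover have "g (r (fst k)) (r (fst l)) x = m (s (fst k)) (s (fst l)) x + (b (fst k) x - b (fst l) x)"
      using W(8)[OF k(1,3), of x] x by (simp add: algebra_simps)
    moreover have "n (s' (snd k)) (s' (snd l)) x = m (r' (snd k)) (r' (snd l)) x - (b' (snd k) x - b' (snd l) x)"
      using Y(8)[OF k(2,4), of x] x by (simp add: algebra_simps)
    moreover have "y - z = a1 + (a2 + a3) - (b1 + (b2 + b3))"
      if "p + b2 = q" "a2 + o' = q" "y = p + (a1 - b1)" "z = o' - (a3 - b3)"
      for y z a1 a2 a3 b1 b2 b3 p q o' :: 'g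
    proof -
      have p: "p = q - b2" using that(1) by (simp add: eq_diff_eq)
      have o': "o' = q - a2" using that(2) by (simp add: eq_diff_eq add.commute)
      show ?thesis unfolding that(3,4) p o' by (simp add: algebra_simps)
    qed
    ultimately show "g (r (fst k)) (r (fst l)) x - n (s' (snd k)) (s' (snd l)) x = c k x - c l x"
      unfolding c_def by blast
  qed (use W(3) Y(5) in auto)
qed

lemma cech_class_eq:
  fixes C :: "('i, 'a, 'g::ab_group_add) cech" and D :: "('j, 'a, 'g) cech"
  assumes "cech_cocycle X C" "cech_cocycle X D" "cech_cohomologous X C D"
  shows "cech_class X C = cech_class X D"
proof -
  have "cech_cohomologous X C E \<longleftrightarrow> cech_cohomologous X D E" for E :: "('a set, 'a, 'g) cech"
    using cech_cohomologous_trans[OF assms(3) _ assms(2), of E]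
      cech_cohomologous_trans[OF cech_cohomologous_sym[OF assms(3)] _ assms(1), of E] by blast
  then show ?thesis by (simp add: cech_class_def)
qed

text \<open>A cocycle is cohomologous to one indexed by the members of its cover.\<close>

lemma cech_class_nonempty:
  fixes C :: "('i, 'a, 'g::ab_group_add) cech"
  assumes "cech_cocycle X C"
  obtains D where "D \<in> cech_class X C"
proof -
  obtain I U g where C: "C = (I, U, g)" by (cases C)
  note cD = cech_cocycleD[OF assms[unfolded C]]
  define i where "i = inv_into I U"
  have i: "i (U k) \<in> I" "U (i (U k)) = U k" if "k \<in> I" for k
    using that by (simp_all add: i_def inv_into_into f_inv_into_f)
  have i': "i A \<in> I" "U (i A) = A" if "A \<in> U ` I" for A
    using that by (simp_all add: i_def inv_into_into f_inv_into_f)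
  let ?D = "(U ` I, id, \<lambda>A B. g (i A) (i B)) :: ('a set, 'a, 'g) cech"
  have "cech_cocycle X ?D"
    unfolding cech_cocycle_def prod.case
  proof (intro conjI ballI)
    fix A assume A: "A \<in> U ` I"
    show "openin X (id A)" using cD(1)[OF i'(1)[OF A]] i'(2)[OF A] by simp
  next
    show "(\<Union>A\<in>U ` I. id A) = topspace X" using cD(2) by simp
  next
    fix A B assume AB: "A \<in> U ` I" "B \<in> U ` I"
    show "locally_constant_on X (id A \<inter> id B) (g (i A) (i B))"
      using cD(3)[OF i'(1)[OF AB(1)] i'(1)[OF AB(2)]] i'(2) AB by simp
  next
    fix A B E x assume "A \<in> U ` I" "B \<in> U ` I" "E \<in> U ` I" "x \<in> id A \<inter> id B \<inter> id E"
    then show "g (i A) (i B) x + g (i B) (i E) x = g (i A) (i E) x"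
      using i' by (intro cD(4)) auto
  qed
  moreover have "cech_cohomologous X (I, U, g) ?D"
  proof (rule cech_cohomologousI[where K = I and W = U and r = id and s = U and b = "\<lambda>k. g k (i (U k))"])
    fix k assume k: "k \<in> I"
    show "locally_constant_on X (U k) (g k (i (U k)))" using cD(3)[OF k i(1)[OF k]] i(2)[OF k] by simp
  next
    fix k l x assume kl: "k \<in> I" "l \<in> I" "x \<in> U k" "x \<in> U l"
    note ik = i[OF kl(1)] and il = i[OF kl(2)]
    have "g k (i (U k)) x + g (i (U k)) (i (U l)) x = g k (i (U l)) x"
      by (rule cD(4)) (use kl ik il in auto)
    moreover have "g k l x + g l (i (U l)) x = g k (i (U l)) x"
      by (rule cD(4)) (use kl ik il in auto)
    ultimately show "g (id k) (id l) x - g (i (U k)) (i (U l)) x = g k (i (U k)) x - g l (i (U l)) x"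
      by (simp add: algebra_simps)
  qed (use cD in auto)
  ultimately have "?D \<in> cech_class X C" by (simp add: cech_class_def C)
  then show ?thesis by (rule that)
qed

lemma cech_cohomologous_if_class_eq:
  assumes "cech_class X C = cech_class X D" "cech_cocycle X C"
  shows "cech_cohomologous X C D"
proof -
  obtain E where "E \<in> cech_class X C" using cech_class_nonempty[OF assms(2)] by blast
  then have "cech_cocycle X E" "cech_cohomologous X C E" "cech_cohomologous X D E"
    using assms(1) by (auto simp: cech_class_def)
  then show ?thesis using cech_cohomologous_trans cech_cohomologous_sym by blast
qed

definition cech_preimage :: "'a topology \<Rightarrow> ('a \<Rightarrow> 'b) \<Rightarrow> ('i, 'b, 'g) cech \<Rightarrow> ('i, 'a, 'g) cech" where
  "cech_preimage X h = (\<lambda>(I, U, g). (I, \<lambda>i. {x \<in> topspace X. h x \<in> U i}, \<lambda>i j x. g i j (h x)))"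

lemma cech_cocycle_preimage:
  assumes h: "continuous_map X Y h" and C: "cech_cocycle Y C"
  shows "cech_cocycle X (cech_preimage X h C)"
proof -
  obtain I U g where C': "C = (I, U, g)" by (cases C)
  note cD = cech_cocycleD[OF C[unfolded C']]
  show ?thesis
    unfolding C' cech_preimage_def cech_cocycle_def prod.case
  proof (intro conjI ballI)
    fix i assume "i \<in> I"
    then show "openin X {x \<in> topspace X. h x \<in> U i}"
      using cD(1) h by (auto intro: openin_continuous_map_preimage)
  next
    have "h x \<in> topspace Y" if "x \<in> topspace X" for x
      using h that by (auto simp: continuous_map_def)
    then show "(\<Union>i\<in>I. {x \<in> topspace X. h x \<in> U i}) = topspace X" using cD(2) by blast
  next
    fix i j assume "i \<in> I" "j \<in> I"
    then show "locally_constant_on X ({x \<in> topspace X. h x \<in> U i} \<inter> {x \<in> topspace X. h x \<in> U j}) (\<lambda>x. g i j (h x))"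
      by (intro locally_constant_on_preimage[OF cD(3) h]) auto
  next
    fix i j k x assume "i \<in> I" "j \<in> I" "k \<in> I"
      "x \<in> {x \<in> topspace X. h x \<in> U i} \<inter> {x \<in> topspace X. h x \<in> U j} \<inter> {x \<in> topspace X. h x \<in> U k}"
    then show "g i j (h x) + g j k (h x) = g i k (h x)" by (intro cD(4)) auto
  qed
qed

lemma cech_cohomologous_preimage:
  assumes h: "continuous_map X Y h" and CD: "cech_cohomologous Y C D"
  shows "cech_cohomologous X (cech_preimage X h C) (cech_preimage X h D)"
proof -
  obtain I U g where C: "C = (I, U, g)" by (cases C)
  obtain J V m where D: "D = (J, V, m)" by (cases D)
  obtain \<W> r s b where W: "\<And>W. W \<in> \<W> \<Longrightarrow> openin Y W" "\<Union>\<W> = topspace Y"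
    "\<And>W. W \<in> \<W> \<Longrightarrow> r W \<in> I" "\<And>W. W \<in> \<W> \<Longrightarrow> W \<subseteq> U (r W)"
    "\<And>W. W \<in> \<W> \<Longrightarrow> s W \<in> J" "\<And>W. W \<in> \<W> \<Longrightarrow> W \<subseteq> V (s W)"
    "\<And>W. W \<in> \<W> \<Longrightarrow> locally_constant_on Y W (b W)"
    "\<And>W W' x. W \<in> \<W> \<Longrightarrow> W' \<in> \<W> \<Longrightarrow> x \<in> W \<Longrightarrow> x \<in> W' \<Longrightarrow>
      g (r W) (r W') x - m (s W) (s W') x = b W x - b W' x"
    using cech_cohomologousE[OF CD[unfolded C D]] by blast
  have hY: "h x \<in> topspace Y" if "x \<in> topspace X" for x
    using h that by (auto simp: continuous_map_def)
  show ?thesis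
    unfolding C D cech_preimage_def prod.case
  proof (rule cech_cohomologousI[where K = \<W> and W = "\<lambda>W. {x \<in> topspace X. h x \<in> W}"
        and r = r and s = s and b = "\<lambda>W x. b W (h x)"])
    show "(\<Union>W\<in>\<W>. {x \<in> topspace X. h x \<in> W}) = topspace X" using W(2) hY by blast
  next
    fix W assume A: "W \<in> \<W>"
    show "openin X {x \<in> topspace X. h x \<in> W}" using h W(1)[OF A] by (rule openin_continuous_map_preimage)
    show "locally_constant_on X {x \<in> topspace X. h x \<in> W} (\<lambda>x. b W (h x))"
      by (rule locally_constant_on_preimage[OF W(7)[OF A] h]) auto
    show "{x \<in> topspace X. h x \<in> W} \<subseteq> {x \<in> topspace X. h x \<in> U (r W)}" using W(4)[OF A] by blast
    show "{x \<in> topspace X. h x \<in> W} \<subseteq> {x \<in> topspace X. h x \<in> V (s W)}" using W(6)[OF A] by blast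
  qed (use W(3,5,8) in auto)
qed

lemma cech_pullback_class:
  assumes h: "continuous_map X Y h" and C: "cech_cocycle Y C"
  shows "cech_pullback X Y h (cech_class Y C) = cech_class X (cech_preimage X h C)"
proof -
  have "cech_class X (cech_preimage X h D) = cech_class X (cech_preimage X h C)"
    if "D \<in> cech_class Y C" for D
  proof (intro cech_class_eq cech_cocycle_preimage[OF h] cech_cohomologous_preimage[OF h] C)
    show "cech_cocycle Y D" using that by (simp add: cech_class_def)
    have "cech_cohomologous Y C D" using that by (simp add: cech_class_def)
    then show "cech_cohomologous Y D C" by (rule cech_cohomologous_sym)
  qed
  moreover have "cech_pullback X Y h (cech_class Y C) =
      (\<Union>D\<in>cech_class Y C. cech_class X (cech_preimage X h D))"
    unfolding cech_pullback_def cech_preimage_def by (rule SUP_cong) (auto split: prod.split)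
  moreover obtain D where "D \<in> cech_class Y C" using cech_class_nonempty[OF C] by blast
  ultimately show ?thesis by auto
qed


section \<open>The Cech cocycle of a strong cocycle\<close>

context flc_space
begin

lemma strong_cocycleD:
  assumes "strong_cocycle \<Omega> \<alpha>"
  shows "T \<in> \<Omega> \<Longrightarrow> \<alpha> T (x + y) = \<alpha> T x + \<alpha> (shift x T) y"
    and "patch_stable (\<lambda>T. \<alpha> T v)"
  using assms unfolding strong_cocycle_def transversally_locally_constant_iff by simp_all

lemma cech_of_cocycle_eq:
  "cech_of_cocycle \<Omega> \<alpha> = (Collect (open_flow_box \<Omega>), \<lambda>k. flow_box (fst k) (snd k),
     \<lambda>i j T. flow_box_primitive \<alpha> i T - flow_box_primitive \<alpha> j T)"
  by (simp add: cech_of_cocycle_def case_prod_beta')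

lemma flow_boxes_cover: "(\<Union>k\<in>Collect (open_flow_box \<Omega>). flow_box (fst k) (snd k)) = \<Omega>"
proof -
  have "flow_box (fst k) (snd k) \<subseteq> \<Omega>" if "open_flow_box \<Omega> k" for k
    using flow_box_subset(2)[of "fst k" "snd k"] that by simp
  moreover have "\<exists>k. open_flow_box \<Omega> k \<and> T \<in> flow_box (fst k) (snd k)" if "T \<in> \<Omega>" for T
    using flow_box_exists[OF that] by (metis fst_conv snd_conv)
  ultimately show ?thesis by blast
qed

text \<open>
  On an overlap the transverse coordinates \<open>S - x = S' - x'\<close> differ by the locally constant vector
  \<open>x - x'\<close>, and the difference of the primitives is \<open>\<alpha>(S, x - x')\<close>.
\<close>

lemma cech_cocycle_of_cocycle:
  assumes \<alpha>: "strong_cocycle \<Omega> \<alpha>"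
  shows "cech_cocycle (space_topology \<Omega>) (cech_of_cocycle \<Omega> \<alpha>)"
  unfolding cech_of_cocycle_eq cech_cocycle_def prod.case
proof (intro conjI ballI)
  fix i assume "i \<in> Collect (open_flow_box \<Omega>)"
  then show "openin (space_topology \<Omega>) (flow_box (fst i) (snd i))"
    using flow_box_subset(3)[of "fst i" "snd i"] by simp
next
  show "(\<Union>k\<in>Collect (open_flow_box \<Omega>). flow_box (fst k) (snd k)) = topspace (space_topology \<Omega>)"
    using flow_boxes_cover by simp
next
  fix i j assume "i \<in> Collect (open_flow_box \<Omega>)" "j \<in> Collect (open_flow_box \<Omega>)"
  then obtain \<Xi> \<epsilon> \<Xi>' \<epsilon>' where i: "i = (\<Xi>, \<epsilon>)" "open_flow_box \<Omega> (\<Xi>, \<epsilon>)"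
    and j: "j = (\<Xi>', \<epsilon>')" "open_flow_box \<Omega> (\<Xi>', \<epsilon>')"
    by (metis mem_Collect_eq surj_pair)
  have sub: "flow_box (fst i) (snd i) \<inter> flow_box (fst j) (snd j) \<subseteq> \<Omega>"
    using flow_box_subset(2)[OF i(2)] by (auto simp: i(1))
  show "locally_constant_on (space_topology \<Omega>) (flow_box (fst i) (snd i) \<inter> flow_box (fst j) (snd j))
      (\<lambda>T. flow_box_primitive \<alpha> i T - flow_box_primitive \<alpha> j T)"
    unfolding locally_constant_on_iff_nbd[OF sub]
  proof
    fix T assume "T \<in> flow_box (fst i) (snd i) \<inter> flow_box (fst j) (snd j)"
    then have "T \<in> flow_box \<Xi> \<epsilon>" "T \<in> flow_box \<Xi>' \<epsilon>'" by (simp_all add: i(1) j(1))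
    then obtain S x S' x' where S: "S \<in> \<Xi>" "norm x < \<epsilon>" "T = shift x S"
      and S': "S' \<in> \<Xi>'" "norm x' < \<epsilon>'" "T = shift x' S'"
      by (metis flow_boxE)
    have diff: "flow_box_primitive \<alpha> i (shift y P) - flow_box_primitive \<alpha> j (shift y P) = \<alpha> P (y - y')"
      if "P \<in> \<Xi>" "norm y < \<epsilon>" "shift (y - y') P \<in> \<Xi>'" "norm y' < \<epsilon>'" for P y y'
    proof -
      have "P \<in> \<Omega>" using that(1) flow_box_subset(1)[OF i(2)] by blast
      then have "\<alpha> P y = \<alpha> P (y - y') + \<alpha> (shift (y - y') P) y'"
        using strong_cocycleD(1)[OF \<alpha>, of P "y - y'" y'] by simp
      moreover have "flow_box_primitive \<alpha> j (shift y' (shift (y - y') P)) = \<alpha> (shift (y - y') P) y'"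
        unfolding j(1) by (rule flow_box_primitive_shift[OF j(2) that(3,4)])
      ultimately show ?thesis
        using flow_box_primitive_shift[OF i(2) that(1,2), of \<alpha>] by (simp add: i(1))
    qed
    have S\<Omega>: "S \<in> \<Omega>" using S(1) flow_box_subset(1)[OF i(2)] by blast
    obtain r where r: "r > 0" "\<And>S1. S1 \<in> \<Omega> \<Longrightarrow> agree r S1 S \<Longrightarrow> \<alpha> S1 (x - x') = \<alpha> S (x - x')"
      using patch_stableE[OF strong_cocycleD(2)[OF \<alpha>] S\<Omega>] by blast
    obtain R e where R: "R > 0" "e > 0"
      "\<And>T' z. T' \<in> \<Omega> \<Longrightarrow> norm z < e \<Longrightarrow> agree R T' (shift z (shift x S)) \<Longrightarrow>
       shift (- x - z) T' \<in> \<Xi> \<and> agree r (shift (- x - z) T') S \<and> norm (x + z) < \<epsilon>"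
      using flow_box_coordinates[OF i(2) S(1,2)] by blast
    obtain R' e' where R': "R' > 0" "e' > 0"
      "\<And>T' z. T' \<in> \<Omega> \<Longrightarrow> norm z < e' \<Longrightarrow> agree R' T' (shift z (shift x' S')) \<Longrightarrow>
       shift (- x' - z) T' \<in> \<Xi>' \<and> agree r (shift (- x' - z) T') S' \<and> norm (x' + z) < \<epsilon>'"
      using flow_box_coordinates[OF j(2) S'(1,2)] by blast
    have val: "flow_box_primitive \<alpha> i T' - flow_box_primitive \<alpha> j T' = \<alpha> S (x - x')"
      if T': "T' \<in> nbd \<Omega> T (max R R') (min e e')" for T'
    proof -
      obtain z where z: "T' \<in> \<Omega>" "norm z < e" "norm z < e'" "agree (max R R') T' (shift z T)"
        using T' by (auto simp: nbd_def)
      have "agree R T' (shift z (shift x S))" "agree R' T' (shift z (shift x' S'))"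
        using z(4) agree_mono unfolding S(3)[symmetric] S'(3)[symmetric] by (meson max.cobounded1 max.cobounded2)+
      note k = R(3)[OF z(1,2) this(1)] and k' = R'(3)[OF z(1,3) this(2)]
      define S1 where "S1 = shift (- x - z) T'"
      have T': "T' = shift (x + z) S1" by (simp add: S1_def)
      have "shift ((x + z) - (x' + z)) S1 = shift (- x' - z) T'" by (simp add: S1_def)
      then have "flow_box_primitive \<alpha> i T' - flow_box_primitive \<alpha> j T' = \<alpha> S1 ((x + z) - (x' + z))"
        unfolding T' using k k' by (intro diff) (auto simp: S1_def)
      also have "\<dots> = \<alpha> S (x - x')" using r(2)[of S1] k z(1) by (simp add: S1_def)
      finally show ?thesis .
    qed
    have "T \<in> nbd \<Omega> T (max R R') (min e e')"
      using S\<Omega> R(2) R'(2) by (intro nbdI[of _ _ 0]) (auto simp: S(3))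
    then show "\<exists>R>0. \<exists>e>0. \<forall>T'\<in>nbd \<Omega> T R e \<inter> (flow_box (fst i) (snd i) \<inter> flow_box (fst j) (snd j)).
       flow_box_primitive \<alpha> i T' - flow_box_primitive \<alpha> j T' =
       flow_box_primitive \<alpha> i T - flow_box_primitive \<alpha> j T"
      using val R(1,2) R'(2) by (intro exI[of _ "max R R'"] conjI exI[of _ "min e e'"]) auto
  qed
qed simp

lemma strong_cohomologousD:
  assumes "(\<alpha>, \<beta>) \<in> strong_cohomologous \<Omega>"
  obtains s where "strong_cocycle \<Omega> \<alpha>" "strong_cocycle \<Omega> \<beta>" "patch_stable s"
    "\<And>T v. T \<in> \<Omega> \<Longrightarrow> \<beta> T v - \<alpha> T v = s (shift v T) - s T"
  using assms unfolding strong_cohomologous_def strong_coboundary_def transversally_locally_constant_iff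
  by blast

text \<open>
  The transverse coordinate \<open>S\<close> of \<open>S - x\<close> is locally constant up to agreement, so \<open>s(S)\<close> is locally
  constant on a flow box; its coboundary is the difference of the two Cech cocycles.
\<close>

lemma cech_cohomologous_of_strong_cohomologous:
  assumes "(\<alpha>, \<beta>) \<in> strong_cohomologous \<Omega>"
  shows "cech_cohomologous (space_topology \<Omega>) (cech_of_cocycle \<Omega> \<alpha>) (cech_of_cocycle \<Omega> \<beta>)"
proof -
  obtain s where \<alpha>: "strong_cocycle \<Omega> \<alpha>" "strong_cocycle \<Omega> \<beta>" and s: "patch_stable s"
    "\<And>T v. T \<in> \<Omega> \<Longrightarrow> \<beta> T v - \<alpha> T v = s (shift v T) - s T"
    using strong_cohomologousD[OF assms] by blast
  define b where "b i T = flow_box_primitive \<alpha> i T - flow_box_primitive \<beta> i T + s T" for i T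
  have b: "b (\<Xi>, \<epsilon>) (shift x S) = s S"
    if "open_flow_box \<Omega> (\<Xi>, \<epsilon>)" "S \<in> \<Xi>" "norm x < \<epsilon>" for \<Xi> \<epsilon> S x
  proof -
    have "S \<in> \<Omega>" using flow_box_subset(1)[OF that(1)] that(2) by blast
    then show ?thesis
      using s(2)[of S x] flow_box_primitive_shift[OF that] by (simp add: b_def algebra_simps)
  qed
  have lc: "locally_constant_on (space_topology \<Omega>) (flow_box (fst i) (snd i)) (b i)"
    if "open_flow_box \<Omega> i" for i
  proof -
    obtain \<Xi> \<epsilon> where i: "i = (\<Xi>, \<epsilon>)" by (cases i)
    note box = that[unfolded i]
    show ?thesis
      unfolding i fst_conv snd_conv locally_constant_on_iff_nbd[OF flow_box_subset(2)[OF box]]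
    proof
      fix T assume "T \<in> flow_box \<Xi> \<epsilon>"
      then obtain S x where S: "S \<in> \<Xi>" "norm x < \<epsilon>" "T = shift x S" by (rule flow_boxE)
      have "S \<in> \<Omega>" using flow_box_subset(1)[OF box] S(1) by blast
      then obtain r where r: "r > 0" "\<And>S1. S1 \<in> \<Omega> \<Longrightarrow> agree r S1 S \<Longrightarrow> s S1 = s S"
        using patch_stableE[OF s(1)] by blast
      obtain R e where R: "R > 0" "e > 0"
        "\<And>T' z. T' \<in> \<Omega> \<Longrightarrow> norm z < e \<Longrightarrow> agree R T' (shift z (shift x S)) \<Longrightarrow>
         shift (- x - z) T' \<in> \<Xi> \<and> agree r (shift (- x - z) T') S \<and> norm (x + z) < \<epsilon>"
        using flow_box_coordinates[OF box S(1,2)] by blast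
      have "b (\<Xi>, \<epsilon>) T' = b (\<Xi>, \<epsilon>) T" if T': "T' \<in> nbd \<Omega> T R e" for T'
      proof -
        obtain z where z: "T' \<in> \<Omega>" "norm z < e" "agree R T' (shift z (shift x S))"
          using T' unfolding S(3) nbd_def by blast
        note k = R(3)[OF z]
        have "b (\<Xi>, \<epsilon>) (shift (x + z) (shift (- x - z) T')) = s (shift (- x - z) T')"
          using k by (intro b[OF box]) auto
        also have "\<dots> = s S" using r(2) k z(1) by simp
        also have "\<dots> = b (\<Xi>, \<epsilon>) T" using b[OF box S(1,2)] by (simp add: S(3))
        finally show ?thesis by simp
      qed
      then show "\<exists>R>0. \<exists>e>0. \<forall>T'\<in>nbd \<Omega> T R e \<inter> flow_box \<Xi> \<epsilon>. b (\<Xi>, \<epsilon>) T' = b (\<Xi>, \<epsilon>) T"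
        using R(1,2) by blast
    qed
  qed
  show ?thesis
    unfolding cech_of_cocycle_eq
  proof (rule cech_cohomologousI[where K = "Collect (open_flow_box \<Omega>)" and r = id and s = id and b = b
        and W = "\<lambda>k. flow_box (fst k) (snd k)"])
    fix k assume "k \<in> Collect (open_flow_box \<Omega>)"
    then show "openin (space_topology \<Omega>) (flow_box (fst k) (snd k))"
      using flow_box_subset(3)[of "fst k" "snd k"] by simp
  qed (use lc flow_boxes_cover in \<open>auto simp: b_def algebra_simps\<close>)
qed

lemma strong_cohomologous_refl:
  assumes "strong_cocycle \<Omega> \<alpha>"
  shows "(\<alpha>, \<alpha>) \<in> strong_cohomologous \<Omega>"
proof -
  have "patch_stable (\<lambda>_. 0 :: real ^ 'd)"
    unfolding patch_stable_def using zero_less_one by blast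
  then have "strong_coboundary \<Omega> (\<lambda>T v. \<alpha> T v - \<alpha> T v)"
    unfolding strong_coboundary_def transversally_locally_constant_iff
    by (intro exI[of _ "\<lambda>_. 0"]) simp
  then show ?thesis using assms by (simp add: strong_cohomologous_def)
qed

lemma strong_to_cech_class:
  assumes "strong_cocycle \<Omega> \<alpha>"
  shows "strong_to_cech \<Omega> (strong_cohomologous \<Omega> `` {\<alpha>}) =
    cech_class (space_topology \<Omega>) (cech_of_cocycle \<Omega> \<alpha>)"
proof -
  have "cech_class (space_topology \<Omega>) (cech_of_cocycle \<Omega> \<beta>) =
      cech_class (space_topology \<Omega>) (cech_of_cocycle \<Omega> \<alpha>)"
    if "(\<alpha>, \<beta>) \<in> strong_cohomologous \<Omega>" for \<beta>
  proof (rule cech_class_eq)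
    show "cech_cohomologous (space_topology \<Omega>) (cech_of_cocycle \<Omega> \<beta>) (cech_of_cocycle \<Omega> \<alpha>)"
      using that by (intro cech_cohomologous_sym[OF cech_cohomologous_of_strong_cohomologous])
  qed (use that in \<open>auto simp: strong_cohomologous_def intro: cech_cocycle_of_cocycle\<close>)
  note eq = this
  show ?thesis
    unfolding strong_to_cech_def
  proof (rule SUP_eq_const)
    show "strong_cohomologous \<Omega> `` {\<alpha>} \<noteq> {}" using strong_cohomologous_refl[OF assms] by blast
    fix \<beta> assume "\<beta> \<in> strong_cohomologous \<Omega> `` {\<alpha>}"
    then have "(\<alpha>, \<beta>) \<in> strong_cohomologous \<Omega>" by simp
    then show "cech_class (space_topology \<Omega>) (cech_of_cocycle \<Omega> \<beta>) =
      cech_class (space_topology \<Omega>) (cech_of_cocycle \<Omega> \<alpha>)" by (rule eq)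
  qed
qed

end


section \<open>Local properties and partitions of unity\<close>

context flc_space
begin

definition near :: "('d, 'l) pattern \<Rightarrow> (('d, 'l) pattern \<Rightarrow> bool) \<Rightarrow> bool" where
  "near T P \<longleftrightarrow> (\<exists>R>0. \<exists>e>0. \<forall>S\<in>nbd \<Omega> T R e. P S)"

lemma near_mono: "near T P \<Longrightarrow> (\<And>S. S \<in> \<Omega> \<Longrightarrow> P S \<Longrightarrow> Q S) \<Longrightarrow> near T Q"
  unfolding near_def nbd_def by blast

lemma near_conj:
  assumes "near T P" "near T Q"
  shows "near T (\<lambda>S. P S \<and> Q S)"
proof -
  obtain R e where "R > 0" "e > 0" "\<And>S. S \<in> nbd \<Omega> T R e \<Longrightarrow> P S" using assms(1) unfolding near_def by blast
  moreover obtain R' e' where "R' > 0" "e' > 0" "\<And>S. S \<in> nbd \<Omega> T R' e' \<Longrightarrow> Q S"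
    using assms(2) unfolding near_def by blast
  moreover have "nbd \<Omega> T (max R R') (min e e') \<subseteq> nbd \<Omega> T R e \<inter> nbd \<Omega> T R' e'"
    by (intro Int_greatest nbd_mono) auto
  ultimately show ?thesis
    unfolding near_def by (intro exI[of _ "max R R'"] conjI exI[of _ "min e e'"]) auto
qed

lemma near_True: "near T (\<lambda>_. True)"
  unfolding near_def using zero_less_one by blast

lemma near_finite:
  assumes "finite F" "\<And>j. j \<in> F \<Longrightarrow> near T (P j)"
  shows "near T (\<lambda>S. \<forall>j\<in>F. P j S)"
  using assms
proof (induction F)
  case (insert j F)
  then have "near T (\<lambda>S. P j S \<and> (\<forall>j\<in>F. P j S))" by (intro near_conj) auto
  then show ?case by simp
qed (simp add: near_True)

lemma nbd_self: "T \<in> \<Omega> \<Longrightarrow> e > 0 \<Longrightarrow> T \<in> nbd \<Omega> T R e"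
  by (rule nbdI[of _ _ 0]) auto

lemma near_open: "openin (space_topology \<Omega>) U \<Longrightarrow> T \<in> U \<Longrightarrow> near T (\<lambda>S. S \<in> U)"
  unfolding openin_iff_nbd near_def by blast

lemma near_agree:
  assumes "near T P" "T \<in> \<Omega>"
  obtains R where "R > 0" "\<And>S. S \<in> \<Omega> \<Longrightarrow> agree R S T \<Longrightarrow> P S"
proof -
  obtain R e where "R > 0" "e > 0" "\<And>S. S \<in> nbd \<Omega> T R e \<Longrightarrow> P S" using assms(1) unfolding near_def by blast
  then show ?thesis using that[of R] nbdI[of _ \<Omega> 0 e R T] by simp
qed

lemma near_shift:
  assumes "near T P" "T \<in> \<Omega>"
  shows "\<exists>R>0. \<exists>e>0. \<forall>S\<in>nbd \<Omega> T R e. \<forall>z. norm z < e \<longrightarrow> P (shift z S)"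
proof -
  obtain R e where R: "R > 0" "e > 0" "\<And>S. S \<in> nbd \<Omega> T R e \<Longrightarrow> P S" using assms(1) unfolding near_def by blast
  have "P (shift z S)" if S: "S \<in> nbd \<Omega> T (R + e / 2) (e / 2)" and z: "norm z < e / 2" for S and z :: "real ^ 'd"
  proof -
    obtain x where x: "S \<in> \<Omega>" "norm x < e / 2" "agree (R + e / 2) S (shift x T)"
      using S by (auto simp: nbd_def)
    have "agree R (shift z S) (shift z (shift x T))" by (rule agree_shift[OF x(3)]) (use z in simp)
    moreover have "norm (z + x) < e" using z x(2) norm_triangle_ineq[of z x] by linarith
    ultimately have "shift z S \<in> nbd \<Omega> T R e" using x(1) by (intro nbdI[of _ _ "z + x"]) auto
    then show ?thesis by (rule R(3))
  qed
  then show ?thesis using R(1,2) by (intro exI[of _ "R + e / 2"] conjI exI[of _ "e / 2"]) auto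
qed

lemma near_iff_agree_shift:
  assumes "T \<in> \<Omega>"
  shows "near T P \<longleftrightarrow> (\<exists>R>0. \<exists>e>0. \<forall>S\<in>\<Omega>. \<forall>z. norm z < e \<longrightarrow> agree R S (shift z T) \<longrightarrow> P S)"
  unfolding near_def nbd_def by blast

lemma locally_constant_on_open_iff_near:
  assumes "openin (space_topology \<Omega>) A"
  shows "locally_constant_on (space_topology \<Omega>) A f \<longleftrightarrow> (\<forall>T\<in>A. near T (\<lambda>S. f S = f T))"
proof -
  have sub: "A \<subseteq> \<Omega>" using assms by (simp add: openin_iff_nbd)
  show ?thesis
    unfolding locally_constant_on_iff_nbd[OF sub]
  proof (intro ball_cong refl iffI)
    fix T assume T: "T \<in> A" and "\<exists>R>0. \<exists>e>0. \<forall>S\<in>nbd \<Omega> T R e \<inter> A. f S = f T"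
    then have "near T (\<lambda>S. S \<in> A \<longrightarrow> f S = f T)" unfolding near_def by blast
    from near_conj[OF this near_open[OF assms T]] show "near T (\<lambda>S. f S = f T)"
      by (rule near_mono) blast
  next
    fix T assume "T \<in> A" "near T (\<lambda>S. f S = f T)"
    then show "\<exists>R>0. \<exists>e>0. \<forall>S\<in>nbd \<Omega> T R e \<inter> A. f S = f T" unfolding near_def by blast
  qed
qed

end

text \<open>
  A bump function around \<open>T0\<close> that depends only on a patch: the height is \<open>e\<close> minus the length of the
  shortest translation that makes \<open>T\<close> agree with \<open>T0\<close>, or 0 if that is negative.
\<close>

definition bump :: "('d::finite, 'l) pattern \<Rightarrow> real \<Rightarrow> real \<Rightarrow> ('d, 'l) pattern \<Rightarrow> real" where
  "bump T0 R e T = (SUP x. if agree R (shift x T) T0 then max 0 (e - norm x) else 0)"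

lemma bump_bdd_above:
  "e > 0 \<Longrightarrow> bdd_above (range (\<lambda>x. if agree R (shift x T) T0 then max 0 (e - norm x) else 0))"
  by (rule bdd_aboveI[of _ e]) auto

lemma bump_ge:
  assumes "e > 0" "agree R (shift x T) T0"
  shows "e - norm x \<le> bump T0 R e T"
  using cSUP_upper[OF UNIV_I bump_bdd_above[OF assms(1), of R T T0], of x] assms(2)
  by (simp add: bump_def)

lemma bump_nonneg: "e > 0 \<Longrightarrow> 0 \<le> bump T0 R e T"
  using cSUP_upper[OF UNIV_I bump_bdd_above[of e R T T0], of "e *\<^sub>R axis undefined 1"]
  by (auto simp: bump_def split: if_splits)

lemma bump_pos_iff:
  assumes "e > 0"
  shows "bump T0 R e T > 0 \<longleftrightarrow> (\<exists>x. norm x < e \<and> agree R (shift x T) T0)"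
proof
  assume pos: "bump T0 R e T > 0"
  show "\<exists>x. norm x < e \<and> agree R (shift x T) T0"
  proof (rule ccontr)
    assume "\<not> ?thesis"
    then have "(if agree R (shift x T) T0 then max 0 (e - norm x) else 0) \<le> 0" for x
      by (auto simp: not_less)
    then have "bump T0 R e T \<le> 0" unfolding bump_def by (intro cSUP_least) auto
    then show False using pos by simp
  qed
next
  assume "\<exists>x. norm x < e \<and> agree R (shift x T) T0"
  then show "bump T0 R e T > 0" using bump_ge[OF assms] by force
qed

lemma bump_agree:
  assumes "agree (R + e) S T"
  shows "bump T0 R e S = bump T0 R e T"
proof -
  have "(if agree R (shift x S) T0 then max 0 (e - norm x) else 0) =
      (if agree R (shift x T) T0 then max 0 (e - norm x) else 0)" for x
  proof (cases "norm x < e")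
    case True
    then have "agree R (shift x S) (shift x T)" by (intro agree_shift[OF assms]) auto
    then show ?thesis by (auto simp: agree_def)
  qed auto
  then show ?thesis by (simp add: bump_def)
qed

lemma bump_shift_le:
  assumes "e > 0"
  shows "bump T0 R e (shift z T) \<le> bump T0 R e T + norm z"
  unfolding bump_def[of _ _ _ "shift z T"]
proof (rule cSUP_least)
  fix x
  show "(if agree R (shift x (shift z T)) T0 then max 0 (e - norm x) else 0) \<le> bump T0 R e T + norm z"
  proof (cases "agree R (shift x (shift z T)) T0")
    case True
    then have "e - norm (x + z) \<le> bump T0 R e T" using bump_ge[OF assms, of R "x + z"] by simp
    moreover have "norm (x + z) \<le> norm x + norm z" by (rule norm_triangle_ineq)
    ultimately show ?thesis using bump_nonneg[OF assms, of T0 R T] True by simp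
  next
    case False
    then show ?thesis using bump_nonneg[OF assms, of T0 R T] by simp
  qed
qed simp

lemma bump_shift_tendsto:
  assumes "e > 0"
  shows "((\<lambda>z. bump T0 R e (shift z T)) \<longlongrightarrow> bump T0 R e T) (at 0)"
proof (rule Lim_transform_bound[where g = "\<lambda>z. z" and f = "\<lambda>z. bump T0 R e (shift z T) - bump T0 R e T", THEN LIM_zero_cancel])
  show "\<forall>\<^sub>F z in at 0. norm (bump T0 R e (shift z T) - bump T0 R e T) \<le> norm z"
  proof (rule always_eventually, rule allI)
    fix z
    have "bump T0 R e T \<le> bump T0 R e (shift z T) + norm z"
      using bump_shift_le[OF assms, of T0 R "- z" "shift z T"] by simp
    then show "norm (bump T0 R e (shift z T) - bump T0 R e T) \<le> norm z"
      using bump_shift_le[OF assms, of T0 R z T] by (simp add: abs_le_iff)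
  qed
qed (rule tendsto_ident_at)

context flc_space
begin

text \<open>
  The weights are normalised bump functions around finitely many elements of \<open>\<Omega>\<close>, so they depend only
  on a patch of fixed size. The bump around \<open>j\<close> has half the width that would fit into \<open>U j\<close>, hence
  vanishes near every element outside \<open>U j\<close>.
\<close>

lemma partition_of_unity:
  assumes U: "\<And>T. T \<in> \<Omega> \<Longrightarrow> openin (space_topology \<Omega>) (U T)" "\<And>T. T \<in> \<Omega> \<Longrightarrow> T \<in> U T"
  obtains F w R where "finite F" "F \<subseteq> \<Omega>" "R > 0"
    "\<And>T. T \<in> \<Omega> \<Longrightarrow> (\<Sum>j\<in>F. w j T) = (1 :: real)"
    "\<And>j S T. j \<in> F \<Longrightarrow> agree R S T \<Longrightarrow> w j S = w j T"
    "\<And>j T. j \<in> F \<Longrightarrow> T \<in> \<Omega> \<Longrightarrow> ((\<lambda>z. w j (shift z T)) \<longlongrightarrow> w j T) (at 0)"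
    "\<And>j T. j \<in> F \<Longrightarrow> T \<in> \<Omega> \<Longrightarrow> T \<notin> U j \<Longrightarrow> near T (\<lambda>S. w j S = 0)"
proof -
  have "\<forall>T\<in>\<Omega>. \<exists>R>0. \<exists>e>0. nbd \<Omega> T R e \<subseteq> U T" using U unfolding openin_iff_nbd by blast
  then obtain r e where re: "\<And>T. T \<in> \<Omega> \<Longrightarrow> r T > 0" "\<And>T. T \<in> \<Omega> \<Longrightarrow> e T > 0"
    "\<And>T. T \<in> \<Omega> \<Longrightarrow> nbd \<Omega> T (r T) (e T) \<subseteq> U T" by metis
  define f where "f j = bump j (r j + e j) (e j / 2)" for j
  have e2: "j \<in> \<Omega> \<Longrightarrow> e j / 2 > 0" for j using re(2) by simp
  have pos: "f j T > 0" if j: "j \<in> \<Omega>" and T: "T \<in> nbd \<Omega> j (r j + 2 * e j) (e j / 2)" for j T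
  proof -
    obtain x where x: "T \<in> \<Omega>" "norm x < e j / 2" "agree (r j + 2 * e j) T (shift x j)"
      using T by (auto simp: nbd_def)
    have "agree (r j + e j) (shift (- x) T) j"
      by (rule agree_shiftD[OF x(3)]) (use x(2) re(2)[OF j] in simp)
    then show ?thesis unfolding f_def bump_pos_iff[OF e2[OF j]] using x(2) by (metis norm_minus_cancel)
  qed
  have "r j + 2 * e j > 0" if "j \<in> \<Omega>" for j using re(1,2)[OF that] by simp
  then obtain F where F: "finite F" "F \<subseteq> \<Omega>" "\<Omega> \<subseteq> (\<Union>j\<in>F. nbd \<Omega> j (r j + 2 * e j) (e j / 2))"
    using finite_nbd_cover[of "\<lambda>j. r j + 2 * e j" "\<lambda>j. e j / 2"] e2 by blast
  define g where "g T = (\<Sum>j\<in>F. f j T)" for T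
  have gpos: "g T > 0" if T: "T \<in> \<Omega>" for T
    unfolding g_def
  proof -
    obtain j where "j \<in> F" "T \<in> nbd \<Omega> j (r j + 2 * e j) (e j / 2)" using F(3) T by blast
    then have "j \<in> F" "f j T > 0" using pos F(2) by auto
    then show "(\<Sum>j\<in>F. f j T) > 0"
      using F(1,2) by (intro sum_pos2[of F j]) (auto simp: f_def intro!: bump_nonneg[OF e2])
  qed
  define R where "R = 1 + (\<Sum>j\<in>F. r j + 2 * e j)"
  have nn: "r j + 2 * e j \<ge> 0" if "j \<in> F" for j
  proof -
    have "j \<in> \<Omega>" using that F(2) by blast
    then show ?thesis using re(1,2)[of j] by simp
  qed
  have Rj: "r j + e j + e j / 2 \<le> R" if "j \<in> F" for j
  proof -
    have "r j + 2 * e j \<le> (\<Sum>j\<in>F. r j + 2 * e j)"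
      using nn by (intro member_le_sum[OF that _ F(1)]) auto
    moreover have "e j \<ge> 0" using that F(2) re(2)[of j] by (auto simp: less_imp_le)
    ultimately show ?thesis by (simp add: R_def)
  qed
  have fag: "f j S = f j T" if "j \<in> F" "agree R S T" for j S T
    unfolding f_def by (rule bump_agree[OF agree_mono[OF that(2) Rj[OF that(1)]]])
  show ?thesis
  proof (rule that[of F R "\<lambda>j T. f j T / g T"])
    show "R > 0" using sum_nonneg[of F "\<lambda>j. r j + 2 * e j", OF nn] by (simp add: R_def)
    show "(\<Sum>j\<in>F. f j T / g T) = 1" if "T \<in> \<Omega>" for T
      using gpos[OF that] by (simp add: sum_divide_distrib[symmetric] g_def)
    show "f j S / g S = f j T / g T" if "j \<in> F" "agree R S T" for j S T
      using fag that by (simp add: g_def)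
    show "((\<lambda>z. f j (shift z T) / g (shift z T)) \<longlongrightarrow> f j T / g T) (at 0)" if "j \<in> F" "T \<in> \<Omega>" for j T
    proof -
      have lim: "((\<lambda>z. f i (shift z T)) \<longlongrightarrow> f i T) (at 0)" if "i \<in> F" for i
        unfolding f_def using that F(2) e2 by (intro bump_shift_tendsto) auto
      then have "((\<lambda>z. g (shift z T)) \<longlongrightarrow> g T) (at 0)" unfolding g_def by (intro tendsto_sum)
      then show ?thesis using lim[OF \<open>j \<in> F\<close>] gpos[OF \<open>T \<in> \<Omega>\<close>] by (intro tendsto_divide) auto
    qed
    show "near T (\<lambda>S. f j S / g S = 0)" if j: "j \<in> F" and T: "T \<in> \<Omega>" "T \<notin> U j" for j T
      unfolding near_iff_agree_shift[OF T(1)]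
    proof (intro exI conjI ballI allI impI)
      have j\<Omega>: "j \<in> \<Omega>" using j F(2) by blast
      show "R > 0" by fact
      show "e j / 2 > 0" by (rule e2[OF j\<Omega>])
      fix S z assume S: "S \<in> \<Omega>" "norm z < e j / 2" "agree R S (shift z T)"
      have "f j S = 0"
      proof (rule ccontr)
        assume "f j S \<noteq> 0"
        then have "f j S > 0" using bump_nonneg[OF e2[OF j\<Omega>]] by (simp add: f_def order_less_le)
        then have "f j (shift z T) > 0" using fag[OF j S(3)] by simp
        then obtain x where x: "norm x < e j / 2" "agree (r j + e j) (shift x (shift z T)) j"
          unfolding f_def bump_pos_iff[OF e2[OF j\<Omega>]] by blast
        have xz: "norm (x + z) < e j" using x(1) S(2) norm_triangle_ineq[of x z] by linarith
        have "agree (r j) (shift (- (x + z)) (shift x (shift z T))) (shift (- (x + z)) j)"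
          by (rule agree_shift[OF x(2)]) (unfold norm_minus_cancel, use xz in linarith)
        then have "agree (r j) T (shift (- (x + z)) j)" by simp
        then have "T \<in> nbd \<Omega> j (r j) (e j)" using T(1) xz by (intro nbdI[of _ _ "- (x + z)"]) (simp_all only: norm_minus_cancel)
        then show False using re(3)[OF j\<Omega>] T(2) by blast
      qed
      then show "f j S / g S = 0" by simp
    qed
  qed (use F in auto)
qed

section \<open>Cocycles that are local near zero\<close>

text \<open>
  If a patch of \<open>T\<close> determines \<open>\<alpha>(T, z)\<close> for all small \<open>z\<close> at once, the cocycle identity extends this
  along the connected space of all \<open>z\<close>. The uniformity in \<open>z\<close> is more than transversal local constancy
  of each \<open>\<alpha>(\<cdot>, z)\<close>.
\<close>

lemma local_cocycle_extend:
  fixes \<alpha> :: "('d, 'l) cochain"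
  assumes add: "\<And>T x y. T \<in> \<Omega> \<Longrightarrow> \<alpha> T (x + y) = \<alpha> T x + \<alpha> (shift x T) y"
    and loc: "\<And>T. T \<in> \<Omega> \<Longrightarrow> \<exists>R>0. \<exists>e>0. \<forall>S\<in>\<Omega>. \<forall>z. agree R S T \<longrightarrow> norm z < e \<longrightarrow> \<alpha> S z = \<alpha> T z"
    and T: "T \<in> \<Omega>"
  obtains R e where "R > 0" "e > 0"
    "\<And>S z. S \<in> \<Omega> \<Longrightarrow> agree R S T \<Longrightarrow> norm z < e \<Longrightarrow> \<alpha> S (v + z) = \<alpha> T (v + z)"
proof -
  have zero: "\<alpha> S 0 = 0" if "S \<in> \<Omega>" for S using add[OF that, of 0 0] by simp
  define P where "P v \<longleftrightarrow> (\<exists>R>0. \<forall>S\<in>\<Omega>. agree R S T \<longrightarrow> \<alpha> S v = \<alpha> T v)" for v :: "real ^ 'd"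
  have step: "\<exists>R>0. \<exists>e>0. \<forall>S\<in>\<Omega>. \<forall>z. agree R S T \<longrightarrow> norm z < e \<longrightarrow> \<alpha> (shift v S) z = \<alpha> (shift v T) z" for v
  proof -
    obtain R e where R: "R > 0" "e > 0"
      "\<And>S z. S \<in> \<Omega> \<Longrightarrow> agree R S (shift v T) \<Longrightarrow> norm z < e \<Longrightarrow> \<alpha> S z = \<alpha> (shift v T) z"
      using loc[OF shift_in[OF T, of v]] by blast
    have "\<alpha> (shift v S) z = \<alpha> (shift v T) z" if "S \<in> \<Omega>" "agree (norm v + R) S T" "norm z < e" for S z
      by (rule R(3)) (use that in \<open>auto intro: agree_shift\<close>)
    then show ?thesis using R(1,2) by (intro exI[of _ "norm v + R"] conjI exI[of _ e]) (auto simp: add_nonneg_pos)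
  qed
  have Pmono: "P v'" if Pv: "P v" and eq: "\<And>S. S \<in> \<Omega> \<Longrightarrow> agree R S T \<Longrightarrow> \<alpha> S v' - \<alpha> S v = \<alpha> T v' - \<alpha> T v"
    and "R > 0" for v v' :: "real ^ 'd" and R :: real
  proof -
    obtain R' where R': "R' > 0" "\<And>S. S \<in> \<Omega> \<Longrightarrow> agree R' S T \<Longrightarrow> \<alpha> S v = \<alpha> T v"
      using Pv unfolding P_def by blast
    have "\<alpha> S v' = \<alpha> T v'" if S: "S \<in> \<Omega>" "agree (max R R') S T" for S
    proof -
      have "agree R S T" "agree R' S T" using S(2) agree_mono by (meson max.cobounded1 max.cobounded2)+
      then show ?thesis using eq[OF S(1)] R'(2)[OF S(1)] by simp
    qed
    then show ?thesis unfolding P_def using \<open>R > 0\<close> by (intro exI[of _ "max R R'"]) auto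
  qed
  have "P v = P 0" for v
  proof (rule connected_local_const[where A = UNIV and f = P])
    show "\<forall>v\<in>UNIV. \<forall>\<^sub>F v' in at v within UNIV. P v = P v'"
    proof
      fix v
      obtain R e where R: "R > 0" "e > 0"
        "\<And>S z. S \<in> \<Omega> \<Longrightarrow> agree R S T \<Longrightarrow> norm z < e \<Longrightarrow> \<alpha> (shift v S) z = \<alpha> (shift v T) z"
        using step[of v] by blast
      have "P v = P v'" if "dist v' v < e" for v'
      proof -
        have *: "\<alpha> S v' - \<alpha> S v = \<alpha> T v' - \<alpha> T v" if "S \<in> \<Omega>" "agree R S T" for S
          using add[OF that(1), of v "v' - v"] add[OF T, of v "v' - v"] R(3)[OF that(1,2), of "v' - v"] \<open>dist v' v < e\<close>
          by (simp add: dist_norm)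
        have "\<alpha> S v - \<alpha> S v' = \<alpha> T v - \<alpha> T v'" if "S \<in> \<Omega>" "agree R S T" for S
          using *[OF that] by (simp add: algebra_simps)
        then show ?thesis using Pmono[of v R v'] Pmono[of v' R v] * R(1) by blast
      qed
      then show "\<forall>\<^sub>F v' in at v within UNIV. P v = P v'"
        using R(2) by (auto simp: eventually_at)
    qed
  qed (auto simp: convex_connected)
  moreover have "P 0" unfolding P_def using zero T by (intro exI[of _ 1]) auto
  ultimately have "P v" by simp
  then obtain R1 where R1: "R1 > 0" "\<And>S. S \<in> \<Omega> \<Longrightarrow> agree R1 S T \<Longrightarrow> \<alpha> S v = \<alpha> T v"
    unfolding P_def by blast
  obtain R e where R: "R > 0" "e > 0"
    "\<And>S z. S \<in> \<Omega> \<Longrightarrow> agree R S T \<Longrightarrow> norm z < e \<Longrightarrow> \<alpha> (shift v S) z = \<alpha> (shift v T) z"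
    using step[of v] by blast
  have "\<alpha> S (v + z) = \<alpha> T (v + z)" if S: "S \<in> \<Omega>" "agree (max R R1) S T" "norm z < e" for S z
  proof -
    have "agree R S T" "agree R1 S T" using S(2) agree_mono by (meson max.cobounded1 max.cobounded2)+
    then show ?thesis using add[OF S(1)] add[OF T] R(3)[OF S(1) _ S(3)] R1(2)[OF S(1)] by simp
  qed
  then show ?thesis using R(1,2) by (intro that[of "max R R1" e]) auto
qed

text \<open>
  Joint continuity comes from continuity along orbits alone: an element near \<open>T\<close> is \<open>S - x\<close> with \<open>S\<close>
  agreeing with \<open>T\<close> and \<open>x\<close> small, and \<open>\<alpha>(S - x, u) = \<alpha>(S, x + u) - \<alpha>(S, x)\<close>, where \<open>S\<close> can be replaced by \<open>T\<close>.
\<close>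

lemma strong_cocycle_if_local:
  fixes \<alpha> :: "('d, 'l) cochain"
  assumes add: "\<And>T x y. T \<in> \<Omega> \<Longrightarrow> \<alpha> T (x + y) = \<alpha> T x + \<alpha> (shift x T) y"
    and loc: "\<And>T. T \<in> \<Omega> \<Longrightarrow> \<exists>R>0. \<exists>e>0. \<forall>S\<in>\<Omega>. \<forall>z. agree R S T \<longrightarrow> norm z < e \<longrightarrow> \<alpha> S z = \<alpha> T z"
    and cont: "\<And>T. T \<in> \<Omega> \<Longrightarrow> (\<alpha> T \<longlongrightarrow> 0) (at 0)"
  shows "strong_cocycle \<Omega> \<alpha>"
  unfolding strong_cocycle_def transversally_locally_constant_iff
proof (intro conjI allI ballI)
  show "\<alpha> T x + \<alpha> (shift x T) y = \<alpha> T (x + y)" if "T \<in> \<Omega>" for T x y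
    using add[OF that] by simp
  show "patch_stable (\<lambda>T. \<alpha> T v)" for v
    unfolding patch_stable_def
  proof
    fix T assume T: "T \<in> \<Omega>"
    obtain R e where "R > 0" "e > 0" "\<And>S z. S \<in> \<Omega> \<Longrightarrow> agree R S T \<Longrightarrow> norm z < e \<Longrightarrow> \<alpha> S (v + z) = \<alpha> T (v + z)"
      using local_cocycle_extend[OF add loc T] by blast
    note R = this(1,2) and eq = this(3)[of _ 0]
    show "\<exists>R>0. \<forall>S\<in>\<Omega>. agree R S T \<longrightarrow> \<alpha> S v = \<alpha> T v"
      using R eq by (intro exI[of _ R]) simp
  qed
  have zero: "\<alpha> S 0 = 0" if "S \<in> \<Omega>" for S using add[OF that, of 0 0] by simp
  have cont0: "\<exists>d>0. \<forall>z. norm z < d \<longrightarrow> norm (\<alpha> T z) < \<eta>" if T: "T \<in> \<Omega>" and "\<eta> > 0" for T \<eta>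
  proof -
    obtain d where "d > 0" "\<forall>z. z \<noteq> 0 \<and> dist z 0 < d \<longrightarrow> dist (\<alpha> T z) 0 < \<eta>"
      using tendstoD[OF cont[OF T] \<open>\<eta> > 0\<close>] by (auto simp: eventually_at)
    then have "norm (\<alpha> T z) < \<eta>" if "norm z < d" for z
      using that zero[OF T] \<open>\<eta> > 0\<close> by (cases "z = 0") auto
    then show ?thesis using \<open>d > 0\<close> by blast
  qed
  show "continuous_map (prod_topology (space_topology \<Omega>) euclidean) euclidean (\<lambda>(T, x). \<alpha> T x)"
    unfolding continuous_map_def
  proof (intro conjI allI impI)
    fix U :: "(real ^ 'd) set" assume "openin euclidean U"
    then have "open U" by simp
    show "openin (prod_topology (space_topology \<Omega>) euclidean)
      {p \<in> topspace (prod_topology (space_topology \<Omega>) euclidean). (case p of (T, x) \<Rightarrow> \<alpha> T x) \<in> U}"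
      unfolding openin_prod_topology_alt
    proof (intro allI impI)
      fix T v
      assume "(T, v) \<in> {p \<in> topspace (prod_topology (space_topology \<Omega>) euclidean). (case p of (T, x) \<Rightarrow> \<alpha> T x) \<in> U}"
      then have T: "T \<in> \<Omega>" and "\<alpha> T v \<in> U" by auto
      then obtain \<eta> where \<eta>: "\<eta> > 0" "\<And>y. dist y (\<alpha> T v) < \<eta> \<Longrightarrow> y \<in> U"
        using \<open>open U\<close> unfolding open_dist by blast
      obtain R e where R: "R > 0" "e > 0"
        "\<And>S z. S \<in> \<Omega> \<Longrightarrow> agree R S T \<Longrightarrow> norm z < e \<Longrightarrow> \<alpha> S (v + z) = \<alpha> T (v + z)"
        using local_cocycle_extend[OF add loc T] by blast
      obtain R' e' where R': "R' > 0" "e' > 0"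
        "\<And>S z. S \<in> \<Omega> \<Longrightarrow> agree R' S T \<Longrightarrow> norm z < e' \<Longrightarrow> \<alpha> S z = \<alpha> T z"
        using loc[OF T] by blast
      obtain d where d: "d > 0" "\<And>z. norm z < d \<Longrightarrow> norm (\<alpha> T z) < \<eta> / 2"
        using cont0[OF T, of "\<eta> / 2"] \<eta>(1) by auto
      obtain d' where d': "d' > 0" "\<And>z. norm z < d' \<Longrightarrow> norm (\<alpha> (shift v T) z) < \<eta> / 2"
        using cont0[OF shift_in[OF T, of v], of "\<eta> / 2"] \<eta>(1) by auto
      define \<delta> where "\<delta> = min (min (e / 2) e') (min d (d' / 2))"
      have \<delta>: "\<delta> > 0" "2 * \<delta> \<le> e" "\<delta> \<le> e'" "\<delta> \<le> d" "2 * \<delta> \<le> d'" using R(2) R'(2) d(1) d'(1) by (auto simp: \<delta>_def)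
      have "max R R' + \<delta> > 0" using R(1) \<delta>(1) by (simp add: add_pos_pos less_max_iff_disj)
      then obtain N where N: "openin (space_topology \<Omega>) N" "T \<in> N" "N \<subseteq> nbd \<Omega> T (max R R' + \<delta>) \<delta>"
        using open_nhd_in_nbd[OF T _ \<delta>(1)] by blast
      have "(S, u) \<in> {p \<in> topspace (prod_topology (space_topology \<Omega>) euclidean). (case p of (T, x) \<Rightarrow> \<alpha> T x) \<in> U}"
        if S: "S \<in> N" and u: "u \<in> ball v \<delta>" for S u
      proof -
        obtain x where x: "S \<in> \<Omega>" "norm x < \<delta>" "agree (max R R' + \<delta>) S (shift x T)"
          using S N(3) by (auto simp: nbd_def)
        define S0 where "S0 = shift (- x) S"
        have S0: "S0 \<in> \<Omega>" "S = shift x S0" using x(1) by (simp_all add: S0_def)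
        have "agree (max R R') S0 T"
          unfolding S0_def by (rule agree_shiftD[OF x(3)]) (use x(2) in simp)
        then have ag: "agree R S0 T" "agree R' S0 T" using agree_mono by (meson max.cobounded1 max.cobounded2)+
        define z where "z = x + u - v"
        have z: "norm z < 2 * \<delta>"
          using x(2) u norm_triangle_ineq[of x "u - v"]
          by (simp add: z_def dist_norm norm_minus_commute algebra_simps)
        have "\<alpha> S u = \<alpha> S0 (v + z) - \<alpha> S0 x"
          using add[OF S0(1), of x u] by (simp add: S0(2) z_def)
        also have "\<dots> = \<alpha> T (v + z) - \<alpha> T x"
          using R(3)[OF S0(1) ag(1)] R'(3)[OF S0(1) ag(2)] z x(2) \<delta> by simp
        also have "\<dots> = \<alpha> T v + \<alpha> (shift v T) z - \<alpha> T x" using add[OF T] by simp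
        finally have "dist (\<alpha> S u) (\<alpha> T v) \<le> norm (\<alpha> (shift v T) z) + norm (\<alpha> T x)"
          using norm_triangle_ineq4[of "\<alpha> (shift v T) z" "\<alpha> T x"] by (simp add: dist_norm)
        also have "\<dots> < \<eta>" using d(2)[of x] d'(2)[of z] x(2) z \<delta> by simp
        finally show ?thesis using \<eta>(2) x(1) by simp
      qed
      then have "N \<times> ball v \<delta> \<subseteq>
          {p \<in> topspace (prod_topology (space_topology \<Omega>) euclidean). (case p of (T, x) \<Rightarrow> \<alpha> T x) \<in> U}"
        by blast
      then show "\<exists>N B. openin (space_topology \<Omega>) N \<and> openin euclidean B \<and> T \<in> N \<and> v \<in> B \<and>
          N \<times> B \<subseteq> {p \<in> topspace (prod_topology (space_topology \<Omega>) euclidean). (case p of (T, x) \<Rightarrow> \<alpha> T x) \<in> U}"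
        using N(1,2) \<delta>(1) by (intro exI[of _ N] exI[of _ "ball v \<delta>"]) simp
    qed
  qed simp
qed

text \<open>The coordinate \<open>x\<close> of \<open>S - x\<close>, as the primitive of the cocycle \<open>\<F>(T, v) = v\<close>.\<close>

definition box_coord :: "('d, 'l) pattern set \<times> real \<Rightarrow> ('d, 'l) pattern \<Rightarrow> real ^ 'd" where
  "box_coord = flow_box_primitive (\<lambda>T v. v)"

lemma box_coord_shift:
  "open_flow_box \<Omega> (\<Xi>, \<epsilon>) \<Longrightarrow> S \<in> \<Xi> \<Longrightarrow> norm x < \<epsilon> \<Longrightarrow> box_coord (\<Xi>, \<epsilon>) (shift x S) = x"
  unfolding box_coord_def by (rule flow_box_primitive_shift)

lemma box_coord:
  assumes "open_flow_box \<Omega> (\<Xi>, \<epsilon>)" "T \<in> flow_box \<Xi> \<epsilon>"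
  shows "norm (box_coord (\<Xi>, \<epsilon>) T) < \<epsilon>" "shift (- box_coord (\<Xi>, \<epsilon>) T) T \<in> \<Xi>"
proof -
  obtain S x where "S \<in> \<Xi>" "norm x < \<epsilon>" "T = shift x S" using assms(2) by (rule flow_boxE)
  then show "norm (box_coord (\<Xi>, \<epsilon>) T) < \<epsilon>" "shift (- box_coord (\<Xi>, \<epsilon>) T) T \<in> \<Xi>"
    using box_coord_shift[OF assms(1), of S x] by simp_all
qed

lemma box_transversal_near:
  assumes box: "open_flow_box \<Omega> (\<Xi>, \<epsilon>)" and T: "T \<in> flow_box \<Xi> \<epsilon>"
  shows "near T (\<lambda>S. S \<in> flow_box \<Xi> \<epsilon> \<and>
    agree r (shift (- box_coord (\<Xi>, \<epsilon>) S) S) (shift (- box_coord (\<Xi>, \<epsilon>) T) T))"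
proof -
  define x where "x = box_coord (\<Xi>, \<epsilon>) T"
  define P where "P = shift (- x) T"
  have P: "P \<in> \<Xi>" "norm x < \<epsilon>" and TP: "T = shift x P"
    using box_coord[OF box T] by (simp_all add: x_def P_def)
  have T\<Omega>: "T \<in> \<Omega>" using T flow_box_subset(2)[OF box] by blast
  obtain R e where R: "R > 0" "e > 0"
    "\<And>T' z. T' \<in> \<Omega> \<Longrightarrow> norm z < e \<Longrightarrow> agree R T' (shift z (shift x P)) \<Longrightarrow>
       shift (- x - z) T' \<in> \<Xi> \<and> agree r (shift (- x - z) T') P \<and> norm (x + z) < \<epsilon>"
    using flow_box_coordinates[OF box P] by blast
  have "S \<in> flow_box \<Xi> \<epsilon> \<and> agree r (shift (- box_coord (\<Xi>, \<epsilon>) S) S) P"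
    if S: "S \<in> \<Omega>" "norm z < e" "agree R S (shift z T)" for S z
  proof -
    have k: "shift (- x - z) S \<in> \<Xi>" "agree r (shift (- x - z) S) P" "norm (x + z) < \<epsilon>"
      using R(3)[OF S(1,2)] S(3) unfolding TP by auto
    have "S \<in> flow_box \<Xi> \<epsilon>" unfolding flow_box_def
      using k by (intro image_eqI[where x = "(shift (- x - z) S, x + z)"]) auto
    moreover have "box_coord (\<Xi>, \<epsilon>) (shift (x + z) (shift (- x - z) S)) = x + z"
      by (rule box_coord_shift[OF box k(1,3)])
    then have "box_coord (\<Xi>, \<epsilon>) S = x + z" by simp
    then have "shift (- box_coord (\<Xi>, \<epsilon>) S) S = shift (- x - z) S" by simp
    ultimately show ?thesis using k(2) by simp
  qed
  then show ?thesis
    unfolding near_iff_agree_shift[OF T\<Omega>] x_def[symmetric] P_def[symmetric] using R(1,2) by blast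
qed

end


section \<open>The orbit cocycle of a continuous map\<close>

locale flc_map = dom: flc_space \<Omega> + cod: flc_space \<Omega>'
  for \<Omega> :: "('d::finite, 'l::metric_space) pattern set"
    and \<Omega>' :: "('d, 'm::metric_space) pattern set" +
  fixes h :: "('d, 'l) pattern \<Rightarrow> ('d, 'm) pattern"
  assumes h: "continuous_map (space_topology \<Omega>) (space_topology \<Omega>') h"
    and aperiodic: "aperiodic_space \<Omega>'"
begin

lemma h_in: "T \<in> \<Omega> \<Longrightarrow> h T \<in> \<Omega>'"
  using h by (auto simp: continuous_map_def)

lemma open_preimage: "openin (space_topology \<Omega>') U \<Longrightarrow> openin (space_topology \<Omega>) {T \<in> \<Omega>. h T \<in> U}"
  using openin_continuous_map_preimage[OF h] by simp

lemma near_preimage: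
  assumes "cod.near (h T) P" "T \<in> \<Omega>"
  shows "dom.near T (\<lambda>S. P (h S))"
proof -
  obtain R e where "R > 0" "e > 0" "\<And>S. S \<in> nbd \<Omega>' (h T) R e \<Longrightarrow> P S"
    using assms(1) unfolding cod.near_def by blast
  note Re = this
  obtain U where U: "openin (space_topology \<Omega>') U" "h T \<in> U" "U \<subseteq> nbd \<Omega>' (h T) R e"
    using cod.open_nhd_in_nbd[OF h_in[OF assms(2)] Re(1,2)] by blast
  have "dom.near T (\<lambda>S. S \<in> {T \<in> \<Omega>. h T \<in> U})"
    by (rule dom.near_open[OF open_preimage[OF U(1)]]) (use U(2) assms(2) in simp)
  then show ?thesis by (rule dom.near_mono) (use U(3) Re(3) in blast)
qed

text \<open>
  As long as a connected piece of an orbit is mapped into a flow box, the transverse coordinate of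
  the image does not change: each of its patches is a locally constant function.
\<close>

lemma map_within_box:
  assumes box: "open_flow_box \<Omega>' (\<Xi>, \<epsilon>)" and T: "T \<in> \<Omega>"
    and inbox: "\<And>z. norm z < e \<Longrightarrow> h (shift z T) \<in> flow_box \<Xi> \<epsilon>" and z: "norm z < e"
  shows "h (shift z T) = shift (cod.box_coord (\<Xi>, \<epsilon>) (h (shift z T)) - cod.box_coord (\<Xi>, \<epsilon>) (h T)) (h T)"
proof -
  let ?q = "cod.box_coord (\<Xi>, \<epsilon>)"
  define S where "S z = shift (- ?q (h (shift z T))) (h (shift z T))" for z
  have e: "e > 0" using z norm_ge_zero[of z] by linarith
  have S_in: "S w \<in> \<Omega>'" for w using T h_in by (simp add: S_def)
  have "agree r (S z) (S 0)" for r
  proof -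
    have "patch (S z) 0 r = patch (S 0) 0 r"
    proof (rule connected_local_const[where A = "ball 0 e" and f = "\<lambda>z. patch (S z) 0 r"])
      show "\<forall>w\<in>ball 0 e. \<forall>\<^sub>F w' in at w within ball 0 e. patch (S w) 0 r = patch (S w') 0 r"
      proof
        fix w :: "real ^ 'd" assume "w \<in> ball 0 e"
        then have w: "h (shift w T) \<in> flow_box \<Xi> \<epsilon>" using inbox by simp
        have wT: "shift w T \<in> \<Omega>" using T by simp
        have "dom.near (shift w T) (\<lambda>U. agree r (shift (- ?q (h U)) (h U)) (S w))"
          unfolding S_def
          using near_preimage[OF cod.box_transversal_near[OF box w, of r] wT] by (rule dom.near_mono) simp
        note nf = this
        obtain R d where d: "d > 0"
          "\<forall>U\<in>nbd \<Omega> (shift w T) R d. \<forall>x. norm x < d \<longrightarrow>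
             agree r (shift (- ?q (h (shift x U))) (h (shift x U))) (S w)"
          using dom.near_shift[OF nf wT] by blast
        have "patch (S w) 0 r = patch (S w') 0 r" if "dist w' w < d" for w'
          using d(2)[rule_format, OF dom.nbd_self[OF wT d(1)], of "w' - w"] that
          by (simp add: S_def agree_def dist_norm)
        then show "\<forall>\<^sub>F w' in at w within ball 0 e. patch (S w) 0 r = patch (S w') 0 r"
          using d(1) by (auto simp: eventually_at)
      qed
    qed (use e z in auto)
    then show ?thesis by (simp add: agree_def)
  qed
  then have "S z = S 0" using cod.eq_if_agree_all S_in by blast
  then have "shift (?q (h (shift z T))) (S z) = shift (?q (h (shift z T))) (S 0)" by simp
  then show ?thesis by (simp add: S_def)
qed

lemma box_near_orbit:
  assumes box: "open_flow_box \<Omega>' (\<Xi>, \<epsilon>)" and T: "T \<in> \<Omega>" "h T \<in> flow_box \<Xi> \<epsilon>"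
  obtains R e where "R > 0" "e > 0"
    "\<And>S z. S \<in> nbd \<Omega> T R e \<Longrightarrow> norm z < e \<Longrightarrow> h (shift z S) \<in> flow_box \<Xi> \<epsilon> \<and>
       h (shift z S) = shift (cod.box_coord (\<Xi>, \<epsilon>) (h (shift z S)) - cod.box_coord (\<Xi>, \<epsilon>) (h S)) (h S)"
proof -
  have "dom.near T (\<lambda>S. S \<in> {T \<in> \<Omega>. h T \<in> flow_box \<Xi> \<epsilon>})"
    using T by (intro dom.near_open open_preimage cod.flow_box_subset(3)[OF box]) auto
  from dom.near_shift[OF this T(1)] obtain R e where R: "R > 0" "e > 0"
    "\<And>S z. S \<in> nbd \<Omega> T R e \<Longrightarrow> norm z < e \<Longrightarrow> shift z S \<in> {T \<in> \<Omega>. h T \<in> flow_box \<Xi> \<epsilon>}"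
    by blast
  show ?thesis
  proof (rule that[OF R(1,2)])
    fix S and z :: "real ^ 'd" assume S: "S \<in> nbd \<Omega> T R e" and z: "norm z < e"
    have "S \<in> \<Omega>" using S by (simp add: nbd_def)
    then show "h (shift z S) \<in> flow_box \<Xi> \<epsilon> \<and>
       h (shift z S) = shift (cod.box_coord (\<Xi>, \<epsilon>) (h (shift z S)) - cod.box_coord (\<Xi>, \<epsilon>) (h S)) (h S)"
      using map_within_box[OF box, of S e z] R(3)[OF S] z by blast
  qed
qed

text \<open>The orbit of \<open>h (T - z)\<close> is a locally constant function of \<open>z\<close>.\<close>

lemma orbit_into_orbit:
  assumes T: "T \<in> \<Omega>"
  shows "\<exists>y. h (shift z T) = shift y (h T)"
proof -
  define orbit where "orbit z = range (\<lambda>y. shift y (h (shift z T)))" for z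
  have "orbit z = orbit 0"
  proof (rule connected_local_const[where A = UNIV and f = orbit])
    show "\<forall>w\<in>UNIV. \<forall>\<^sub>F w' in at w within UNIV. orbit w = orbit w'"
    proof
      fix w
      have wT: "shift w T \<in> \<Omega>" using T by simp
      obtain \<Xi> \<epsilon> where box: "open_flow_box \<Omega>' (\<Xi>, \<epsilon>)" "h (shift w T) \<in> flow_box \<Xi> \<epsilon>"
        using cod.flow_box_exists[OF h_in[OF wT]] by blast
      obtain R e where e: "e > 0" "\<And>x. norm x < e \<Longrightarrow> \<exists>y. h (shift x (shift w T)) = shift y (h (shift w T))"
        using box_near_orbit[OF box(1) wT box(2)] dom.nbd_self[OF wT] by metis
      have "orbit w = orbit w'" if w': "dist w' w < e" for w'
      proof -
        have "\<exists>y. h (shift (w' - w) (shift w T)) = shift y (h (shift w T))"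
          by (rule e(2)) (use w' in \<open>simp add: dist_norm\<close>)
        then obtain y where y: "h (shift w' T) = shift y (h (shift w T))" by auto
        have "shift u (h (shift w T)) \<in> orbit w'" for u
          unfolding orbit_def y by (rule range_eqI[of _ _ "u - y"]) simp
        moreover have "shift u (h (shift w' T)) \<in> orbit w" for u
          unfolding orbit_def y by (rule range_eqI[of _ _ "u + y"]) simp
        ultimately show ?thesis unfolding orbit_def by blast
      qed
      then show "\<forall>\<^sub>F w' in at w within UNIV. orbit w = orbit w'"
        using e(1) by (auto simp: eventually_at)
    qed
  qed (auto simp: convex_connected)
  moreover have "h (shift z T) \<in> orbit z" unfolding orbit_def by (rule range_eqI[of _ _ 0]) simp
  ultimately show ?thesis unfolding orbit_def by auto
qed

text \<open>The translation is unique by aperiodicity.\<close>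

definition orbit_cocycle :: "('d, 'l) cochain" where
  "orbit_cocycle T z = (THE y. h (shift z T) = shift y (h T))"

lemma orbit_cocycle_unique:
  assumes "T \<in> \<Omega>" "h (shift z T) = shift y (h T)"
  shows "orbit_cocycle T z = y"
  unfolding orbit_cocycle_def
proof (rule the_equality[where P = "\<lambda>y. h (shift z T) = shift y (h T)", OF assms(2)])
  fix y' assume "h (shift z T) = shift y' (h T)"
  then have "shift (- y) (shift y' (h T)) = shift (- y) (shift y (h T))" using assms(2) by simp
  then have "shift (y' - y) (h T) = h T" by simp
  then show "y' = y" using aperiodic h_in[OF assms(1)] by (fastforce simp: aperiodic_space_def)
qed

lemma orbit_cocycle: "T \<in> \<Omega> \<Longrightarrow> h (shift z T) = shift (orbit_cocycle T z) (h T)"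
  using orbit_into_orbit orbit_cocycle_unique by metis

lemma orbit_cocycle_add:
  assumes "T \<in> \<Omega>"
  shows "orbit_cocycle T (x + y) = orbit_cocycle T x + orbit_cocycle (shift x T) y"
proof (rule orbit_cocycle_unique[OF assms])
  have "h (shift (x + y) T) = h (shift y (shift x T))" by (simp add: add.commute)
  then show "h (shift (x + y) T) = shift (orbit_cocycle T x + orbit_cocycle (shift x T) y) (h T)"
    using orbit_cocycle[OF assms, of x] orbit_cocycle[of "shift x T" y] assms by (simp add: add.commute)
qed

lemma orbit_cocycle_box:
  assumes box: "open_flow_box \<Omega>' (\<Xi>, \<epsilon>)" and T: "T \<in> \<Omega>" "h T \<in> flow_box \<Xi> \<epsilon>"
  shows "\<exists>R>0. \<exists>e>0. \<forall>S\<in>nbd \<Omega> T R e. \<forall>z. norm z < e \<longrightarrow> h (shift z S) \<in> flow_box \<Xi> \<epsilon> \<and>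
       orbit_cocycle S z = cod.box_coord (\<Xi>, \<epsilon>) (h (shift z S)) - cod.box_coord (\<Xi>, \<epsilon>) (h S)"
proof -
  obtain R e where R: "R > 0" "e > 0"
    "\<And>S z. S \<in> nbd \<Omega> T R e \<Longrightarrow> norm z < e \<Longrightarrow> h (shift z S) \<in> flow_box \<Xi> \<epsilon> \<and>
       h (shift z S) = shift (cod.box_coord (\<Xi>, \<epsilon>) (h (shift z S)) - cod.box_coord (\<Xi>, \<epsilon>) (h S)) (h S)"
    using box_near_orbit[OF box T] by blast
  have "h (shift z S) \<in> flow_box \<Xi> \<epsilon> \<and>
       orbit_cocycle S z = cod.box_coord (\<Xi>, \<epsilon>) (h (shift z S)) - cod.box_coord (\<Xi>, \<epsilon>) (h S)"
    if S: "S \<in> nbd \<Omega> T R e" and z: "norm z < e" for S and z :: "real ^ 'd"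
  proof -
    have "S \<in> \<Omega>" using S by (simp add: nbd_def)
    then show ?thesis
      using R(3)[OF S z] by (intro conjI orbit_cocycle_unique) auto
  qed
  then show ?thesis using R(1,2) by blast
qed

text \<open>
  By compactness the orbit cocycle is bounded for translations of one small size, and the cocycle
  identity turns this into linear growth.
\<close>

lemma orbit_cocycle_growth:
  obtains C where "C \<ge> 0" "\<And>T z. T \<in> \<Omega> \<Longrightarrow> norm (orbit_cocycle T z) \<le> C * norm z + C"
proof -
  have "\<exists>R>0. \<exists>e>0. \<exists>c\<ge>0. \<forall>S\<in>nbd \<Omega> T R e. \<forall>z. norm z < e \<longrightarrow> norm (orbit_cocycle S z) \<le> c"
    if T: "T \<in> \<Omega>" for T
  proof -
    obtain \<Xi> \<epsilon> where box: "open_flow_box \<Omega>' (\<Xi>, \<epsilon>)" "h T \<in> flow_box \<Xi> \<epsilon>"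
      using cod.flow_box_exists[OF h_in[OF T]] by blast
    obtain R e where R: "R > 0" "e > 0"
      "\<And>S z. S \<in> nbd \<Omega> T R e \<Longrightarrow> norm z < e \<Longrightarrow> h (shift z S) \<in> flow_box \<Xi> \<epsilon> \<and>
         orbit_cocycle S z = cod.box_coord (\<Xi>, \<epsilon>) (h (shift z S)) - cod.box_coord (\<Xi>, \<epsilon>) (h S)"
      using orbit_cocycle_box[OF box(1) T box(2)] by blast
    have "norm (orbit_cocycle S z) \<le> 2 * \<epsilon>" if "S \<in> nbd \<Omega> T R e" "norm z < e"
      for S and z :: "real ^ 'd"
    proof -
      have "h (shift z S) \<in> flow_box \<Xi> \<epsilon>" "h S \<in> flow_box \<Xi> \<epsilon>"
        using R(3)[OF that] R(3)[OF that(1), of 0] R(2) by auto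
      from this[THEN cod.box_coord(1)[OF box(1)]] show ?thesis
        using R(3)[OF that] norm_triangle_ineq4[of "cod.box_coord (\<Xi>, \<epsilon>) (h (shift z S))" "cod.box_coord (\<Xi>, \<epsilon>) (h S)"]
        by simp
    qed
    moreover have "\<epsilon> > 0" using box(1) by (simp add: open_flow_box_def)
    ultimately show ?thesis using R(1,2)
      by (intro exI[of _ R] conjI exI[of _ e] exI[of _ "2 * \<epsilon>"]) auto
  qed
  then obtain R e c where Rec: "\<And>T. T \<in> \<Omega> \<Longrightarrow> R T > 0" "\<And>T. T \<in> \<Omega> \<Longrightarrow> e T > 0" "\<And>T. T \<in> \<Omega> \<Longrightarrow> c T \<ge> 0"
    "\<And>T S z. T \<in> \<Omega> \<Longrightarrow> S \<in> nbd \<Omega> T (R T) (e T) \<Longrightarrow> norm z < e T \<Longrightarrow> norm (orbit_cocycle S z) \<le> c T"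
    by metis
  obtain F where F: "finite F" "F \<subseteq> \<Omega>" "\<Omega> \<subseteq> (\<Union>T\<in>F. nbd \<Omega> T (R T) (e T))"
    using dom.finite_nbd_cover[of R e] Rec(1,2) by blast
  obtain \<delta> where \<delta>: "\<delta> > 0" "\<And>T. T \<in> F \<Longrightarrow> \<delta> \<le> e T"
    using finite_positive_lower_bound[OF F(1), of e] Rec(2) F(2) by blast
  define c0 where "c0 = (\<Sum>T\<in>F. c T)"
  have c0: "c0 \<ge> 0" unfolding c0_def using Rec(3) F(2) by (intro sum_nonneg) auto
  have small: "norm (orbit_cocycle S z) \<le> c0" if "S \<in> \<Omega>" "norm z < \<delta>" for S z
  proof -
    obtain T where T: "T \<in> F" "S \<in> nbd \<Omega> T (R T) (e T)" using F(3) \<open>S \<in> \<Omega>\<close> by blast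
    have "norm (orbit_cocycle S z) \<le> c T"
      using Rec(4)[OF _ T(2), of z] T(1) F(2) \<delta>(2)[OF T(1)] that(2) by auto
    also have "c T \<le> c0" unfolding c0_def
      using Rec(3) F(2) by (intro member_le_sum[OF T(1) _ F(1)]) auto
    finally show ?thesis .
  qed
  have mult: "norm (orbit_cocycle S (real n *\<^sub>R z)) \<le> real n * c0" if "S \<in> \<Omega>" "norm z < \<delta>" for S z n
  proof (induction n)
    case 0
    have "orbit_cocycle S 0 = 0" using orbit_cocycle_add[OF that(1), of 0 0] by simp
    then show ?case by simp
  next
    case (Suc n)
    have "orbit_cocycle S (real (Suc n) *\<^sub>R z) =
        orbit_cocycle S (real n *\<^sub>R z) + orbit_cocycle (shift (real n *\<^sub>R z) S) z"
      using orbit_cocycle_add[OF that(1), of "real n *\<^sub>R z" z] by (simp add: scaleR_left_distrib add.commute)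
    also have "norm \<dots> \<le> real n * c0 + c0"
      using Suc small[of "shift (real n *\<^sub>R z) S" z] that by (intro norm_triangle_mono) auto
    finally show ?case by (simp add: algebra_simps)
  qed
  define C where "C = c0 / \<delta> + c0"
  show ?thesis
  proof (rule that[of C])
    show "C \<ge> 0" using c0 \<delta>(1) by (simp add: C_def)
    fix T and z :: "real ^ 'd" assume T: "T \<in> \<Omega>"
    define n where "n = nat \<lfloor>norm z / \<delta>\<rfloor> + 1"
    have nn: "real_of_int \<lfloor>norm z / \<delta>\<rfloor> \<ge> 0" using \<delta>(1) by simp
    have n: "real n > norm z / \<delta>" "real n \<le> norm z / \<delta> + 1"
      using nn unfolding n_def by (simp_all, linarith+)
    have "real n > 0" by (simp add: n_def)
    then have "norm (z /\<^sub>R real n) < \<delta>"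
      using n(1) \<delta>(1) by (simp add: field_simps)
    from mult[of T "z /\<^sub>R real n" n, OF T this] have "norm (orbit_cocycle T z) \<le> real n * c0"
      using \<open>real n > 0\<close> by simp
    also have "\<dots> \<le> (norm z / \<delta> + 1) * c0" using n(2) c0 by (rule mult_right_mono)
    also have "\<dots> \<le> C * norm z + C"
      using c0 \<delta>(1) by (simp add: C_def algebra_simps)
    finally show "norm (orbit_cocycle T z) \<le> C * norm z + C" .
  qed
qed


section \<open>A strong cocycle in the class of a map\<close>

lemma fundamental_cocycle: "strong_cocycle \<Omega>' (\<lambda>T v. v)"
proof -
  have "cod.patch_stable (\<lambda>T. v)" for v :: "real ^ 'd"
    unfolding cod.patch_stable_def using zero_less_one by blast
  then show ?thesis
    unfolding strong_cocycle_def cod.transversally_locally_constant_iff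
    using continuous_map_snd by (auto simp: case_prod_beta' continuous_map_snd)
qed

definition map_cech :: "(('d, 'm) pattern set \<times> real, ('d, 'l) pattern, real ^ 'd) cech" where
  "map_cech = cech_preimage (space_topology \<Omega>) h (cech_of_cocycle \<Omega>' (\<lambda>T v. v))"

lemma map_cech_eq:
  "map_cech = (Collect (open_flow_box \<Omega>'), \<lambda>k. {T \<in> \<Omega>. h T \<in> flow_box (fst k) (snd k)},
     \<lambda>i j T. cod.box_coord i (h T) - cod.box_coord j (h T))"
  by (simp add: map_cech_def cech_preimage_def cod.cech_of_cocycle_eq cod.box_coord_def)

lemma map_cech_cocycle: "cech_cocycle (space_topology \<Omega>) map_cech"
  unfolding map_cech_def by (rule cech_cocycle_preimage[OF h cod.cech_cocycle_of_cocycle[OF fundamental_cocycle]])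

lemma box_coord_diff_near:
  assumes "open_flow_box \<Omega>' i" "open_flow_box \<Omega>' j" "T \<in> \<Omega>"
    and "h T \<in> flow_box (fst i) (snd i)" "h T \<in> flow_box (fst j) (snd j)"
  shows "dom.near T (\<lambda>S. cod.box_coord i (h S) - cod.box_coord j (h S) =
    cod.box_coord i (h T) - cod.box_coord j (h T))"
proof -
  note c = cech_cocycleD[OF map_cech_cocycle[unfolded map_cech_eq]]
  have i: "i \<in> Collect (open_flow_box \<Omega>')" and j: "j \<in> Collect (open_flow_box \<Omega>')" using assms by simp_all
  show ?thesis
    by (rule bspec[OF iffD1[OF dom.locally_constant_on_open_iff_near c(3)[OF i j]]])
      (use openin_Int[OF c(1)[OF i] c(1)[OF j]] assms(3-5) in auto)
qed

text \<open>
  The boundary of \<open>\<Phi> = \<Sum>j. w j * q j\<close>, with \<open>q j\<close> the flow box coordinate of the image, makes the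
  orbit cocycle locally constant in the transverse direction: in a flow box with coordinate \<open>q\<close> the
  cocycle is the boundary of \<open>q - \<Phi> = \<Sum>j. w j * (q - q j)\<close>, whose ingredients depend only on patches.
\<close>

lemma strong_representative:
  obtains \<alpha> where "strong_cocycle \<Omega> \<alpha>"
    "cech_cohomologous (space_topology \<Omega>) (cech_of_cocycle \<Omega> \<alpha>) map_cech"
proof -
  have "\<forall>T\<in>\<Omega>. \<exists>k. open_flow_box \<Omega>' k \<and> h T \<in> flow_box (fst k) (snd k)"
    using cod.flow_box_exists h_in by (metis fst_conv snd_conv)
  then obtain k where k: "\<And>T. T \<in> \<Omega> \<Longrightarrow> open_flow_box \<Omega>' (k T)"
    "\<And>T. T \<in> \<Omega> \<Longrightarrow> h T \<in> flow_box (fst (k T)) (snd (k T))" by metis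
  define U where "U T = {S \<in> \<Omega>. h S \<in> flow_box (fst (k T)) (snd (k T))}" for T
  have U: "openin (space_topology \<Omega>) (U T)" "T \<in> U T" if "T \<in> \<Omega>" for T
    using k[OF that] that cod.flow_box_subset(3)[of "fst (k T)" "snd (k T)"] open_preimage
    by (simp_all add: U_def)
  show ?thesis
  proof (rule dom.partition_of_unity[of U, OF U])
    fix F w R
    assume F: "finite F" "F \<subseteq> \<Omega>" "R > 0"
      and w1: "\<And>T. T \<in> \<Omega> \<Longrightarrow> (\<Sum>j\<in>F. w j T) = (1 :: real)"
      and w2: "\<And>j S T. j \<in> F \<Longrightarrow> agree R S T \<Longrightarrow> w j S = w j T"
      and w3: "\<And>j T. j \<in> F \<Longrightarrow> T \<in> \<Omega> \<Longrightarrow> ((\<lambda>z. w j (shift z T)) \<longlongrightarrow> w j T) (at 0)"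
      and w4: "\<And>j T. j \<in> F \<Longrightarrow> T \<in> \<Omega> \<Longrightarrow> T \<notin> U j \<Longrightarrow> dom.near T (\<lambda>S. w j S = 0)"
    define q where "q i T = cod.box_coord i (h T)" for i T
    define \<Phi> where "\<Phi> T = (\<Sum>j\<in>F. w j T *\<^sub>R q (k j) T)" for T
    define \<alpha> where "\<alpha> T z = orbit_cocycle T z - (\<Phi> (shift z T) - \<Phi> T)" for T z
    define d where "d i T j = q i T - q (k j) T" for i T j
    have add: "\<alpha> T (x + y) = \<alpha> T x + \<alpha> (shift x T) y" if "T \<in> \<Omega>" for T x y
      using orbit_cocycle_add[OF that, of x y] by (simp add: \<alpha>_def add.commute)
    \<comment> \<open>The primitive \<open>q - \<Phi>\<close> near \<open>T\<close> is a combination of the weights with constant coefficients.\<close>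
    have prim: "dom.near T (\<lambda>S. q i S - \<Phi> S = (\<Sum>j\<in>F. w j S *\<^sub>R d i T j))"
      if i: "open_flow_box \<Omega>' i" and T: "T \<in> \<Omega>" "h T \<in> flow_box (fst i) (snd i)" for i T
    proof -
      have "dom.near T (\<lambda>S. w j S *\<^sub>R (q i S - q (k j) S) = w j S *\<^sub>R d i T j)" if j: "j \<in> F" for j
      proof (cases "T \<in> U j")
        case True
        have "open_flow_box \<Omega>' (k j)" using k(1) j F(2) by blast
        from box_coord_diff_near[OF i this T] True
        have "dom.near T (\<lambda>S. q i S - q (k j) S = d i T j)" by (simp add: U_def q_def d_def)
        then show ?thesis by (rule dom.near_mono) simp
      next
        case False
        show ?thesis by (rule dom.near_mono[OF w4[OF j T(1) False]]) simp
      qed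
      then have "dom.near T (\<lambda>S. \<forall>j\<in>F. w j S *\<^sub>R (q i S - q (k j) S) = w j S *\<^sub>R d i T j)"
        by (rule dom.near_finite[OF F(1)])
      then show ?thesis
      proof (rule dom.near_mono)
        fix S assume S: "S \<in> \<Omega>" "\<forall>j\<in>F. w j S *\<^sub>R (q i S - q (k j) S) = w j S *\<^sub>R d i T j"
        have "q i S - \<Phi> S = (\<Sum>j\<in>F. w j S) *\<^sub>R q i S - \<Phi> S" using w1[OF S(1)] by simp
        also have "\<dots> = (\<Sum>j\<in>F. w j S *\<^sub>R (q i S - q (k j) S))"
          by (simp add: \<Phi>_def scaleR_sum_left scaleR_diff_right sum_subtractf)
        finally show "q i S - \<Phi> S = (\<Sum>j\<in>F. w j S *\<^sub>R d i T j)" using S(2) by simp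
      qed
    qed
    have formula: "\<exists>R'>0. \<exists>e>0. \<forall>S\<in>nbd \<Omega> T R' e. \<forall>z. norm z < e \<longrightarrow>
        \<alpha> S z = (q i (shift z S) - \<Phi> (shift z S)) - (q i S - \<Phi> S) \<and>
        \<alpha> S z = (\<Sum>j\<in>F. (w j (shift z S) - w j S) *\<^sub>R d i T j)"
      if i: "open_flow_box \<Omega>' i" and T: "T \<in> \<Omega>" "h T \<in> flow_box (fst i) (snd i)" for i T
    proof -
      obtain R1 e1 where R1: "R1 > 0" "e1 > 0"
        "\<And>S z. S \<in> nbd \<Omega> T R1 e1 \<Longrightarrow> norm z < e1 \<Longrightarrow> orbit_cocycle S z = q i (shift z S) - q i S"
        using orbit_cocycle_box[of "fst i" "snd i" T] i T unfolding q_def prod.collapse by blast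
      obtain R2 e2 where R2: "R2 > 0" "e2 > 0"
        "\<And>S z. S \<in> nbd \<Omega> T R2 e2 \<Longrightarrow> norm z < e2 \<Longrightarrow>
           q i (shift z S) - \<Phi> (shift z S) = (\<Sum>j\<in>F. w j (shift z S) *\<^sub>R d i T j)"
        using dom.near_shift[OF prim[OF i T] T(1)] by blast
      have "\<alpha> S z = (q i (shift z S) - \<Phi> (shift z S)) - (q i S - \<Phi> S) \<and>
        \<alpha> S z = (\<Sum>j\<in>F. (w j (shift z S) - w j S) *\<^sub>R d i T j)"
        if S: "S \<in> nbd \<Omega> T (max R1 R2) (min e1 e2)" and z: "norm z < min e1 e2" for S z
      proof -
        have S': "S \<in> nbd \<Omega> T R1 e1" "S \<in> nbd \<Omega> T R2 e2"
          using S nbd_mono[of R1 "max R1 R2" "min e1 e2" e1 \<Omega> T] nbd_mono[of R2 "max R1 R2" "min e1 e2" e2 \<Omega> T] by auto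
        have a: "\<alpha> S z = (q i (shift z S) - \<Phi> (shift z S)) - (q i S - \<Phi> S)"
          using R1(3)[OF S'(1), of z] z by (simp add: \<alpha>_def)
        then show ?thesis
          using R2(3)[OF S'(2), of z] R2(3)[OF S'(2), of 0] R2(2) z
          by (simp add: scaleR_diff_left sum_subtractf)
      qed
      moreover have "max R1 R2 > 0" "min e1 e2 > 0" using R1(1,2) R2(2) by auto
      ultimately show ?thesis by blast
    qed
    have loc: "\<exists>R>0. \<exists>e>0. \<forall>S\<in>\<Omega>. \<forall>z. agree R S T \<longrightarrow> norm z < e \<longrightarrow> \<alpha> S z = \<alpha> T z" if T: "T \<in> \<Omega>" for T
    proof -
      obtain R1 e where R1: "R1 > 0" "e > 0" "\<And>S z. S \<in> nbd \<Omega> T R1 e \<Longrightarrow> norm z < e \<Longrightarrow>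
          \<alpha> S z = (\<Sum>j\<in>F. (w j (shift z S) - w j S) *\<^sub>R d (k T) T j)"
        using formula[OF k(1)[OF T] T k(2)[OF T]] by blast
      have "\<alpha> S z = \<alpha> T z" if S: "S \<in> \<Omega>" "agree (max R1 (R + e)) S T" "norm z < e" for S z
      proof -
        have "agree R1 S T" "agree (R + e) S T" using S(2) agree_mono by (meson max.cobounded1 max.cobounded2)+
        then have 1: "S \<in> nbd \<Omega> T R1 e" "T \<in> nbd \<Omega> T R1 e"
          using S(1) T R1(2) by (auto intro: nbdI[of _ _ 0] dom.nbd_self)
        have "agree R (shift z S) (shift z T)" "agree R S T"
          using \<open>agree (R + e) S T\<close> S(3) R1(2) by (auto intro: agree_shift agree_mono)
        then show ?thesis
          unfolding R1(3)[OF 1(1) S(3)] R1(3)[OF 1(2) S(3)] using w2 by (intro sum.cong) auto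
      qed
      then show ?thesis using R1(1,2) by (intro exI[of _ "max R1 (R + e)"] conjI exI[of _ e]) auto
    qed
    have cont: "(\<alpha> T \<longlongrightarrow> 0) (at 0)" if T: "T \<in> \<Omega>" for T
    proof -
      obtain R1 e where R1: "R1 > 0" "e > 0" "\<And>S z. S \<in> nbd \<Omega> T R1 e \<Longrightarrow> norm z < e \<Longrightarrow>
          \<alpha> S z = (\<Sum>j\<in>F. (w j (shift z S) - w j S) *\<^sub>R d (k T) T j)"
        using formula[OF k(1)[OF T] T k(2)[OF T]] by blast
      have "((\<lambda>z. \<Sum>j\<in>F. (w j (shift z T) - w j T) *\<^sub>R d (k T) T j) \<longlongrightarrow> 0) (at 0)"
      proof (rule tendsto_null_sum)
        fix j assume j: "j \<in> F"
        have "((\<lambda>z. (w j (shift z T) - w j T) *\<^sub>R d (k T) T j) \<longlongrightarrow> (w j T - w j T) *\<^sub>R d (k T) T j) (at 0)"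
          by (intro tendsto_intros w3[OF j T])
        then show "((\<lambda>z. (w j (shift z T) - w j T) *\<^sub>R d (k T) T j) \<longlongrightarrow> 0) (at 0)" by simp
      qed
      moreover have "\<forall>\<^sub>F z in at 0. (\<Sum>j\<in>F. (w j (shift z T) - w j T) *\<^sub>R d (k T) T j) = \<alpha> T z"
        unfolding eventually_at using R1(2) R1(3)[OF dom.nbd_self[OF T R1(2)]]
        by (intro exI[of _ e]) auto
      ultimately show ?thesis by (rule Lim_transform_eventually)
    qed
    have strong: "strong_cocycle \<Omega> \<alpha>" by (rule dom.strong_cocycle_if_local[OF add loc cont])
    define K where "K = Collect (open_flow_box \<Omega>) \<times> Collect (open_flow_box \<Omega>')"
    define W where "W = (\<lambda>(m, i). flow_box (fst m) (snd m) \<inter> {T \<in> \<Omega>. h T \<in> flow_box (fst i) (snd i)})"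
    define b where "b = (\<lambda>(m, i) T. flow_box_primitive \<alpha> m T - (q i T - \<Phi> T))"
    have Wop: "openin (space_topology \<Omega>) (W x)" if "x \<in> K" for x
      using that dom.flow_box_subset(3)[of "fst (fst x)" "snd (fst x)"]
        cod.flow_box_subset(3)[of "fst (snd x)" "snd (snd x)"] open_preimage
      by (auto simp: K_def W_def)
    have "cech_cohomologous (space_topology \<Omega>) (cech_of_cocycle \<Omega> \<alpha>) map_cech"
      unfolding map_cech_eq dom.cech_of_cocycle_eq
    proof (rule cech_cohomologousI[where K = K and W = W and r = fst and s = snd and b = b])
      show "(\<Union>x\<in>K. W x) = topspace (space_topology \<Omega>)"
      proof -
        have "(\<Union>x\<in>K. W x) = \<Omega>"
        proof (intro subset_antisym subsetI)
          fix T assume T: "T \<in> \<Omega>"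
          then obtain m where "open_flow_box \<Omega> m" "T \<in> flow_box (fst m) (snd m)"
            using dom.flow_boxes_cover by blast
          then have "(m, k T) \<in> K" "T \<in> W (m, k T)" using T k[OF T] by (auto simp: K_def W_def)
          then show "T \<in> (\<Union>x\<in>K. W x)" by blast
        qed (auto simp: W_def)
        then show ?thesis by simp
      qed
    next
      fix x assume x: "x \<in> K"
      then obtain \<Xi> \<epsilon> i where xi: "x = ((\<Xi>, \<epsilon>), i)" and box: "open_flow_box \<Omega> (\<Xi>, \<epsilon>)" and i: "open_flow_box \<Omega>' i"
        by (auto simp: K_def)
      show "locally_constant_on (space_topology \<Omega>) (W x) (b x)"
        unfolding dom.locally_constant_on_open_iff_near[OF Wop[OF x]]
      proof
        fix T assume "T \<in> W x"
        then have T: "T \<in> \<Omega>" "T \<in> flow_box \<Xi> \<epsilon>" "h T \<in> flow_box (fst i) (snd i)"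
          by (auto simp: W_def xi)
        obtain S y where S: "S \<in> \<Xi>" "norm y < \<epsilon>" "T = shift y S" using T(2) by (rule dom.flow_boxE)
        have S\<Omega>: "S \<in> \<Omega>" using S(1) dom.flow_box_subset(1)[OF box] by blast
        obtain r e0 where r: "r > 0" "e0 > 0"
          "\<And>S' z. S' \<in> \<Omega> \<Longrightarrow> agree r S' S \<Longrightarrow> norm z < e0 \<Longrightarrow> \<alpha> S' (y + z) = \<alpha> S (y + z)"
          using dom.local_cocycle_extend[OF add loc S\<Omega>] by blast
        obtain R1 e1 where R1: "R1 > 0" "e1 > 0"
          "\<And>T' z. T' \<in> \<Omega> \<Longrightarrow> norm z < e1 \<Longrightarrow> agree R1 T' (shift z (shift y S)) \<Longrightarrow>
             shift (- y - z) T' \<in> \<Xi> \<and> agree r (shift (- y - z) T') S \<and> norm (y + z) < \<epsilon>"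
          using dom.flow_box_coordinates[OF box S(1,2)] by blast
        obtain R2 e2 where R2: "R2 > 0" "e2 > 0"
          "\<And>T' z. T' \<in> nbd \<Omega> T R2 e2 \<Longrightarrow> norm z < e2 \<Longrightarrow>
            \<alpha> T' z = (q i (shift z T') - \<Phi> (shift z T')) - (q i T' - \<Phi> T')"
          using formula[OF i T(1,3)] by blast
        obtain R3 e3 where R3: "R3 > 0" "e3 > 0"
          "\<And>T'. T' \<in> nbd \<Omega> T R3 e3 \<Longrightarrow> q i T' - \<Phi> T' = (\<Sum>j\<in>F. w j T' *\<^sub>R d i T j)"
          using prim[OF i T(1,3)] unfolding dom.near_def by blast
        have "b x T' = b x T"
          if T': "T' \<in> \<Omega>" "norm z < min (min e0 e1) (min e2 e3)" "agree (max (max R1 R) R3) T' (shift z T)" for T' z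
        proof -
          have ag: "agree R1 T' (shift z T)" "agree R T' (shift z T)" "agree R3 T' (shift z T)"
            using T'(3) by (auto elim: agree_mono)
          define S' where "S' = shift (- y - z) T'"
          have S': "S' \<in> \<Xi>" "agree r S' S" "norm (y + z) < \<epsilon>"
            using R1(3)[OF T'(1) _ ag(1)[unfolded S(3)]] T'(2) by (auto simp: S'_def)
          have T'S: "T' = shift (y + z) S'" by (simp add: S'_def)
          have "flow_box_primitive \<alpha> (\<Xi>, \<epsilon>) T' = \<alpha> S' (y + z)"
            unfolding T'S by (rule dom.flow_box_primitive_shift[OF box S'(1,3)])
          also have "\<dots> = \<alpha> S (y + z)" using r(3)[of S' z] S'(2) T'(1,2) by (simp add: S'_def)
          also have "\<dots> = \<alpha> S y + \<alpha> T z" using add[OF S\<Omega>] by (simp add: S(3))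
          also have "\<alpha> S y = flow_box_primitive \<alpha> (\<Xi>, \<epsilon>) T"
            unfolding S(3) by (rule dom.flow_box_primitive_shift[OF box S(1,2), symmetric])
          finally have p: "flow_box_primitive \<alpha> (\<Xi>, \<epsilon>) T' = flow_box_primitive \<alpha> (\<Xi>, \<epsilon>) T + \<alpha> T z" .
          have "T' \<in> nbd \<Omega> T R3 e3" "shift z T \<in> nbd \<Omega> T R3 e3"
            using T' T(1) ag(3) by (auto intro: nbdI)
          then have "q i T' - \<Phi> T' = q i (shift z T) - \<Phi> (shift z T)"
            using R3(3) w2[OF _ ag(2)] by simp
          also have "\<dots> = \<alpha> T z + (q i T - \<Phi> T)"
            using R2(3)[OF dom.nbd_self[OF T(1) R2(2)], of z] T'(2) by simp
          finally show ?thesis using p by (simp add: b_def xi)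
        qed
        then show "dom.near T (\<lambda>S. b x S = b x T)"
          unfolding dom.near_iff_agree_shift[OF T(1)] using r(2) R1(1,2) R2(2) R3(2)
          by (intro exI[of _ "max (max R1 R) R3"] conjI exI[of _ "min (min e0 e1) (min e2 e3)"]) auto
      qed
    next
      fix x y T assume "x \<in> K" "y \<in> K" "T \<in> W x" "T \<in> W y"
      show "flow_box_primitive \<alpha> (fst x) T - flow_box_primitive \<alpha> (fst y) T -
         (cod.box_coord (snd x) (h T) - cod.box_coord (snd y) (h T)) = b x T - b y T"
        by (simp add: b_def case_prod_beta' q_def algebra_simps)
    qed (use Wop in \<open>auto simp: K_def W_def\<close>)
    then show ?thesis using strong that by blast
  qed
qed

text \<open>
  Conversely, a strong cocycle with this Cech class differs from the orbit cocycle by the boundary of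
  the bounded function that the local primitives and the Cech coboundary glue together.
\<close>

lemma cohomologous_imp_bounded_difference:
  assumes \<alpha>: "strong_cocycle \<Omega> \<alpha>"
    and coh: "cech_cohomologous (space_topology \<Omega>) (cech_of_cocycle \<Omega> \<alpha>) map_cech"
  obtains B where "\<And>T v. T \<in> \<Omega> \<Longrightarrow> norm (\<alpha> T v - orbit_cocycle T v) \<le> B"
proof -
  obtain \<W> r s b where W0: "\<And>W. W \<in> \<W> \<Longrightarrow> openin (space_topology \<Omega>) W" "\<Union>\<W> = topspace (space_topology \<Omega>)"
    "\<And>W. W \<in> \<W> \<Longrightarrow> r W \<in> Collect (open_flow_box \<Omega>)" "\<And>W. W \<in> \<W> \<Longrightarrow> W \<subseteq> flow_box (fst (r W)) (snd (r W))"
    "\<And>W. W \<in> \<W> \<Longrightarrow> s W \<in> Collect (open_flow_box \<Omega>')" "\<And>W. W \<in> \<W> \<Longrightarrow> W \<subseteq> {T \<in> \<Omega>. h T \<in> flow_box (fst (s W)) (snd (s W))}"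
    "\<And>W. W \<in> \<W> \<Longrightarrow> locally_constant_on (space_topology \<Omega>) W (b W)"
    "\<And>W W' T. W \<in> \<W> \<Longrightarrow> W' \<in> \<W> \<Longrightarrow> T \<in> W \<Longrightarrow> T \<in> W' \<Longrightarrow>
      flow_box_primitive \<alpha> (r W) T - flow_box_primitive \<alpha> (r W') T -
      (cod.box_coord (s W) (h T) - cod.box_coord (s W') (h T)) = b W T - b W' T"
    using cech_cohomologousE[OF coh[unfolded map_cech_eq dom.cech_of_cocycle_eq]] by blast
  note W = W0[unfolded mem_Collect_eq topspace_subtopology topspace_pattern_topology Int_UNIV_left]
  note add = dom.strong_cocycleD(1)[OF \<alpha>]
  define f where "f W T = flow_box_primitive \<alpha> (r W) T - cod.box_coord (s W) (h T) - b W T" for W T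
  have "\<forall>T\<in>\<Omega>. \<exists>W. W \<in> \<W> \<and> T \<in> W" using W(2) by blast
  then obtain w where w: "\<And>T. T \<in> \<Omega> \<Longrightarrow> w T \<in> \<W>" "\<And>T. T \<in> \<Omega> \<Longrightarrow> T \<in> w T" by metis
  define g where "g T = f (w T) T" for T
  have \<W>\<Omega>: "W \<subseteq> \<Omega>" if "W \<in> \<W>" for W using that W(2) by blast
  have g: "g T = f W T" if "W \<in> \<W>" "T \<in> W" for W T
  proof -
    have "T \<in> \<Omega>" using that \<W>\<Omega> by blast
    then show ?thesis
      using W(8)[OF w(1) that(1) w(2) that(2)] by (simp add: g_def f_def algebra_simps)
  qed
  have step: "\<exists>e>0. \<forall>z. norm z < e \<longrightarrow> g (shift z T) - g T = \<alpha> T z - orbit_cocycle T z" if T: "T \<in> \<Omega>" for T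
  proof -
    define A where "A = w T"
    have A: "A \<in> \<W>" "T \<in> A" using w[OF T] by (simp_all add: A_def)
    obtain \<Xi> \<epsilon> where rA: "r A = (\<Xi>, \<epsilon>)" by (cases "r A")
    have box: "open_flow_box \<Omega> (\<Xi>, \<epsilon>)" "T \<in> flow_box \<Xi> \<epsilon>" using W(3,4)[OF A(1)] A(2) by (auto simp: rA)
    obtain S y where S: "S \<in> \<Xi>" "norm y < \<epsilon>" "T = shift y S" using box(2) by (rule dom.flow_boxE)
    have S\<Omega>: "S \<in> \<Omega>" using S(1) dom.flow_box_subset(1)[OF box(1)] by blast
    obtain e1 where e1: "e1 > 0" "\<And>z. norm z < e1 \<Longrightarrow>
        orbit_cocycle T z = cod.box_coord (s A) (h (shift z T)) - cod.box_coord (s A) (h T)"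
    proof -
      have "h T \<in> flow_box (fst (s A)) (snd (s A))" using W(6)[OF A(1)] A(2) by blast
      then obtain R1 e1 where R1: "e1 > 0" "\<And>S z. S \<in> nbd \<Omega> T R1 e1 \<Longrightarrow> norm z < e1 \<Longrightarrow>
          orbit_cocycle S z = cod.box_coord (s A) (h (shift z S)) - cod.box_coord (s A) (h S)"
        using orbit_cocycle_box[of "fst (s A)" "snd (s A)" T] W(5)[OF A(1)] T unfolding prod.collapse by blast
      show thesis by (rule that[OF R1(1) R1(2)[OF dom.nbd_self[OF T R1(1)]]])
    qed
    have "dom.near T (\<lambda>U. U \<in> A \<and> b A U = b A T)"
      using W(7)[OF A(1)] A(2) dom.near_open[OF W(1)[OF A(1)] A(2)]
      unfolding dom.locally_constant_on_open_iff_near[OF W(1)[OF A(1)]] by (intro dom.near_conj) auto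
    from dom.near_shift[OF this T] obtain R2 e2 where e2: "R2 > 0" "e2 > 0"
      "\<And>U z. U \<in> nbd \<Omega> T R2 e2 \<Longrightarrow> norm z < e2 \<Longrightarrow> shift z U \<in> A \<and> b A (shift z U) = b A T"
      by blast
    define e where "e = min (min e1 e2) (\<epsilon> - norm y)"
    have "g (shift z T) - g T = \<alpha> T z - orbit_cocycle T z" if z: "norm z < e" for z
    proof -
      have z': "norm z < e1" "norm z < e2" "norm (y + z) < \<epsilon>"
        using z norm_triangle_ineq[of y z] by (auto simp: e_def)
      have zA: "shift z T \<in> A" "b A (shift z T) = b A T" using e2(3)[OF dom.nbd_self[OF T e2(2)] z'(2)] by auto
      have "flow_box_primitive \<alpha> (r A) (shift z T) = \<alpha> S (y + z)"
        using dom.flow_box_primitive_shift[OF box(1) S(1) z'(3), of \<alpha>] by (simp add: rA S(3) add.commute)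
      moreover have "flow_box_primitive \<alpha> (r A) T = \<alpha> S y"
        using dom.flow_box_primitive_shift[OF box(1) S(1,2), of \<alpha>] by (simp add: rA S(3))
      moreover have "\<alpha> S (y + z) = \<alpha> S y + \<alpha> T z" using add[OF S\<Omega>] by (simp add: S(3))
      ultimately show ?thesis
        using g[OF A(1) zA(1)] g[OF A] zA(2) e1(2)[OF z'(1)] by (simp add: f_def)
    qed
    moreover have "e > 0" using e1(1) e2(2) S(2) by (simp add: e_def)
    ultimately show ?thesis by blast
  qed
  have cob: "\<alpha> T v - orbit_cocycle T v = g (shift v T) - g T" if T: "T \<in> \<Omega>" for T v
  proof -
    define f0 where "f0 v = \<alpha> T v - orbit_cocycle T v - g (shift v T)" for v
    have "f0 v = f0 0"
    proof (rule connected_local_const[where A = UNIV and f = f0])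
      show "\<forall>w\<in>UNIV. \<forall>\<^sub>F w' in at w within UNIV. f0 w = f0 w'"
      proof
        fix w
        obtain e where e: "e > 0" "\<And>z. norm z < e \<Longrightarrow>
            g (shift z (shift w T)) - g (shift w T) = \<alpha> (shift w T) z - orbit_cocycle (shift w T) z"
          using step[of "shift w T"] T by auto
        have "f0 w = f0 w'" if "dist w' w < e" for w'
          using e(2)[of "w' - w"] that add[OF T, of w "w' - w"] orbit_cocycle_add[OF T, of w "w' - w"]
          by (simp add: f0_def dist_norm algebra_simps)
        then show "\<forall>\<^sub>F w' in at w within UNIV. f0 w = f0 w'" using e(1) by (auto simp: eventually_at)
      qed
    qed (auto simp: convex_connected)
    moreover have "\<alpha> T 0 = 0" "orbit_cocycle T 0 = 0"
      using add[OF T, of 0 0] orbit_cocycle_add[OF T, of 0 0] by simp_all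
    ultimately show ?thesis by (simp add: f0_def algebra_simps)
  qed
  have bdd: "\<exists>R>0. \<exists>e>0. \<exists>c\<ge>0. \<forall>T'\<in>nbd \<Omega> T R e. norm (g T') \<le> c" if T: "T \<in> \<Omega>" for T
  proof -
    define A where "A = w T"
    have A: "A \<in> \<W>" "T \<in> A" using w[OF T] by (simp_all add: A_def)
    obtain \<Xi> \<epsilon> where rA: "r A = (\<Xi>, \<epsilon>)" by (cases "r A")
    have box: "open_flow_box \<Omega> (\<Xi>, \<epsilon>)" "T \<in> flow_box \<Xi> \<epsilon>" using W(3,4)[OF A(1)] A(2) by (auto simp: rA)
    obtain S y where S: "S \<in> \<Xi>" "norm y < \<epsilon>" "T = shift y S" using box(2) by (rule dom.flow_boxE)
    have S\<Omega>: "S \<in> \<Omega>" using S(1) dom.flow_box_subset(1)[OF box(1)] by blast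
    have "continuous_map (prod_topology (space_topology \<Omega>) euclidean) euclidean (\<lambda>(T, x). \<alpha> T x)"
      using \<alpha> by (simp add: strong_cocycle_def)
    moreover define Z where "Z = {p \<in> topspace (prod_topology (space_topology \<Omega>) euclidean).
        (\<lambda>(T, x). \<alpha> T x) p \<in> ball 0 (norm (\<alpha> S y) + 1)}"
    ultimately have "openin (prod_topology (space_topology \<Omega>) euclidean) Z"
      by (simp only: Z_def) (rule openin_continuous_map_preimage, assumption, simp)
    moreover have "(S, y) \<in> Z" using S\<Omega> by (simp add: Z_def)
    ultimately have "\<exists>N B. openin (space_topology \<Omega>) N \<and> openin euclidean B \<and> S \<in> N \<and> y \<in> B \<and> N \<times> B \<subseteq> Z"
      unfolding openin_prod_topology_alt by simp
    then obtain N B where NB: "openin (space_topology \<Omega>) N" "open B" "S \<in> N" "y \<in> B" "N \<times> B \<subseteq> Z"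
      by auto
    have NB': "norm (\<alpha> S' y') < norm (\<alpha> S y) + 1" if "S' \<in> N" "y' \<in> B" for S' y'
    proof -
      have "(S', y') \<in> Z" using NB(5) that by blast
      then show ?thesis by (simp add: Z_def)
    qed
    obtain r0 where r0: "r0 > 0" "\<And>S'. S' \<in> \<Omega> \<Longrightarrow> agree r0 S' S \<Longrightarrow> S' \<in> N"
      using dom.near_agree[OF dom.near_open[OF NB(1,3)] S\<Omega>] by blast
    obtain e0 where e0: "e0 > 0" "\<And>y'. dist y' y < e0 \<Longrightarrow> y' \<in> B" using NB(2,4) unfolding open_dist by blast
    obtain R1 e1 where R1: "R1 > 0" "e1 > 0"
      "\<And>T' z. T' \<in> \<Omega> \<Longrightarrow> norm z < e1 \<Longrightarrow> agree R1 T' (shift z (shift y S)) \<Longrightarrow>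
         shift (- y - z) T' \<in> \<Xi> \<and> agree r0 (shift (- y - z) T') S \<and> norm (y + z) < \<epsilon>"
      using dom.flow_box_coordinates[OF box(1) S(1,2)] by blast
    have "norm (flow_box_primitive \<alpha> (r A) T') \<le> norm (\<alpha> S y) + 1"
      if T': "T' \<in> \<Omega>" "norm z < min e0 e1" "agree R1 T' (shift z T)" for T' z
    proof -
      have k: "shift (- y - z) T' \<in> \<Xi>" "agree r0 (shift (- y - z) T') S" "norm (y + z) < \<epsilon>"
        using R1(3)[OF T'(1), of z] T'(2,3) by (auto simp: S(3))
      have "flow_box_primitive \<alpha> (r A) (shift (y + z) (shift (- y - z) T')) = \<alpha> (shift (- y - z) T') (y + z)"
        unfolding rA by (rule dom.flow_box_primitive_shift[OF box(1) k(1,3)])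
      moreover have "norm (\<alpha> (shift (- y - z) T') (y + z)) < norm (\<alpha> S y) + 1"
        by (rule NB'[OF r0(2)[OF _ k(2)] e0(2)]) (use T' in \<open>auto simp: dist_norm\<close>)
      ultimately show ?thesis by simp
    qed
    then have n1: "dom.near T (\<lambda>T'. norm (flow_box_primitive \<alpha> (r A) T') \<le> norm (\<alpha> S y) + 1)"
      unfolding dom.near_iff_agree_shift[OF T] using R1(1,2) e0(1)
      by (intro exI[of _ R1] conjI exI[of _ "min e0 e1"]) auto
    have n2: "dom.near T (\<lambda>U. U \<in> A \<and> b A U = b A T)"
      using W(7)[OF A(1)] A(2) dom.near_open[OF W(1)[OF A(1)] A(2)]
      unfolding dom.locally_constant_on_open_iff_near[OF W(1)[OF A(1)]] by (intro dom.near_conj) auto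
    define c where "c = norm (\<alpha> S y) + 1 + snd (s A) + norm (b A T)"
    have "dom.near T (\<lambda>T'. norm (g T') \<le> c)"
    proof (rule dom.near_mono[OF dom.near_conj[OF n1 n2]])
      fix T' assume T': "T' \<in> \<Omega>" "norm (flow_box_primitive \<alpha> (r A) T') \<le> norm (\<alpha> S y) + 1 \<and> T' \<in> A \<and> b A T' = b A T"
      have hb: "h T' \<in> flow_box (fst (s A)) (snd (s A))" using W(6)[OF A(1)] T'(2) by blast
      have "norm (cod.box_coord (s A) (h T')) < snd (s A)"
        using cod.box_coord(1)[OF _ hb] W(5)[OF A(1)] by simp
      then show "norm (g T') \<le> c"
        using g[OF A(1), of T'] T'(2)
          norm_triangle_ineq4[of "flow_box_primitive \<alpha> (r A) T'" "cod.box_coord (s A) (h T')"]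
          norm_triangle_ineq4[of "flow_box_primitive \<alpha> (r A) T' - cod.box_coord (s A) (h T')" "b A T"]
        by (simp add: f_def c_def)
    qed
    then obtain R e where Re: "R > 0" "e > 0" "\<forall>T'\<in>nbd \<Omega> T R e. norm (g T') \<le> c"
      unfolding dom.near_def by blast
    have "c \<ge> 0"
    proof -
      have "snd (s A) > 0" using W(5)[OF A(1)] by (auto simp: open_flow_box_def split: prod.splits)
      then show ?thesis by (simp add: c_def add_nonneg_nonneg)
    qed
    then show ?thesis using Re by auto
  qed
  then obtain R e c where Rec: "\<And>T. T \<in> \<Omega> \<Longrightarrow> R T > 0" "\<And>T. T \<in> \<Omega> \<Longrightarrow> e T > 0" "\<And>T. T \<in> \<Omega> \<Longrightarrow> c T \<ge> (0 :: real)"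
    "\<And>T T'. T \<in> \<Omega> \<Longrightarrow> T' \<in> nbd \<Omega> T (R T) (e T) \<Longrightarrow> norm (g T') \<le> c T"
    by metis
  obtain F where F: "finite F" "F \<subseteq> \<Omega>" "\<Omega> \<subseteq> (\<Union>T\<in>F. nbd \<Omega> T (R T) (e T))"
    using dom.finite_nbd_cover[of R e] Rec(1,2) by blast
  define c0 where "c0 = (\<Sum>T\<in>F. c T)"
  have gb: "norm (g S) \<le> c0" if "S \<in> \<Omega>" for S
  proof -
    obtain T where T: "T \<in> F" "S \<in> nbd \<Omega> T (R T) (e T)" using F(3) \<open>S \<in> \<Omega>\<close> by blast
    have "norm (g S) \<le> c T" using Rec(4)[OF _ T(2)] T(1) F(2) by auto
    also have "c T \<le> c0" unfolding c0_def
      using Rec(3) F(2) by (intro member_le_sum[OF T(1) _ F(1)]) auto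
    finally show ?thesis .
  qed
  have "norm (\<alpha> T v - orbit_cocycle T v) \<le> 2 * c0" if T: "T \<in> \<Omega>" for T v
    using gb[OF T] gb[OF dom.shift_in[OF T, of v]] norm_triangle_ineq4[of "g (shift v T)" "g T"]
    unfolding cob[OF T] by linarith
  then show ?thesis by (rule that)
qed

end


section \<open>Averages of a bounded function over an ergodic action\<close>

text \<open>
  The averages of the translates of \<open>f\<close> that arise by taking midpoints repeatedly. Midpoints suffice
  for the parallelogram argument below.
\<close>

inductive_set translate_averages :: "('g \<Rightarrow> 'a \<Rightarrow> 'a) \<Rightarrow> ('a \<Rightarrow> 'b::real_vector) \<Rightarrow> ('a \<Rightarrow> 'b) set"
  for \<tau> f where
    translate: "(\<lambda>x. f (\<tau> s x)) \<in> translate_averages \<tau> f"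
  | midpoint: "g \<in> translate_averages \<tau> f \<Longrightarrow> g' \<in> translate_averages \<tau> f \<Longrightarrow>
      (\<lambda>x. (1 / 2) *\<^sub>R (g x + g' x)) \<in> translate_averages \<tau> f"

locale ergodic_action = prob_space \<mu> for \<mu> :: "'a measure" +
  fixes \<tau> :: "'g::ab_group_add \<Rightarrow> 'a \<Rightarrow> 'a"
  assumes measurable_action [measurable]: "\<And>s. \<tau> s \<in> measurable \<mu> \<mu>"
    and preserving: "\<And>s. distr \<mu> \<mu> (\<tau> s) = \<mu>"
    and action: "\<And>s t x. x \<in> space \<mu> \<Longrightarrow> \<tau> s (\<tau> t x) = \<tau> (s + t) x"
    and ergodic: "\<And>A. A \<in> sets \<mu> \<Longrightarrow> (\<And>s. AE x in \<mu>. \<tau> s x \<in> A \<longleftrightarrow> x \<in> A) \<Longrightarrow>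
      emeasure \<mu> A = 0 \<or> emeasure \<mu> A = 1"
begin

lemma action_space: "x \<in> space \<mu> \<Longrightarrow> \<tau> s x \<in> space \<mu>"
  using measurable_space[OF measurable_action] by blast

lemma integral_action:
  fixes f :: "'a \<Rightarrow> 'b::{banach, second_countable_topology}"
  assumes "f \<in> borel_measurable \<mu>"
  shows "(\<integral>x. f (\<tau> s x) \<partial>\<mu>) = (\<integral>x. f x \<partial>\<mu>)"
  using integral_distr[OF measurable_action assms, of s] preserving[of s] by simp

lemma AE_action:
  assumes "AE x in \<mu>. P x"
  shows "AE x in \<mu>. P (\<tau> s x)"
proof -
  have "AE x in distr \<mu> \<mu> (\<tau> s). P x" using assms by (simp only: preserving)
  then show ?thesis by (rule AE_distrD[OF measurable_action])
qed

text \<open>An invariant function is constant: the set where it exceeds its mean is invariant, so null or full.\<close>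

lemma invariant_real_constant:
  fixes g :: "'a \<Rightarrow> real"
  assumes g [measurable]: "g \<in> borel_measurable \<mu>" and b: "\<And>x. x \<in> space \<mu> \<Longrightarrow> \<bar>g x\<bar> \<le> B"
    and inv: "\<And>s. AE x in \<mu>. g (\<tau> s x) = g x"
  shows "AE x in \<mu>. g x = (\<integral>x. g x \<partial>\<mu>)"
proof -
  define c where "c = (\<integral>x. g x \<partial>\<mu>)"
  have int: "integrable \<mu> g"
    by (rule integrable_const_bound[where B = B]) (use b in auto)
  define A where "A = {x \<in> space \<mu>. g x > c}"
  have A [measurable]: "A \<in> sets \<mu>" unfolding A_def by measurable
  have "AE x in \<mu>. \<tau> s x \<in> A \<longleftrightarrow> x \<in> A" for s
    using inv[of s] AE_space by eventually_elim (auto simp: A_def action_space)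
  then have "emeasure \<mu> A = 0 \<or> emeasure \<mu> A = 1" by (rule ergodic[OF A])
  then show ?thesis
  proof
    assume "emeasure \<mu> A = 1"
    then have gc: "AE x in \<mu>. x \<in> A" using prob_eq_1[OF A] by (simp add: emeasure_eq_measure)
    have "AE x in \<mu>. 0 \<le> g x - c" using gc by eventually_elim (simp add: A_def)
    moreover have "(\<integral>x. g x - c \<partial>\<mu>) = 0" using int by (simp add: c_def prob_space)
    moreover have "integrable \<mu> (\<lambda>x. g x - c)" using int by simp
    ultimately have "AE x in \<mu>. g x - c = 0" using integral_nonneg_eq_0_iff_AE by blast
    then show ?thesis by (simp add: c_def)
  next
    assume "emeasure \<mu> A = 0"
    then have "AE x in \<mu>. x \<notin> A" using A by (intro AE_not_in null_setsI)
    then have "AE x in \<mu>. 0 \<le> c - g x" using AE_space by eventually_elim (auto simp: A_def)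
    moreover have "(\<integral>x. c - g x \<partial>\<mu>) = 0" using int by (simp add: c_def prob_space)
    moreover have "integrable \<mu> (\<lambda>x. c - g x)" using int by simp
    ultimately have "AE x in \<mu>. c - g x = 0" using integral_nonneg_eq_0_iff_AE by blast
    then show ?thesis by eventually_elim (simp add: c_def)
  qed
qed

lemma invariant_vector_constant:
  fixes g :: "'a \<Rightarrow> 'b::euclidean_space"
  assumes g [measurable]: "g \<in> borel_measurable \<mu>" and b: "\<And>x. x \<in> space \<mu> \<Longrightarrow> norm (g x) \<le> B"
    and inv: "\<And>s. AE x in \<mu>. g (\<tau> s x) = g x"
  shows "AE x in \<mu>. g x = (\<integral>x. g x \<partial>\<mu>)"
proof -
  have int: "integrable \<mu> g"
    by (rule integrable_const_bound[where B = B]) (use b in auto)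
  have "AE x in \<mu>. g x \<bullet> i = (\<integral>x. g x \<bullet> i \<partial>\<mu>)" if "i \<in> Basis" for i
  proof (rule invariant_real_constant[where B = B])
    show "\<bar>g x \<bullet> i\<bar> \<le> B" if "x \<in> space \<mu>" for x
      using Basis_le_norm[OF \<open>i \<in> Basis\<close>, of "g x"] b[OF that] by linarith
    show "AE x in \<mu>. g (\<tau> s x) \<bullet> i = g x \<bullet> i" for s using inv[of s] by eventually_elim simp
  qed simp
  then have "AE x in \<mu>. \<forall>i\<in>Basis. g x \<bullet> i = (\<integral>x. g x \<bullet> i \<partial>\<mu>)"
    by (subst AE_finite_all) auto
  then show ?thesis
  proof eventually_elim
    case (elim x)
    show ?case
    proof (rule euclidean_eqI)
      fix i :: 'b assume "i \<in> Basis"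
      then show "g x \<bullet> i = (\<integral>x. g x \<partial>\<mu>) \<bullet> i"
        using elim integral_inner_left[of i, OF int] by simp
    qed
  qed
qed

lemma translate_average:
  fixes f :: "'a \<Rightarrow> 'b::euclidean_space"
  assumes f [measurable]: "f \<in> borel_measurable \<mu>" and b: "\<And>x. x \<in> space \<mu> \<Longrightarrow> norm (f x) \<le> B"
    and g: "g \<in> translate_averages \<tau> f"
  shows "g \<in> borel_measurable \<mu>" "\<And>x. x \<in> space \<mu> \<Longrightarrow> norm (g x) \<le> B"
    "(\<integral>x. g x \<partial>\<mu>) = (\<integral>x. f x \<partial>\<mu>)"
proof -
  from g have "g \<in> borel_measurable \<mu> \<and> (\<forall>x\<in>space \<mu>. norm (g x) \<le> B) \<and> (\<integral>x. g x \<partial>\<mu>) = (\<integral>x. f x \<partial>\<mu>)"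
  proof induction
    case (translate s)
    then show ?case using b action_space integral_action[OF f] by auto
  next
    case (midpoint g g')
    then have [measurable]: "g \<in> borel_measurable \<mu>" "g' \<in> borel_measurable \<mu>" by auto
    have "integrable \<mu> g" "integrable \<mu> g'"
      using midpoint by (auto intro!: integrable_const_bound[where B = B])
    moreover have "norm ((1 / 2) *\<^sub>R (g x + g' x)) \<le> B" if "x \<in> space \<mu>" for x
    proof -
      have "norm (g x + g' x) \<le> B + B" using midpoint that by (intro norm_triangle_mono) auto
      then show ?thesis by simp
    qed
    ultimately show ?case using midpoint
      by (auto simp: scaleR_2[symmetric])
  qed
  then show "g \<in> borel_measurable \<mu>" "\<And>x. x \<in> space \<mu> \<Longrightarrow> norm (g x) \<le> B"
    "(\<integral>x. g x \<partial>\<mu>) = (\<integral>x. f x \<partial>\<mu>)" by auto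
qed

text \<open>
  Averages of almost minimal \<open>L\<^sup>2\<close> norm are close to each other by the parallelogram law, since their
  midpoint is an average too. A rapidly minimising sequence therefore converges almost everywhere,
  and its translates have the same limit: the limit is invariant.
\<close>

lemma averages_tendsto_mean:
  fixes f :: "'a \<Rightarrow> 'b::euclidean_space"
  assumes f [measurable]: "f \<in> borel_measurable \<mu>" and b: "\<And>x. x \<in> space \<mu> \<Longrightarrow> norm (f x) \<le> B"
    and "\<epsilon> > 0"
  obtains g where "g \<in> translate_averages \<tau> f" "(\<integral>x. norm (g x - (\<integral>x. f x \<partial>\<mu>)) \<partial>\<mu>) < \<epsilon>"
proof -
  let ?K = "translate_averages \<tau> f"
  have Km: "g \<in> borel_measurable \<mu>" and Kb: "\<And>x. x \<in> space \<mu> \<Longrightarrow> norm (g x) \<le> B"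
    and Ki: "(\<integral>x. g x \<partial>\<mu>) = (\<integral>x. f x \<partial>\<mu>)" if "g \<in> ?K" for g
    using translate_average[OF f _ that, of B] b by blast+
  have "B \<ge> 0"
  proof -
    obtain x where "x \<in> space \<mu>" using not_empty by blast
    then show ?thesis using b[of x] norm_ge_zero[of "f x"] by linarith
  qed
  have Kshift: "\<exists>g'\<in>?K. \<forall>x\<in>space \<mu>. g' x = g (\<tau> s x)" if "g \<in> ?K" for g s
    using that
  proof induction
    case (translate t)
    show ?case
      by (intro bexI[OF _ translate_averages.translate[of f \<tau> "t + s"]]) (simp add: action)
  next
    case (midpoint g1 g2)
    then obtain h1 h2 where "h1 \<in> ?K" "h2 \<in> ?K"
      "\<forall>x\<in>space \<mu>. h1 x = g1 (\<tau> s x)" "\<forall>x\<in>space \<mu>. h2 x = g2 (\<tau> s x)" by blast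
    then show ?case by (intro bexI[OF _ translate_averages.midpoint[of h1 \<tau> f h2]]) auto
  qed
  define N where "N g = (\<integral>x. (norm (g x))\<^sup>2 \<partial>\<mu>)" for g :: "'a \<Rightarrow> 'b"
  define m where "m = Inf (N ` ?K)"
  have "(\<lambda>x. f (\<tau> 0 x)) \<in> ?K" by (rule translate_averages.translate)
  then have ne: "N ` ?K \<noteq> {}" by blast
  have bdd: "bdd_below (N ` ?K)" by (rule bdd_belowI2[of _ 0]) (simp add: N_def)
  have m: "m \<le> N g" if "g \<in> ?K" for g
    unfolding m_def using bdd that by (intro cInf_lower) auto
  have int2: "integrable \<mu> (\<lambda>x. (norm (g x))\<^sup>2)"
    if "g \<in> borel_measurable \<mu>" "\<And>x. x \<in> space \<mu> \<Longrightarrow> norm (g x) \<le> C" for g :: "'a \<Rightarrow> 'b" and C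
    using that by (intro integrable_const_bound[where B = "C\<^sup>2"]) (auto intro!: power_mono)
  have bd: "norm (g x - g' x) \<le> 2 * B" if "g \<in> ?K" "g' \<in> ?K" "x \<in> space \<mu>" for g g' x
    using norm_triangle_ineq4[of "g x" "g' x"] Kb[OF that(1,3)] Kb[OF that(2,3)] by linarith
  have parallelogram: "N (\<lambda>x. g x - g' x) \<le> 2 * (N g - m) + 2 * (N g' - m)" if "g \<in> ?K" "g' \<in> ?K" for g g'
  proof -
    note [measurable] = Km[OF that(1)] Km[OF that(2)]
    have mid: "(\<lambda>x. (1 / 2) *\<^sub>R (g x + g' x)) \<in> ?K" using that by (rule translate_averages.midpoint)
    have "N (\<lambda>x. g x - g' x) = (\<integral>x. 2 * (norm (g x))\<^sup>2 + 2 * (norm (g' x))\<^sup>2 -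
        4 * (norm ((1 / 2) *\<^sub>R (g x + g' x)))\<^sup>2 \<partial>\<mu>)"
      unfolding N_def
    proof (rule Bochner_Integration.integral_cong[OF refl])
      fix x
      show "(norm (g x - g' x))\<^sup>2 = 2 * (norm (g x))\<^sup>2 + 2 * (norm (g' x))\<^sup>2 -
        4 * (norm ((1 / 2) *\<^sub>R (g x + g' x)))\<^sup>2"
        by (simp add: power2_norm_eq_inner inner_diff_left inner_diff_right inner_add_left inner_add_right
            power_mult_distrib inner_commute algebra_simps power_divide)
    qed
    also have "\<dots> = 2 * N g + 2 * N g' - 4 * N (\<lambda>x. (1 / 2) *\<^sub>R (g x + g' x))"
      unfolding N_def
      using int2[OF Km[OF that(1)] Kb[OF that(1)]] int2[OF Km[OF that(2)] Kb[OF that(2)]] int2[OF Km[OF mid] Kb[OF mid]]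
      by (simp del: norm_scaleR)
    finally show ?thesis using m[OF mid] by simp
  qed
  \<comment> \<open>With excess at most \<open>16\<^sup>-\<^sup>n\<close> the successive distances are summable.\<close>
  have "\<exists>g\<in>?K. N g < m + (1 / 16) ^ n" for n
  proof -
    have "m < m + (1 / 16) ^ n" by simp
    then show ?thesis unfolding m_def using cInf_lessD[OF ne] by (metis imageE)
  qed
  then obtain G where G: "\<And>n. G n \<in> ?K" "\<And>n. N (G n) < m + (1 / 16) ^ n" by metis
  note [measurable] = Km[OF G(1)]
  have L1: "(\<integral>x. norm (g x - g' x) \<partial>\<mu>) \<le> 2 * (1 / 4) ^ n"
    if "g \<in> ?K" "g' \<in> ?K" "N g \<le> m + (1 / 16) ^ n" "N g' \<le> m + (1 / 16) ^ n" for g g' n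
  proof -
    note [measurable] = Km[OF that(1)] Km[OF that(2)]
    have bb: "integrable \<mu> (\<lambda>x. norm (g x - g' x))"
      using bd[OF that(1,2)] by (intro integrable_const_bound[where B = "2 * B"]) auto
    have i2: "integrable \<mu> (\<lambda>x. (norm (g x - g' x))\<^sup>2)"
      by (rule int2[of _ "2 * B"]) (use bd[OF that(1,2)] in auto)
    have "0 \<le> variance (\<lambda>x. norm (g x - g' x))" by (rule variance_positive)
    then have "(\<integral>x. norm (g x - g' x) \<partial>\<mu>)\<^sup>2 \<le> N (\<lambda>x. g x - g' x)"
      using variance_eq[OF bb i2] by (simp add: N_def)
    also have "\<dots> \<le> 4 * (1 / 16) ^ n" using parallelogram[OF that(1,2)] that(3,4) by simp
    also have "\<dots> = (2 * (1 / 4) ^ n)\<^sup>2"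
      by (simp add: power_mult_distrib power2_eq_square flip: power_mult_distrib)
    finally show ?thesis by (rule power2_le_imp_le) simp
  qed
  have AEsum: "AE x in \<mu>. summable (\<lambda>n. norm (g n x - g' n x))"
    if "\<And>n. g n \<in> ?K" "\<And>n. g' n \<in> ?K" "\<And>n. N (g n) \<le> m + (1 / 16) ^ n" "\<And>n. N (g' n) \<le> m + (1 / 16) ^ n" for g g'
  proof -
    note [measurable] = Km[OF that(1)] Km[OF that(2)]
    have bb: "integrable \<mu> (\<lambda>x. norm (g n x - g' n x))" for n
      using bd[OF that(1,2)] by (intro integrable_const_bound[where B = "2 * B"]) auto
    have "(\<integral>\<^sup>+x. (\<Sum>n. ennreal (norm (g n x - g' n x))) \<partial>\<mu>) = (\<Sum>n. \<integral>\<^sup>+x. ennreal (norm (g n x - g' n x)) \<partial>\<mu>)"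
      by (rule nn_integral_suminf) measurable
    also have "\<dots> = (\<Sum>n. ennreal (\<integral>x. norm (g n x - g' n x) \<partial>\<mu>))"
      using bb by (simp add: nn_integral_eq_integral)
    also have "\<dots> \<le> (\<Sum>n. ennreal (2 * (1 / 4) ^ n))"
      using L1[OF that] by (intro suminf_le ennreal_leI) auto
    also have "\<dots> = ennreal (\<Sum>n. 2 * (1 / 4) ^ n)"
      by (intro suminf_ennreal2 summable_mult summable_geometric) auto
    finally have fin: "(\<integral>\<^sup>+x. (\<Sum>n. ennreal (norm (g n x - g' n x))) \<partial>\<mu>) \<noteq> \<infinity>"
      by (auto simp: top_unique)
    have "AE x in \<mu>. (\<Sum>n. ennreal (norm (g n x - g' n x))) \<noteq> \<infinity>"
      by (rule nn_integral_PInf_AE[OF _ fin]) measurable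
    then show ?thesis
    proof eventually_elim
      case (elim x)
      then show ?case by (intro summable_suminf_not_top) auto
    qed
  qed
  have G': "N (G n) \<le> m + (1 / 16) ^ n" "N (G (Suc n)) \<le> m + (1 / 16) ^ n" for n
  proof -
    show "N (G n) \<le> m + (1 / 16) ^ n" using G(2)[of n] by simp
    have "(1 / 16 :: real) ^ Suc n \<le> (1 / 16) ^ n" by (intro power_decreasing) auto
    then show "N (G (Suc n)) \<le> m + (1 / 16) ^ n" using G(2)[of "Suc n"] by linarith
  qed
  define g where "g x = lim (\<lambda>n. G n x)" for x
  have conv: "AE x in \<mu>. (\<lambda>n. G n x) \<longlonglongrightarrow> g x"
  proof -
    have "AE x in \<mu>. summable (\<lambda>n. norm (G (Suc n) x - G n x))" by (rule AEsum) (use G(1) G' in auto)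
    then show ?thesis
    proof eventually_elim
      case (elim x)
      then have "summable (\<lambda>n. G (Suc n) x - G n x)" by (rule summable_norm_cancel)
      then have "convergent (\<lambda>n. \<Sum>i<n. G (Suc i) x - G i x)" by (simp add: summable_iff_convergent)
      then have "convergent (\<lambda>n. G n x - G 0 x)" 
        by (simp only: sum_lessThan_telescope[of "\<lambda>i. G i x"])
      then have "convergent (\<lambda>n. (G n x - G 0 x) + G 0 x)" by (intro convergent_add convergent_const)
      then show ?case by (simp add: g_def convergent_LIMSEQ_iff)
    qed
  qed
  have gm [measurable]: "g \<in> borel_measurable \<mu>" unfolding g_def by (rule borel_measurable_lim_metric) measurable
  have inv: "AE x in \<mu>. g (\<tau> s x) = g x" for s
  proof -
    have "\<forall>n. \<exists>g'\<in>?K. \<forall>x\<in>space \<mu>. g' x = G n (\<tau> s x)" using Kshift[OF G(1)] by blast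
    then obtain H where H: "\<And>n. H n \<in> ?K" "\<And>n x. x \<in> space \<mu> \<Longrightarrow> H n x = G n (\<tau> s x)" by metis
    have "N (H n) = N (G n)" for n
    proof -
      have "N (H n) = (\<integral>x. (norm (G n (\<tau> s x)))\<^sup>2 \<partial>\<mu>)"
        unfolding N_def by (rule Bochner_Integration.integral_cong) (simp_all add: H(2))
      also have "\<dots> = N (G n)" unfolding N_def by (rule integral_action) measurable
      finally show ?thesis .
    qed
    then have "AE x in \<mu>. summable (\<lambda>n. norm (H n x - G n x))" by (intro AEsum) (use H(1) G(1) G' in auto)
    moreover have "AE x in \<mu>. (\<lambda>n. G n (\<tau> s x)) \<longlonglongrightarrow> g (\<tau> s x)"
      by (rule AE_action[OF conv])
    ultimately show ?thesis using conv AE_space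
    proof eventually_elim
      case (elim x)
      have "(\<lambda>n. norm (H n x - G n x)) \<longlonglongrightarrow> 0" using elim(1) by (rule summable_LIMSEQ_zero)
      then have "(\<lambda>n. H n x - G n x) \<longlonglongrightarrow> 0" by (rule tendsto_norm_zero_cancel)
      moreover have "(\<lambda>n. H n x - G n x) \<longlonglongrightarrow> g (\<tau> s x) - g x"
        using elim by (simp add: H(2)) (intro tendsto_diff; simp)
      ultimately have "g (\<tau> s x) - g x = 0" by (rule LIMSEQ_unique[symmetric])
      then show ?case by simp
    qed
  qed
  \<comment> \<open>The bound on the limit holds almost everywhere; the cutoff makes it hold everywhere.\<close>
  define g1 where "g1 x = (if norm (g x) \<le> B then g x else 0)" for x
  have g1m [measurable]: "g1 \<in> borel_measurable \<mu>" unfolding g1_def by measurable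
  have "AE x in \<mu>. norm (g x) \<le> B"
    using conv AE_space
  proof eventually_elim
    case (elim x)
    show ?case by (rule LIMSEQ_le_const2[OF tendsto_norm[OF elim(1)]]) (use Kb[OF G(1) elim(2)] in auto)
  qed
  then have gg1: "AE x in \<mu>. g1 x = g x" by eventually_elim (simp add: g1_def)
  have "AE x in \<mu>. g1 (\<tau> s x) = g1 x" for s
    using inv[of s] by eventually_elim (simp add: g1_def)
  then have const: "AE x in \<mu>. g1 x = (\<integral>x. g1 x \<partial>\<mu>)"
    by (intro invariant_vector_constant[where B = B]) (auto simp: g1_def \<open>B \<ge> 0\<close>)
  have conv1: "AE x in \<mu>. (\<lambda>n. G n x) \<longlonglongrightarrow> g1 x" using conv gg1 by eventually_elim simp
  have "(\<lambda>n. \<integral>x. G n x \<partial>\<mu>) \<longlonglongrightarrow> (\<integral>x. g1 x \<partial>\<mu>)"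
    by (rule integral_dominated_convergence[where w = "\<lambda>_. B"])
      (use conv1 Kb[OF G(1)] in auto)
  then have mean: "(\<integral>x. g1 x \<partial>\<mu>) = (\<integral>x. f x \<partial>\<mu>)" by (simp add: Ki[OF G(1)] LIMSEQ_const_iff)
  let ?c = "\<integral>x. f x \<partial>\<mu>"
  have "(\<lambda>n. \<integral>x. norm (G n x - ?c) \<partial>\<mu>) \<longlonglongrightarrow> (\<integral>x. 0 \<partial>\<mu>)"
  proof (rule integral_dominated_convergence[where w = "\<lambda>_. B + norm ?c"])
    show "AE x in \<mu>. (\<lambda>n. norm (G n x - ?c)) \<longlonglongrightarrow> 0"
      using conv1 const
    proof eventually_elim
      case (elim x)
      then have "(\<lambda>n. norm (G n x - ?c)) \<longlonglongrightarrow> norm (?c - ?c)"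
        using mean by (intro tendsto_intros) simp
      then show ?case by simp
    qed
    show "AE x in \<mu>. norm (norm (G n x - ?c)) \<le> B + norm ?c" for n
      using AE_space
    proof eventually_elim
      case (elim x)
      then show ?case using norm_triangle_ineq4[of "G n x" ?c] Kb[OF G(1)[of n], of x] by simp
    qed
  qed auto
  then have "\<forall>\<^sub>F n in sequentially. (\<integral>x. norm (G n x - ?c) \<partial>\<mu>) < \<epsilon>"
    using \<open>\<epsilon> > 0\<close> by (intro order_tendstoD(2)) auto
  then obtain n where "(\<integral>x. norm (G n x - ?c) \<partial>\<mu>) < \<epsilon>"
    using eventually_happens trivial_limit_sequentially by blast
  then show ?thesis using that G(1) by blast
qed

end


section \<open>Unique ergodicity and growth of cocycles\<close>

lemma (in flc_space) continuous_shift: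
  "continuous_map (space_topology \<Omega>) (space_topology \<Omega>) (shift x)"
  unfolding continuous_map_def
proof (intro conjI allI impI)
  fix U assume U: "openin (space_topology \<Omega>) U"
  have "\<exists>R>0. \<exists>e>0. nbd \<Omega> T R e \<subseteq> {T \<in> \<Omega>. shift x T \<in> U}" if T: "T \<in> \<Omega>" "shift x T \<in> U" for T
  proof -
    obtain R e where R: "R > 0" "e > 0" "nbd \<Omega> (shift x T) R e \<subseteq> U"
      using U T(2) unfolding openin_iff_nbd by blast
    have "nbd \<Omega> T (norm x + R) e \<subseteq> {T \<in> \<Omega>. shift x T \<in> U}"
    proof
      fix S assume "S \<in> nbd \<Omega> T (norm x + R) e"
      then obtain z where z: "S \<in> \<Omega>" "norm z < e" "agree (norm x + R) S (shift z T)" by (auto simp: nbd_def)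
      have "agree R (shift x S) (shift x (shift z T))" by (rule agree_shift[OF z(3)]) simp
      then have "shift x S \<in> nbd \<Omega> (shift x T) R e"
        using z by (intro nbdI[of _ _ z]) (auto simp: add.commute)
      then show "S \<in> {T \<in> \<Omega>. shift x T \<in> U}" using R(3) z(1) by blast
    qed
    moreover have "norm x + R > 0" using R(1) by (simp add: add_nonneg_pos)
    ultimately show ?thesis using R(2) by blast
  qed
  then show "openin (space_topology \<Omega>) {T \<in> topspace (space_topology \<Omega>). shift x T \<in> U}"
    by (auto simp: openin_iff_nbd)
qed auto

text \<open>
  If \<open>A\<close> is invariant up to null sets and not null, conditioning on \<open>A\<close> gives an invariant probability
  measure, which must be \<open>\<mu>\<close>.
\<close>

lemma (in flc_space) ergodic_action_shift:
  assumes \<mu>: "uniquely_ergodic \<Omega> \<mu>"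
  shows "ergodic_action \<mu> shift"
proof -
  have inv: "invariant_prob \<Omega> \<mu>" and unique: "\<And>\<nu>. invariant_prob \<Omega> \<nu> \<Longrightarrow> \<nu> = \<mu>"
    using \<mu> by (auto simp: uniquely_ergodic_def)
  interpret prob_space \<mu> using inv by (simp add: invariant_prob_def)
  have sp: "space \<mu> = \<Omega>" and st: "sets \<mu> = sigma_sets \<Omega> {U. openin (space_topology \<Omega>) U}"
    and pres: "\<And>A x. A \<in> sets \<mu> \<Longrightarrow> emeasure \<mu> (shift x ` A) = emeasure \<mu> A"
    using inv by (auto simp: invariant_prob_def)
  have meas: "shift s \<in> measurable \<mu> \<mu>" for s
  proof (rule measurable_sigma_sets[OF st])
    show "{U. openin (space_topology \<Omega>) U} \<subseteq> Pow \<Omega>" using openin_subset by fastforce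
    show "shift s \<in> space \<mu> \<rightarrow> \<Omega>" by (simp add: sp)
    fix U assume "U \<in> {U. openin (space_topology \<Omega>) U}"
    then have "openin (space_topology \<Omega>) {T \<in> topspace (space_topology \<Omega>). shift s T \<in> U}"
      using continuous_shift by (intro openin_continuous_map_preimage) auto
    moreover have "shift s -` U \<inter> space \<mu> = {T \<in> topspace (space_topology \<Omega>). shift s T \<in> U}"
      by (auto simp: sp)
    ultimately show "shift s -` U \<inter> space \<mu> \<in> sets \<mu>" by (auto simp: st)
  qed
  have image_eq: "shift s ` A = shift (- s) -` A \<inter> space \<mu>" if "A \<in> sets \<mu>" for A s
  proof -
    have "A \<subseteq> \<Omega>" using sets.sets_into_space[OF that] sp by simp
    then have "T \<in> shift s ` A" if "shift (- s) T \<in> A" for T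
      using that by (intro image_eqI[of _ _ "shift (- s) T"]) auto
    then show ?thesis using \<open>A \<subseteq> \<Omega>\<close> by (auto simp: sp)
  qed
  have image_sets: "shift s ` A \<in> sets \<mu>" if "A \<in> sets \<mu>" for A s
    unfolding image_eq[OF that] using meas that by (rule measurable_sets)
  show ?thesis
  proof
    show "distr \<mu> \<mu> (shift s) = \<mu>" for s
    proof (rule measure_eqI)
      fix A assume "A \<in> sets (distr \<mu> \<mu> (shift s))"
      then have A: "A \<in> sets \<mu>" by simp
      have "emeasure (distr \<mu> \<mu> (shift s)) A = emeasure \<mu> (shift (- s) ` A)"
        using emeasure_distr[OF meas A] image_eq[OF A, of "- s"] by simp
      then show "emeasure (distr \<mu> \<mu> (shift s)) A = emeasure \<mu> A" using pres[OF A] by simp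
    qed simp
  next
    fix A assume A: "A \<in> sets \<mu>" and invA: "\<And>s. AE T in \<mu>. shift s T \<in> A \<longleftrightarrow> T \<in> A"
    show "emeasure \<mu> A = 0 \<or> emeasure \<mu> A = 1"
    proof (cases "emeasure \<mu> A = 0")
      case nz: False
      have fin: "emeasure \<mu> A \<noteq> \<infinity>" by simp
      let ?\<nu> = "uniform_measure \<mu> A"
      have "emeasure ?\<nu> (shift x ` B) = emeasure ?\<nu> B" if "B \<in> sets ?\<nu>" for B x
      proof -
        have B: "B \<in> sets \<mu>" using that by simp
        have "emeasure \<mu> (A \<inter> shift x ` B) = emeasure \<mu> (shift x ` (A \<inter> B))"
        proof (rule emeasure_eq_AE)
          show "AE T in \<mu>. T \<in> A \<inter> shift x ` B \<longleftrightarrow> T \<in> shift x ` (A \<inter> B)"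
            using invA[of "- x"] AE_space
            by eventually_elim (simp add: image_eq A B sets.Int)
        qed (use A B image_sets in auto)
        then show ?thesis using A B pres[of "A \<inter> B" x] image_sets[OF B] by simp
      qed
      then have "invariant_prob \<Omega> ?\<nu>"
        using prob_space_uniform_measure[OF nz fin] by (simp add: invariant_prob_def sp st)
      then have "?\<nu> = \<mu>" by (rule unique)
      then have "emeasure \<mu> A = emeasure ?\<nu> A" by simp
      also have "\<dots> = 1" by (rule emeasure_uniform_measure_1[OF nz fin])
      finally show ?thesis by simp
    qed simp
  qed (use meas in auto)
qed

text \<open>
  The deviation \<open>f (r x) - r f x\<close> from homogeneity is additive in \<open>r\<close> and vanishes on the integers; so
  it is bounded, and a bounded additive function is zero.
\<close>

lemma additive_bounded_imp_linear:
  fixes f :: "'a::real_normed_vector \<Rightarrow> 'b::real_normed_vector"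
  assumes add: "\<And>x y. f (x + y) = f x + f y"
    and bdd: "\<And>r. \<exists>B. \<forall>x. norm x \<le> r \<longrightarrow> norm (f x) \<le> B"
  shows "linear f"
proof (rule linearI[OF add])
  fix c :: real and x
  define g where "g r = f (r *\<^sub>R x) - r *\<^sub>R f x" for r
  have gadd: "g (r + s) = g r + g s" for r s
    by (simp add: g_def scaleR_left_distrib add)
  have gmult: "g (real n * r) = real n *\<^sub>R g r" for n r
  proof (induction n)
    case 0
    show ?case using gadd[of 0 0] by simp
  next
    case (Suc n)
    have "g (real (Suc n) * r) = g (real n * r + r)" by (simp add: algebra_simps)
    then show ?case using Suc by (simp add: gadd scaleR_left_distrib)
  qed
  have "g 1 = 0" by (simp add: g_def)
  then have gnat: "g (real n) = 0" for n using gmult[of n 1] by simp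
  have "g (- r) = - g r" for r using gadd[of r "- r"] gadd[of 0 0] by (simp add: eq_neg_iff_add_eq_0 add.commute)
  then have gint: "g (of_int k) = 0" for k
    using gnat by (cases k rule: int_cases2) simp_all
  obtain B where B: "\<And>y. norm y \<le> norm x \<Longrightarrow> norm (f y) \<le> B" using bdd by blast
  have bound: "norm (g r) \<le> B + norm (f x)" for r
  proof -
    have "g r = g (frac r)" using gadd[of "of_int \<lfloor>r\<rfloor>" "frac r"] gint by (simp add: frac_def)
    moreover have "norm (f (frac r *\<^sub>R x)) \<le> B"
      by (rule B) (use frac_lt_1[of r] in \<open>simp add: mult_left_le_one_le less_imp_le\<close>)
    moreover have "norm (frac r *\<^sub>R f x) \<le> norm (f x)"
      using frac_lt_1[of r] by (simp add: mult_left_le_one_le less_imp_le)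
    ultimately show ?thesis
      using norm_triangle_ineq4[of "f (frac r *\<^sub>R x)" "frac r *\<^sub>R f x"] by (simp add: g_def)
  qed
  have "norm (g c) \<le> 0"
  proof (rule ccontr)
    assume "\<not> norm (g c) \<le> 0"
    then obtain n where "real n * norm (g c) > B + norm (f x)"
      using reals_Archimedean3[of "norm (g c)"] by auto
    then show False using bound[of "real n * c"] gmult[of n c] by simp
  qed
  then show "f (c *\<^sub>R x) = c *\<^sub>R f x" by (simp add: g_def)
qed

lemma (in flc_space) strong_cocycle_bounded:
  assumes "strong_cocycle \<Omega> \<alpha>"
  obtains B where "\<And>T v. T \<in> \<Omega> \<Longrightarrow> norm v \<le> r \<Longrightarrow> norm (\<alpha> T v) \<le> B"
proof -
  have "compactin (space_topology \<Omega>) \<Omega>"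
    using tiling_space by (simp add: tiling_space_def compactin_subtopology)
  then have "compactin (prod_topology (space_topology \<Omega>) euclidean) (\<Omega> \<times> cball (0 :: real ^ 'd) r)"
    by (simp add: compactin_Times)
  moreover have "continuous_map (prod_topology (space_topology \<Omega>) euclidean) euclidean (\<lambda>(T, x). \<alpha> T x)"
    using assms unfolding strong_cocycle_def by blast
  ultimately have "compactin euclidean ((\<lambda>(T, x). \<alpha> T x) ` (\<Omega> \<times> cball (0 :: real ^ 'd) r))"
    by (rule image_compactin)
  then have "bounded ((\<lambda>(T, x). \<alpha> T x) ` (\<Omega> \<times> cball (0 :: real ^ 'd) r))" by (simp add: compact_imp_bounded)
  then obtain B where B: "\<And>y. y \<in> (\<lambda>(T, x). \<alpha> T x) ` (\<Omega> \<times> cball (0 :: real ^ 'd) r) \<Longrightarrow> norm y \<le> B"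
    unfolding bounded_iff by blast
  show ?thesis by (rule that[of B]) (auto intro!: B)
qed

lemma (in flc_space) strong_cocycle_measurable:
  assumes \<alpha>: "strong_cocycle \<Omega> \<alpha>" and \<mu>: "invariant_prob \<Omega> \<mu>"
  shows "(\<lambda>T. \<alpha> T v) \<in> borel_measurable \<mu>"
proof (rule borel_measurableI)
  have sp: "space \<mu> = \<Omega>" and st: "sets \<mu> = sigma_sets \<Omega> {U. openin (space_topology \<Omega>) U}"
    using \<mu> by (auto simp: invariant_prob_def)
  have "continuous_map (space_topology \<Omega>) (prod_topology (space_topology \<Omega>) euclidean) (\<lambda>T. (T, v))"
    by (simp add: continuous_map_paired)
  moreover have "continuous_map (prod_topology (space_topology \<Omega>) euclidean) euclidean (\<lambda>(T, x). \<alpha> T x)"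
    using \<alpha> by (simp add: strong_cocycle_def)
  ultimately have "continuous_map (space_topology \<Omega>) euclidean ((\<lambda>(T, x). \<alpha> T x) \<circ> (\<lambda>T. (T, v)))"
    by (rule continuous_map_compose)
  then have c: "continuous_map (space_topology \<Omega>) euclidean (\<lambda>T. \<alpha> T v)" by (simp add: o_def)
  fix S :: "(real ^ 'd) set" assume "open S"
  then have "openin (space_topology \<Omega>) {T \<in> topspace (space_topology \<Omega>). \<alpha> T v \<in> S}"
    by (intro openin_continuous_map_preimage[OF c]) simp
  moreover have "(\<lambda>T. \<alpha> T v) -` S \<inter> space \<mu> = {T \<in> topspace (space_topology \<Omega>). \<alpha> T v \<in> S}"
    by (auto simp: sp)
  ultimately show "(\<lambda>T. \<alpha> T v) -` S \<inter> space \<mu> \<in> sets \<mu>" by (auto simp: st)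
qed

text \<open>
  Along \<open>T, T - v, \<dots>, T - (L - 1) v\<close> the values of the translate \<open>\<alpha>(\<cdot> - s, v)\<close> add up to \<open>\<alpha>(T - s, L v)\<close>,
  which differs from \<open>\<alpha>(T, L v)\<close> by \<open>\<alpha>(T - L v, s) - \<alpha>(T, s)\<close>. This is bounded independently of \<open>L\<close>.
\<close>

lemma (in flc_space) sum_translate_average:
  assumes \<alpha>: "strong_cocycle \<Omega> \<alpha>" and g: "g \<in> translate_averages shift (\<lambda>T. \<alpha> T v)"
  obtains D where "\<And>T L. T \<in> \<Omega> \<Longrightarrow> norm ((\<Sum>k<L. g (shift (real k *\<^sub>R v) T)) - \<alpha> T (real L *\<^sub>R v)) \<le> D"
proof -
  note add = strong_cocycleD(1)[OF \<alpha>]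
  have tele: "(\<Sum>k<L. \<alpha> (shift (real k *\<^sub>R v) T) v) = \<alpha> T (real L *\<^sub>R v)" if "T \<in> \<Omega>" for T L
  proof (induction L)
    case 0
    show ?case using add[OF that, of 0 0] by simp
  next
    case (Suc L)
    have "\<alpha> T (real (Suc L) *\<^sub>R v) = \<alpha> T (real L *\<^sub>R v + v)"
      by (simp add: scaleR_left_distrib add.commute)
    then show ?case using Suc add[OF that, of "real L *\<^sub>R v" v] by simp
  qed
  have "\<exists>D. \<forall>T\<in>\<Omega>. \<forall>L. norm ((\<Sum>k<L. g (shift (real k *\<^sub>R v) T)) - \<alpha> T (real L *\<^sub>R v)) \<le> D"
    using g
  proof induction
    case (translate s)
    obtain B where B: "\<And>T u. T \<in> \<Omega> \<Longrightarrow> norm u \<le> norm s \<Longrightarrow> norm (\<alpha> T u) \<le> B"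
      using strong_cocycle_bounded[OF \<alpha>] by blast
    have "norm ((\<Sum>k<L. \<alpha> (shift s (shift (real k *\<^sub>R v) T)) v) - \<alpha> T (real L *\<^sub>R v)) \<le> 2 * B"
      if T: "T \<in> \<Omega>" for T L
    proof -
      have "(\<Sum>k<L. \<alpha> (shift s (shift (real k *\<^sub>R v) T)) v) = \<alpha> (shift s T) (real L *\<^sub>R v)"
        using tele[of "shift s T" L] T by (simp add: add.commute)
      moreover have "\<alpha> T s + \<alpha> (shift s T) (real L *\<^sub>R v) = \<alpha> T (real L *\<^sub>R v) + \<alpha> (shift (real L *\<^sub>R v) T) s"
        using add[OF T, of s "real L *\<^sub>R v"] add[OF T, of "real L *\<^sub>R v" s] by (simp add: add.commute)
      ultimately have "(\<Sum>k<L. \<alpha> (shift s (shift (real k *\<^sub>R v) T)) v) - \<alpha> T (real L *\<^sub>R v) =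
          \<alpha> (shift (real L *\<^sub>R v) T) s - \<alpha> T s"
        by (simp add: algebra_simps)
      then show ?thesis
        using norm_triangle_ineq4[of "\<alpha> (shift (real L *\<^sub>R v) T) s" "\<alpha> T s"] B[OF T, of s] B[of "shift (real L *\<^sub>R v) T" s] T
        by simp
    qed
    then show ?case by blast
  next
    case (midpoint g g')
    obtain D D' where D: "\<And>T L. T \<in> \<Omega> \<Longrightarrow> norm ((\<Sum>k<L. g (shift (real k *\<^sub>R v) T)) - \<alpha> T (real L *\<^sub>R v)) \<le> D"
      "\<And>T L. T \<in> \<Omega> \<Longrightarrow> norm ((\<Sum>k<L. g' (shift (real k *\<^sub>R v) T)) - \<alpha> T (real L *\<^sub>R v)) \<le> D'"
      using midpoint.IH by blast
    have "norm ((\<Sum>k<L. (1 / 2) *\<^sub>R (g (shift (real k *\<^sub>R v) T) + g' (shift (real k *\<^sub>R v) T))) - \<alpha> T (real L *\<^sub>R v))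
        \<le> (D + D') / 2" if T: "T \<in> \<Omega>" for T L
    proof -
      let ?a = "(\<Sum>k<L. g (shift (real k *\<^sub>R v) T)) - \<alpha> T (real L *\<^sub>R v)"
      let ?b = "(\<Sum>k<L. g' (shift (real k *\<^sub>R v) T)) - \<alpha> T (real L *\<^sub>R v)"
      have "?a + ?b = (\<Sum>k<L. g (shift (real k *\<^sub>R v) T) + g' (shift (real k *\<^sub>R v) T)) - 2 *\<^sub>R \<alpha> T (real L *\<^sub>R v)"
        by (simp add: sum.distrib scaleR_2)
      then have "(\<Sum>k<L. (1 / 2) *\<^sub>R (g (shift (real k *\<^sub>R v) T) + g' (shift (real k *\<^sub>R v) T))) - \<alpha> T (real L *\<^sub>R v)
          = (1 / 2) *\<^sub>R (?a + ?b)"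
        by (simp only: scaleR_sum_right[symmetric]) (simp add: scaleR_diff_right)
      moreover have "norm (?a + ?b) \<le> D + D'" by (rule norm_triangle_mono[OF D(1)[OF T] D(2)[OF T]])
      ultimately show ?thesis by simp
    qed
    then show ?case by blast
  qed
  then show ?thesis using that by blast
qed

text \<open>
  If the mean of \<open>\<alpha>(\<cdot>, v)\<close> vanishes, some average \<open>g\<close> of its translates has small \<open>L\<^sup>1\<close> norm, so that for
  every \<open>L\<close> there is a \<open>T\<close> at which the sum of \<open>g\<close> along \<open>L\<close> steps is small compared to \<open>L\<close>. Then
  \<open>\<alpha>(T, L v)\<close> is small compared to \<open>L\<close> as well, against the linear lower bound.
\<close>

lemma (in flc_space) mean_cocycle_kernel_trivial:
  assumes \<alpha>: "strong_cocycle \<Omega> \<alpha>" and \<mu>: "uniquely_ergodic \<Omega> \<mu>"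
    and C: "C \<ge> 0" "\<And>T z. T \<in> \<Omega> \<Longrightarrow> norm z \<le> C * norm (\<alpha> T z) + C"
    and mean: "(\<integral>T. \<alpha> T v \<partial>\<mu>) = 0"
  shows "v = 0"
proof (rule ccontr)
  assume "v \<noteq> 0"
  interpret ergodic_action \<mu> shift using \<mu> by (rule ergodic_action_shift)
  have inv: "invariant_prob \<Omega> \<mu>" using \<mu> by (simp add: uniquely_ergodic_def)
  then have sp: "space \<mu> = \<Omega>" by (simp add: invariant_prob_def)
  obtain B where B: "\<And>T u. T \<in> \<Omega> \<Longrightarrow> norm u \<le> norm v \<Longrightarrow> norm (\<alpha> T u) \<le> B"
    using strong_cocycle_bounded[OF \<alpha>] by blast
  have Bv: "norm (\<alpha> T v) \<le> B" if "T \<in> space \<mu>" for T using B that by (simp add: sp)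
  note meas = strong_cocycle_measurable[OF \<alpha> inv]
  define \<epsilon> where "\<epsilon> = norm v / (2 * (C + 1))"
  have e: "\<epsilon> > 0" using \<open>v \<noteq> 0\<close> C(1) by (simp add: \<epsilon>_def)
  obtain g where g: "g \<in> translate_averages shift (\<lambda>T. \<alpha> T v)" "(\<integral>T. norm (g T) \<partial>\<mu>) < \<epsilon>"
    using averages_tendsto_mean[OF meas[of v] _ e, of B] Bv unfolding mean by auto
  have gm [measurable]: "g \<in> borel_measurable \<mu>" and gb: "\<And>T. T \<in> space \<mu> \<Longrightarrow> norm (g T) \<le> B"
    using translate_average[OF meas[of v] _ g(1), of B] Bv by blast+
  obtain D where D: "\<And>T L. T \<in> \<Omega> \<Longrightarrow> norm ((\<Sum>k<L. g (shift (real k *\<^sub>R v) T)) - \<alpha> T (real L *\<^sub>R v)) \<le> D"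
    using sum_translate_average[OF \<alpha> g(1)] by blast
  have small: "\<exists>T\<in>\<Omega>. norm (\<Sum>k<L. g (shift (real k *\<^sub>R v) T)) \<le> real L * \<epsilon>" if L: "L > 0" for L
  proof (rule ccontr)
    assume "\<not> ?thesis"
    then have large: "real L * \<epsilon> \<le> (\<Sum>k<L. norm (g (shift (real k *\<^sub>R v) T)))" if "T \<in> \<Omega>" for T
      using that norm_sum[of "\<lambda>k. g (shift (real k *\<^sub>R v) T)" "{..<L}"] by (meson le_less_linear order_trans less_imp_le)
    have int: "integrable \<mu> (\<lambda>T. norm (g (shift s T)))" for s
      by (rule integrable_const_bound[where B = B]) (use gb action_space in auto)
    have "real L * \<epsilon> \<le> (\<integral>T. (\<Sum>k<L. norm (g (shift (real k *\<^sub>R v) T))) \<partial>\<mu>)"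
      using int large by (intro integral_ge_const Bochner_Integration.integrable_sum) (auto simp: sp)
    also have "\<dots> = (\<Sum>k<L. \<integral>T. norm (g (shift (real k *\<^sub>R v) T)) \<partial>\<mu>)"
      using int by (intro Bochner_Integration.integral_sum) auto
    also have "\<dots> = real L * (\<integral>T. norm (g T) \<partial>\<mu>)"
      using integral_action[of "\<lambda>T. norm (g T)"] by simp
    also have "\<dots> < real L * \<epsilon>" using g(2) L by simp
    finally show False by simp
  qed
  have "real L * (norm v / 2) \<le> C * D + C" if L: "L > 0" for L
  proof -
    obtain T where T: "T \<in> \<Omega>" "norm (\<Sum>k<L. g (shift (real k *\<^sub>R v) T)) \<le> real L * \<epsilon>" using small[OF L] by blast
    have "norm (\<alpha> T (real L *\<^sub>R v)) \<le> real L * \<epsilon> + D"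
      using norm_triangle_sub[of "\<alpha> T (real L *\<^sub>R v)" "\<Sum>k<L. g (shift (real k *\<^sub>R v) T)"] D[OF T(1), of L] T(2)
      by (simp add: norm_minus_commute)
    then have "C * norm (\<alpha> T (real L *\<^sub>R v)) \<le> C * (real L * \<epsilon> + D)" using C(1) by (rule mult_left_mono)
    then have "real L * norm v \<le> C * (real L * \<epsilon> + D) + C"
      using C(2)[OF T(1), of "real L *\<^sub>R v"] by simp
    moreover have "C * \<epsilon> \<le> norm v / 2"
      using C(1) by (simp add: \<epsilon>_def divide_simps mult_mono algebra_simps)
    then have "real L * (C * \<epsilon>) \<le> real L * (norm v / 2)" by (intro mult_left_mono) auto
    ultimately show ?thesis by (simp add: algebra_simps)
  qed
  moreover have "norm v / 2 > 0" using \<open>v \<noteq> 0\<close> by simp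
  then obtain n where "real n * (norm v / 2) > C * D + C"
    using reals_Archimedean3 by blast
  moreover have "real n * (norm v / 2) \<le> real (Suc n) * (norm v / 2)" by (intro mult_right_mono) auto
  ultimately show False using \<open>v \<noteq> 0\<close> by (meson less_le_trans not_less zero_less_Suc)
qed

lemma (in flc_space) mean_cocycle_linear:
  assumes \<alpha>: "strong_cocycle \<Omega> \<alpha>" and \<mu>: "uniquely_ergodic \<Omega> \<mu>"
  shows "linear (\<lambda>v. \<integral>T. \<alpha> T v \<partial>\<mu>)"
proof (rule additive_bounded_imp_linear)
  interpret ergodic_action \<mu> shift using \<mu> by (rule ergodic_action_shift)
  have inv: "invariant_prob \<Omega> \<mu>" using \<mu> by (simp add: uniquely_ergodic_def)
  then have sp: "space \<mu> = \<Omega>" by (simp add: invariant_prob_def)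
  note [measurable] = strong_cocycle_measurable[OF \<alpha> inv]
  have int: "integrable \<mu> (\<lambda>T. \<alpha> T v)" for v
  proof -
    obtain B where "\<And>T u. T \<in> \<Omega> \<Longrightarrow> norm u \<le> norm v \<Longrightarrow> norm (\<alpha> T u) \<le> B"
      using strong_cocycle_bounded[OF \<alpha>] by blast
    then show ?thesis by (intro integrable_const_bound[where B = B]) (auto simp: sp)
  qed
  show "(\<integral>T. \<alpha> T (x + y) \<partial>\<mu>) = (\<integral>T. \<alpha> T x \<partial>\<mu>) + (\<integral>T. \<alpha> T y \<partial>\<mu>)" for x y
  proof -
    have "(\<integral>T. \<alpha> T (x + y) \<partial>\<mu>) = (\<integral>T. \<alpha> T x + \<alpha> (shift x T) y \<partial>\<mu>)"
      by (rule Bochner_Integration.integral_cong) (simp_all add: sp strong_cocycleD(1)[OF \<alpha>])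
    also have "\<dots> = (\<integral>T. \<alpha> T x \<partial>\<mu>) + (\<integral>T. \<alpha> (shift x T) y \<partial>\<mu>)"
    proof (rule Bochner_Integration.integral_add[OF int])
      show "integrable \<mu> (\<lambda>T. \<alpha> (shift x T) y)"
        using integrable_distr_eq[OF measurable_action[of x], of "\<lambda>T. \<alpha> T y"] int[of y] preserving[of x] by simp
    qed
    finally show ?thesis using integral_action[of "\<lambda>T. \<alpha> T y" x] by simp
  qed
  show "\<exists>B. \<forall>v. norm v \<le> r \<longrightarrow> norm (\<integral>T. \<alpha> T v \<partial>\<mu>) \<le> B" for r
  proof -
    obtain B where B: "\<And>T u. T \<in> \<Omega> \<Longrightarrow> norm u \<le> r \<Longrightarrow> norm (\<alpha> T u) \<le> B"
      using strong_cocycle_bounded[OF \<alpha>] by blast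
    have "norm (\<integral>T. \<alpha> T v \<partial>\<mu>) \<le> B" if "norm v \<le> r" for v
    proof -
      have "norm (\<integral>T. \<alpha> T v \<partial>\<mu>) \<le> (\<integral>T. norm (\<alpha> T v) \<partial>\<mu>)" by (rule integral_norm_bound)
      also have "\<dots> \<le> B" using int[of v] B that by (intro integral_le_const) (auto simp: sp)
      finally show ?thesis .
    qed
    then show ?thesis by blast
  qed
qed


section \<open>Invertibility of the Ruelle--Sullivan matrix\<close>

text \<open>The orbit cocycle of the inverse inverts the orbit cocycle, and it grows at most linearly.\<close>

lemma orbit_cocycle_lower_bound:
  assumes "flc_map \<Omega> \<Omega>' h" "flc_map \<Omega>' \<Omega> k" and kh: "\<And>T. T \<in> \<Omega> \<Longrightarrow> k (h T) = T"
  obtains C where "C \<ge> 0"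
    "\<And>T z. T \<in> \<Omega> \<Longrightarrow> norm z \<le> C * norm (flc_map.orbit_cocycle h T z) + C"
proof -
  interpret H: flc_map \<Omega> \<Omega>' h by fact
  interpret K: flc_map \<Omega>' \<Omega> k by fact
  obtain C where C: "C \<ge> 0" "\<And>T z. T \<in> \<Omega>' \<Longrightarrow> norm (K.orbit_cocycle T z) \<le> C * norm z + C"
    using K.orbit_cocycle_growth by blast
  have "norm z \<le> C * norm (H.orbit_cocycle T z) + C" if T: "T \<in> \<Omega>" for T z
  proof -
    have "k (shift (H.orbit_cocycle T z) (h T)) = k (h (shift z T))" using H.orbit_cocycle[OF T] by simp
    also have "\<dots> = shift z (k (h T))" using kh T by simp
    finally have "K.orbit_cocycle (h T) (H.orbit_cocycle T z) = z"
      by (rule K.orbit_cocycle_unique[OF H.h_in[OF T]])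
    then show ?thesis using C(2)[OF H.h_in[OF T], of "H.orbit_cocycle T z"] by simp
  qed
  then show ?thesis using that C(1) by blast
qed

context flc_map
begin

text \<open>
  The pullback of the fundamental shape class is the class of a strong cocycle, so it has a preimage
  under the canonical map from strong cohomology, and every member of the chosen preimage has the
  Cech class of the map.
\<close>

lemma homeo_class_members:
  obtains \<alpha>0 where "homeo_class \<Omega> \<Omega>' h = strong_cohomologous \<Omega> `` {\<alpha>0}" "strong_cocycle \<Omega> \<alpha>0"
    "\<And>\<alpha>. \<alpha> \<in> homeo_class \<Omega> \<Omega>' h \<Longrightarrow> strong_cocycle \<Omega> \<alpha> \<and>
       cech_cohomologous (space_topology \<Omega>) (cech_of_cocycle \<Omega> \<alpha>) map_cech"
proof -
  let ?X = "space_topology \<Omega>"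
  define P where "P = cech_pullback ?X (space_topology \<Omega>') h (strong_to_cech \<Omega>' (fundamental_shape_class \<Omega>'))"
  have P: "P = cech_class ?X map_cech"
    unfolding P_def fundamental_shape_class_def cod.strong_to_cech_class[OF fundamental_cocycle] map_cech_def
    by (rule cech_pullback_class[OF h cod.cech_cocycle_of_cocycle[OF fundamental_cocycle]])
  obtain \<beta> where \<beta>: "strong_cocycle \<Omega> \<beta>" "cech_cohomologous ?X (cech_of_cocycle \<Omega> \<beta>) map_cech"
    using strong_representative by blast
  have "strong_to_cech \<Omega> (strong_cohomologous \<Omega> `` {\<beta>}) = P"
    unfolding P dom.strong_to_cech_class[OF \<beta>(1)]
    by (rule cech_class_eq[OF dom.cech_cocycle_of_cocycle[OF \<beta>(1)] map_cech_cocycle \<beta>(2)])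
  moreover have "strong_cohomologous \<Omega> `` {\<beta>} \<in> strong_H1 \<Omega>"
    unfolding strong_H1_def using \<beta>(1) by (intro quotientI) simp
  ultimately have "P \<in> strong_to_cech \<Omega> ` strong_H1 \<Omega>" by blast
  then have a: "homeo_class \<Omega> \<Omega>' h \<in> strong_H1 \<Omega>" "strong_to_cech \<Omega> (homeo_class \<Omega> \<Omega>' h) = P"
    unfolding homeo_class_def P_def[symmetric] by (simp_all add: inv_into_into f_inv_into_f)
  then obtain \<alpha>0 where \<alpha>0: "homeo_class \<Omega> \<Omega>' h = strong_cohomologous \<Omega> `` {\<alpha>0}" "strong_cocycle \<Omega> \<alpha>0"
    unfolding strong_H1_def quotient_def by blast
  have eq: "cech_class ?X (cech_of_cocycle \<Omega> \<alpha>0) = cech_class ?X map_cech"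
    using a(2) unfolding \<alpha>0(1) dom.strong_to_cech_class[OF \<alpha>0(2)] P .
  have coh0: "cech_cohomologous ?X (cech_of_cocycle \<Omega> \<alpha>0) map_cech"
    by (rule cech_cohomologous_if_class_eq[OF eq dom.cech_cocycle_of_cocycle[OF \<alpha>0(2)]])
  have "strong_cocycle \<Omega> \<alpha> \<and> cech_cohomologous ?X (cech_of_cocycle \<Omega> \<alpha>) map_cech"
    if "\<alpha> \<in> homeo_class \<Omega> \<Omega>' h" for \<alpha>
  proof -
    have *: "(\<alpha>0, \<alpha>) \<in> strong_cohomologous \<Omega>" using that unfolding \<alpha>0(1) by simp
    then have "strong_cocycle \<Omega> \<alpha>" by (simp add: strong_cohomologous_def)
    moreover have "cech_cohomologous ?X (cech_of_cocycle \<Omega> \<alpha>) (cech_of_cocycle \<Omega> \<alpha>0)"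
      by (rule cech_cohomologous_sym[OF dom.cech_cohomologous_of_strong_cohomologous[OF *]])
    ultimately show ?thesis
      using cech_cohomologous_trans[OF _ coh0 dom.cech_cocycle_of_cocycle[OF \<alpha>0(2)]] by blast
  qed
  then show ?thesis using that \<alpha>0 by blast
qed

end

theorem theorem1p4:
  fixes \<Omega> :: "('d::finite, 'l::metric_space) pattern set"
    and \<Omega>' :: "('d, 'm::metric_space) pattern set"
    and h :: "('d, 'l) pattern \<Rightarrow> ('d, 'm) pattern"
    and \<mu> :: "('d, 'l) pattern measure"
  assumes "tiling_space \<Omega>" "minimal_space \<Omega>" "aperiodic_space \<Omega>" "flc \<Omega>"
    and "tiling_space \<Omega>'" "minimal_space \<Omega>'" "aperiodic_space \<Omega>'" "flc \<Omega>'"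
    and "uniquely_ergodic \<Omega> \<mu>"
    and "homeomorphic_map (space_topology \<Omega>) (space_topology \<Omega>') h"
  shows "invertible (matrix (ruelle_sullivan \<mu> (homeo_class \<Omega> \<Omega>' h)))"
proof -
  obtain k where k: "homeomorphic_maps (space_topology \<Omega>) (space_topology \<Omega>') h k"
    using assms(10) homeomorphic_map_maps by blast
  then have cont: "continuous_map (space_topology \<Omega>) (space_topology \<Omega>') h"
    "continuous_map (space_topology \<Omega>') (space_topology \<Omega>) k" and kh: "\<And>T. T \<in> \<Omega> \<Longrightarrow> k (h T) = T"
    by (simp_all add: homeomorphic_maps_def)
  interpret H: flc_map \<Omega> \<Omega>' h by unfold_locales (use assms cont in auto)
  interpret K: flc_map \<Omega>' \<Omega> k by unfold_locales (use assms cont in auto)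
  obtain \<alpha>0 where \<alpha>0: "homeo_class \<Omega> \<Omega>' h = strong_cohomologous \<Omega> `` {\<alpha>0}" "strong_cocycle \<Omega> \<alpha>0"
    and members: "\<And>\<alpha>. \<alpha> \<in> homeo_class \<Omega> \<Omega>' h \<Longrightarrow> strong_cocycle \<Omega> \<alpha> \<and>
       cech_cohomologous (space_topology \<Omega>) (cech_of_cocycle \<Omega> \<alpha>) H.map_cech"
    using H.homeo_class_members by blast
  define \<alpha> where "\<alpha> = (SOME \<alpha>. \<alpha> \<in> homeo_class \<Omega> \<Omega>' h)"
  have "\<alpha>0 \<in> homeo_class \<Omega> \<Omega>' h" using H.dom.strong_cohomologous_refl[OF \<alpha>0(2)] by (simp add: \<alpha>0(1))
  then have "\<alpha> \<in> homeo_class \<Omega> \<Omega>' h" unfolding \<alpha>_def 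
    by (rule someI[where P = "\<lambda>\<alpha>. \<alpha> \<in> homeo_class \<Omega> \<Omega>' h"])
  then have \<alpha>: "strong_cocycle \<Omega> \<alpha>"
    "cech_cohomologous (space_topology \<Omega>) (cech_of_cocycle \<Omega> \<alpha>) H.map_cech"
    using members by blast+
  obtain B where B: "\<And>T v. T \<in> \<Omega> \<Longrightarrow> norm (\<alpha> T v - H.orbit_cocycle T v) \<le> B"
    using H.cohomologous_imp_bounded_difference[OF \<alpha>] by blast
  obtain C where C: "C \<ge> 0" "\<And>T z. T \<in> \<Omega> \<Longrightarrow> norm z \<le> C * norm (H.orbit_cocycle T z) + C"
    using orbit_cocycle_lower_bound[OF H.flc_map_axioms K.flc_map_axioms kh] by blast
  define C' where "C' = C + C * \<bar>B\<bar>"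
  have "norm z \<le> C' * norm (\<alpha> T z) + C'" if T: "T \<in> \<Omega>" for T z
  proof -
    have "norm (H.orbit_cocycle T z) \<le> norm (\<alpha> T z) + \<bar>B\<bar>"
      using B[OF T, of z] norm_triangle_sub[of "H.orbit_cocycle T z" "\<alpha> T z"]
      by (simp add: norm_minus_commute)
    then have "C * norm (H.orbit_cocycle T z) \<le> C * (norm (\<alpha> T z) + \<bar>B\<bar>)" using C(1) by (rule mult_left_mono)
    moreover have "0 \<le> C * \<bar>B\<bar> * norm (\<alpha> T z)" using C(1) by simp
    ultimately show ?thesis using C(2)[OF T, of z] by (simp add: C'_def algebra_simps)
  qed
  moreover have "C' \<ge> 0" using C(1) by (simp add: C'_def)
  ultimately have ker: "v = 0" if "(\<integral>T. \<alpha> T v \<partial>\<mu>) = 0" for v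
    using H.dom.mean_cocycle_kernel_trivial[OF \<alpha>(1) assms(9) _ _ that] by blast
  have eq: "ruelle_sullivan \<mu> (homeo_class \<Omega> \<Omega>' h) = (\<lambda>v. \<integral>T. \<alpha> T v \<partial>\<mu>)"
    by (rule ext) (simp add: ruelle_sullivan_def \<alpha>_def)
  have lin: "linear (\<lambda>v. \<integral>T. \<alpha> T v \<partial>\<mu>)"
    by (rule H.dom.mean_cocycle_linear[OF \<alpha>(1) assms(9)])
  then have "inj (\<lambda>v. \<integral>T. \<alpha> T v \<partial>\<mu>)"
    using ker linear_injective_0 by blast
  then have "inj ((*v) (matrix (\<lambda>v. \<integral>T. \<alpha> T v \<partial>\<mu>)))"
    using matrix_vector_mul(2)[OF lin] by simp
  then show ?thesis
    unfolding eq invertible_left_inverse matrix_left_invertible_injective .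
qed

end
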